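(* Let $p$ be a prime and $1\le k,n<p$ distinct integers, let $r=\gcd(k,n)$ and $s=\gcd(r,p-1)$, and assume $r\le 0.5\sqrt n$. Let $$M_{k,n}=\max_{\substack{a,b\in\mathbb Z\\ \gcd(ab,p)=1}}\left|\sum_{x=0}^{p-1}\mathbf e_p(ax^k+bx^n)\right|.$$ Then $$M_{k,n}\ll \frac{k^{1/4}n^{1/8}s^{1/2}p^{3/4}}{r^{1/4}}+\left(\frac{kn}{r}\right)^{1/3}s^{1/2}p^{2/3}.$$
   Context: $\mathbf e_p(x)=e^{2\pi i x/p}$. The notation $U\ll V$ means $|U|\le cV$ for an absolute constant $c>0$. *)

theory Defs
  imports "HOL-Analysis.Analysis" "HOL-Computational_Algebra.Primes"
begin

definition e_mod :: "nat \<Rightarrow> int \<Rightarrow> complex" where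
  "e_mod p x = exp (2 * of_real pi * \<i> * of_int x / of_nat p)"

definition binomial_exp_sum :: "nat \<Rightarrow> nat \<Rightarrow> nat \<Rightarrow> int \<Rightarrow> int \<Rightarrow> complex" where
  "binomial_exp_sum p k n a b = (\<Sum>x = 0..<p. e_mod p (a * int x ^ k + b * int x ^ n))"

text \<open>The set of values is finite for \<open>p > 0\<close> because the sums depend only on the
  residues of \<open>a\<close> and \<open>b\<close> modulo \<open>p\<close> (lemma \<open>finite_exp_sum_norms\<close> below), so
  \<open>Max\<close> is a genuine maximum.\<close>
definition max_exp_sum :: "nat \<Rightarrow> nat \<Rightarrow> nat \<Rightarrow> real" where
  "max_exp_sum p k n =
     Max {cmod (binomial_exp_sum p k n a b) | a b :: int. gcd (a * b) (int p) = 1}"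

lemma e_mod_add_mult:
  assumes "p > 0"
  shows "e_mod p (x + int p * m) = e_mod p x"
proof -
  have "2 * complex_of_real pi * \<i> * of_int (x + int p * m) / of_nat p
      = 2 * of_real pi * \<i> * of_int x / of_nat p + 2 * of_int m * of_real pi * \<i>"
    using assms by (simp add: field_simps)
  moreover have "exp (2 * of_int m * complex_of_real pi * \<i>) = 1"
    using exp_integer_2pi[of "of_int m"] by simp
  ultimately show ?thesis by (simp add: e_mod_def exp_add)
qed

lemma e_mod_cong:
  assumes "p > 0" "x mod int p = y mod int p"
  shows "e_mod p x = e_mod p y"
  by (metis assms e_mod_add_mult mod_mult_div_eq)

lemma binomial_exp_sum_mod:
  assumes "p > 0"
  shows "binomial_exp_sum p k n (a mod int p) (b mod int p) = binomial_exp_sum p k n a b"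
  unfolding binomial_exp_sum_def
proof (intro sum.cong refl e_mod_cong assms)
  fix x :: nat
  show "(a mod int p * int x ^ k + b mod int p * int x ^ n) mod int p
      = (a * int x ^ k + b * int x ^ n) mod int p"
    by (intro mod_add_cong) (rule mod_mult_left_eq)+
qed

lemma finite_exp_sum_norms:
  assumes "p > 0"
  shows "finite {cmod (binomial_exp_sum p k n a b) | a b :: int. gcd (a * b) (int p) = 1}"
proof (rule finite_subset)
  let ?R = "{0..<int p} \<times> {0..<int p}"
  show "{cmod (binomial_exp_sum p k n a b) | a b :: int. gcd (a * b) (int p) = 1}
      \<subseteq> (\<lambda>(a, b). cmod (binomial_exp_sum p k n a b)) ` ?R"
  proof clarify
    fix a b :: int
    have "(a mod int p, b mod int p) \<in> ?R" using assms by simp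
    then show "cmod (binomial_exp_sum p k n a b)
        \<in> (\<lambda>(a, b). cmod (binomial_exp_sum p k n a b)) ` ?R"
      by (rule rev_image_eqI) (simp add: binomial_exp_sum_mod[OF assms])
  qed
qed simp

end

theory Submission
  imports Defs "Berlekamp_Zassenhaus.Finite_Field" "Jordan_Normal_Form.Determinant"
    "HOL-Library.Function_Algebras" "HOL-Computational_Algebra.Formal_Power_Series"
begin

hide_const (open) up_ring.coeff up_ring.monom Module.smult
no_notation Matrix.vec_index (infixl "$" 100)
unbundle no vec_syntax
unbundle fps_syntax

text \<open>
  Write \<open>r = gcd k n\<close>, \<open>k = r k'\<close>, \<open>n = r n'\<close>, \<open>D = k n' = n k'\<close>, and assume \<open>k < n\<close>.
  Since \<open>(a t^k, b t^n)\<close> gives the same sum as \<open>(a, b)\<close>, the fourth moment over all coefficients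
  bounds a single sum by the number of points of \<open>x^k + y^k = 1 + z^k\<close>, \<open>x^n + y^n = 1 + z^n\<close>.
  Eliminating \<open>z\<close> gives a plane curve of degree \<open>D\<close>, whose points are counted by the method of
  Stohr and Voloch: a Frobenius Wronskian of the monomials of degree at most \<open>m\<close> has degree
  \<open>O(p m + m^4 D)\<close> and vanishes to order about \<open>m^2 / 2\<close> at every smooth rational point, so there are
  \<open>O(p D / m + m^2 D^2)\<close> such points. This needs that no polynomial of degree at most \<open>m\<close> vanishes
  on a branch of the curve. On a branch where one does, logarithmic differentiation turns the two
  equations into a linear relation with low-degree coefficients between the six monomials
  \<open>x^k y^n, x^n y^k, x^n, x^k, y^n, y^k\<close>; an argument in the style of Mason's theorem splits it into
  vanishing subsums, which is impossible for \<open>m\<close> small against \<open>sqrt n\<close> unless the branch lies on one of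
  the few lines contained in the curve. The choice \<open>m = c min(sqrt n, (p/D)^(1/3))\<close> gives the theorem.
\<close>

section \<open>Functions of low degree\<close>

text \<open>The curve may be reducible and singular, so degrees are never read off a component. A
  smooth rational point enters as the power series branch through it, with x minus its value as
  parameter, and every degree statement is a dimension count: modulo one relation of degree D, the
  functions of degree at most E span a space of dimension at most D (E + 1). Powers of a fixed
  function outgrow this space unless its zeros, or an exponent, are bounded; intersection numbers
  and heights both arise this way.

  The two terms of the theorem come from the two values of p D / m. The constraint m << sqrt n is
  due to branches of low degree, and at m = (p / D)^(1/3) the quantities p D / m and m^2 D^2
  balance. The factor s^(1/2) is the fourth root of s^2: one s counts the t that give the same pair
  of coefficients, the other the z above one pair (x, y). The hypothesis on r controls the lines on
  the curve, which carry O(p s) points with s <= r.\<close>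

inductive_set lowdeg :: "('a::field \<Rightarrow> 'r::comm_ring_1) \<Rightarrow> 'r \<Rightarrow> 'r \<Rightarrow> nat \<Rightarrow> 'r set"
  for \<kappa> x y E where
  monomial: "a + b \<le> E \<Longrightarrow> \<kappa> c * x ^ a * y ^ b \<in> lowdeg \<kappa> x y E"
| add: "f \<in> lowdeg \<kappa> x y E \<Longrightarrow> g \<in> lowdeg \<kappa> x y E \<Longrightarrow> f + g \<in> lowdeg \<kappa> x y E"

text \<open>The outer variable stands for y and the inner one for x, so
  \<open>coeff (coeff f j) i\<close> belongs to x^i y^j.\<close>

definition tdeg_le :: "'a::zero poly poly \<Rightarrow> nat \<Rightarrow> bool" where
  "tdeg_le f E \<longleftrightarrow> (\<forall>i j. i + j > E \<longrightarrow> coeff (coeff f j) i = 0)"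

lemma tdeg_le_mono: "tdeg_le f E \<Longrightarrow> E \<le> E' \<Longrightarrow> tdeg_le f E'"
  by (auto simp: tdeg_le_def)

lemma tdeg_le_diff: "tdeg_le f E \<Longrightarrow> tdeg_le g E \<Longrightarrow> tdeg_le (f - g) E"
  for f g :: "'a::comm_ring_1 poly poly"
  by (auto simp: tdeg_le_def)

lemma tdeg_le_mult:
  fixes f g :: "'a::comm_ring_1 poly poly"
  assumes "tdeg_le f E" "tdeg_le g E'"
  shows "tdeg_le (f * g) (E + E')"
  unfolding tdeg_le_def
proof (intro allI impI)
  fix i j :: nat assume ij: "E + E' < i + j"
  have "coeff (coeff (f * g) j) i =
      (\<Sum>b\<le>j. \<Sum>a\<le>i. coeff (coeff f b) a * coeff (coeff g (j - b)) (i - a))"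
    by (simp add: coeff_mult coeff_sum)
  also have "\<dots> = 0"
  proof (intro sum.neutral ballI)
    fix b a assume "b \<in> {..j}" "a \<in> {..i}"
    with ij have "a + b > E \<or> (i - a) + (j - b) > E'" by auto
    then show "coeff (coeff f b) a * coeff (coeff g (j - b)) (i - a) = 0"
      using assms by (auto simp: tdeg_le_def)
  qed
  finally show "coeff (coeff (f * g) j) i = 0" .
qed

lemma tdeg_le_power:
  fixes f :: "'a::comm_ring_1 poly poly"
  assumes "tdeg_le f E" shows "tdeg_le (f ^ n) (n * E)"
proof (induction n)
  case 0 show ?case by (auto simp: tdeg_le_def coeff_1 split: if_splits)
next
  case (Suc n) then show ?case using tdeg_le_mult[OF assms Suc] by simp
qed

lemma tdeg_le_exists: "\<exists>E. tdeg_le (f :: 'a::zero poly poly) E"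
proof -
  let ?S = "(\<lambda>j. degree (coeff f j)) ` {..degree f}"
  have "tdeg_le f (degree f + Max ?S)"
    unfolding tdeg_le_def
  proof (intro allI impI)
    fix i j :: nat assume ij: "degree f + Max ?S < i + j"
    show "coeff (coeff f j) i = 0"
    proof (cases "j \<le> degree f")
      case True
      then have "degree (coeff f j) \<le> Max ?S" by (intro Max_ge) auto
      with ij True have "i > degree (coeff f j)" by linarith
      then show ?thesis by (rule coeff_eq_0)
    next
      case False then show ?thesis by (simp add: coeff_eq_0)
    qed
  qed
  then show ?thesis by blast
qed

text \<open>Dividing by \<open>J\<close> and letting it grow removes the term \<open>E0 + 1\<close>.
  This is how dimension counts with a bounded error give intersection numbers and heights without
  loss.\<close>

lemma linear_growth_bound:
  fixes q D w E0 :: nat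
  assumes "\<And>J. J > 0 \<Longrightarrow> q * J \<le> D * (E0 + J * w + 1)"
  shows "q \<le> D * w"
proof (rule ccontr)
  assume "\<not> q \<le> D * w"
  then have q: "q \<ge> D * w + 1" by simp
  define J where "J = D * (E0 + 1) + 1"
  have "(D * w + 1) * J \<le> q * J" using q by (rule mult_le_mono1)
  also have "\<dots> \<le> D * (E0 + J * w + 1)" by (rule assms) (simp add: J_def)
  finally have "J \<le> D * (E0 + 1)" by (simp add: algebra_simps)
  then show False by (simp add: J_def)
qed

section \<open>Evaluation of polynomials in a ring and the space of functions of bounded
  degree\<close>

locale coeff_hom =
  fixes \<kappa> :: "'a::field \<Rightarrow> 'r::comm_ring_1"
  assumes hom_add: "\<kappa> (a + b) = \<kappa> a + \<kappa> b"
    and hom_mult: "\<kappa> (a * b) = \<kappa> a * \<kappa> b"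
    and hom_one: "\<kappa> 1 = 1"
begin

lemma hom_zero [simp]: "\<kappa> 0 = 0"
  using hom_add[of 0 0] by simp

lemma hom_uminus: "\<kappa> (- a) = - \<kappa> a"
  using hom_add[of a "- a"] by (simp add: eq_neg_iff_add_eq_0 add.commute)

lemma hom_diff: "\<kappa> (a - b) = \<kappa> a - \<kappa> b"
  using hom_add[of a "- b"] by (simp add: hom_uminus)

lemma hom_sum: "\<kappa> (sum f A) = (\<Sum>a\<in>A. \<kappa> (f a))"
  by (induction A rule: infinite_finite_induct) (auto simp: hom_add)

end

text \<open>The ring is left open: with power series it describes one branch, with functions into
  power series a whole family of branches on which the same polynomial is evaluated at once.\<close>

locale plane = coeff_hom \<kappa> for \<kappa> :: "'a::field \<Rightarrow> 'r::comm_ring_1" +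
  fixes x y :: 'r
begin

abbreviation "S \<equiv> lowdeg \<kappa> x y"

definition ev :: "'a poly poly \<Rightarrow> 'r" where
  "ev f = poly (map_poly (\<lambda>q. poly (map_poly \<kappa> q) x) f) y"

lemma S_mono: assumes "f \<in> S E" "E \<le> E'" shows "f \<in> S E'"
  using assms(1)
proof induction
  case (monomial a b c) then show ?case using assms(2) by (intro lowdeg.monomial) simp
qed (rule lowdeg.add)

lemmas S_add = lowdeg.add[of _ \<kappa> x y]

lemma S_const [simp]: "\<kappa> c \<in> S E"
  using lowdeg.monomial[of 0 0 E \<kappa> c x y] by simp

lemma S_zero [simp]: "0 \<in> S E" using S_const[of 0] by simp

lemma S_one [simp]: "1 \<in> S E" using S_const[of 1] by (simp add: hom_one)

lemma S_x: "x \<in> S 1" using lowdeg.monomial[of 1 0 1 \<kappa> 1 x y] by (simp add: hom_one)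

lemma S_y: "y \<in> S 1" using lowdeg.monomial[of 0 1 1 \<kappa> 1 x y] by (simp add: hom_one)

lemma S_sum: "(\<And>i. i \<in> A \<Longrightarrow> f i \<in> S E) \<Longrightarrow> sum f A \<in> S E"
  by (induction A rule: infinite_finite_induct) (auto intro: S_add)

lemma S_mult: assumes "f \<in> S E" "g \<in> S E'" shows "f * g \<in> S (E + E')"
  using assms(1)
proof induction
  case (monomial a b c)
  from assms(2) show ?case
  proof induction
    case (monomial a' b' c')
    have "\<kappa> c * x ^ a * y ^ b * (\<kappa> c' * x ^ a' * y ^ b') = \<kappa> (c * c') * x ^ (a + a') * y ^ (b + b')"
      by (simp add: hom_mult power_add algebra_simps)
    moreover have "\<dots> \<in> S (E + E')"
      using monomial \<open>a + b \<le> E\<close> by (intro lowdeg.monomial) simp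
    ultimately show ?case by simp
  next
    case (add f g) then show ?case by (simp add: distrib_left S_add)
  qed
next
  case (add f g') then show ?case by (simp add: distrib_right S_add)
qed

lemma S_uminus: "f \<in> S E \<Longrightarrow> - f \<in> S E"
  using S_mult[OF S_const[of "-1" 0], of f E] by (simp add: hom_uminus hom_one)

lemma S_diff: "f \<in> S E \<Longrightarrow> g \<in> S E \<Longrightarrow> f - g \<in> S E"
  using S_add[of f E "- g"] S_uminus[of g E] by simp

lemma S_smult: "f \<in> S E \<Longrightarrow> \<kappa> c * f \<in> S E"
  using S_mult[OF S_const[of c 0], of f E] by simp

lemma S_power: "f \<in> S E \<Longrightarrow> f ^ n \<in> S (n * E)"
  by (induction n) (auto dest: S_mult)

lemma S_prod: "(\<And>i. i \<in> A \<Longrightarrow> f i \<in> S (e i)) \<Longrightarrow> prod f A \<in> S (sum e A)"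
  by (induction A rule: infinite_finite_induct) (auto intro: S_mult)

lemma S_of_nat: "of_nat n * f \<in> S E" if "f \<in> S E"
proof -
  have "\<kappa> (of_nat n) = of_nat n" by (induction n) (auto simp: hom_add hom_one)
  then show ?thesis using S_smult[OF that, of "of_nat n"] by simp
qed

lemma ev_0 [simp]: "ev 0 = 0" by (simp add: ev_def)

lemma ev_pCons: "ev (pCons q f) = poly (map_poly \<kappa> q) x + y * ev f"
  by (subst ev_def, subst Polynomial.map_poly_pCons) (simp_all add: ev_def)

lemma map_add: "map_poly \<kappa> (p + q) = map_poly \<kappa> p + map_poly \<kappa> q"
  by (rule poly_eqI) (simp add: coeff_map_poly hom_add)

lemma map_mult: "map_poly \<kappa> (p * q) = map_poly \<kappa> p * map_poly \<kappa> q"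
  by (rule poly_eqI) (simp add: coeff_map_poly coeff_mult hom_sum hom_mult)

lemma ev_add: "ev (f + g) = ev f + ev g"
  by (induction f g rule: poly_induct2) (auto simp: ev_pCons map_add algebra_simps)

lemma ev_smult: "ev (smult q f) = poly (map_poly \<kappa> q) x * ev f"
  by (induction f) (auto simp: ev_pCons map_mult algebra_simps)

lemma ev_mult: "ev (f * g) = ev f * ev g"
  by (induction f) (auto simp: ev_pCons ev_add ev_smult algebra_simps)

lemma ev_1: "ev 1 = 1"
  by (simp add: one_pCons ev_pCons map_poly_pCons hom_one)

lemma ev_power: "ev (f ^ n) = ev f ^ n"
  by (induction n) (auto simp: ev_1 ev_mult)

lemma ev_diff: "ev (f - g) = ev f - ev g"
  using ev_add[of "f - g" g] by simp

lemma ev_sum: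
  assumes "tdeg_le f D"
  shows "ev f = (\<Sum>(i,j)\<in>{(i,j). i + j \<le> D}. \<kappa> (coeff (coeff f j) i) * x ^ i * y ^ j)"
proof -
  have deg_f: "degree f \<le> D"
  proof (rule degree_le, intro allI impI)
    fix j assume "D < j"
    then show "coeff f j = 0" using assms by (intro poly_eqI) (auto simp: tdeg_le_def)
  qed
  have deg_c: "degree (coeff f j) \<le> D" for j
    using assms by (intro degree_le) (auto simp: tdeg_le_def)
  have c1: "poly (map_poly \<kappa> q) x = (\<Sum>i\<le>D. \<kappa> (coeff q i) * x ^ i)" if "degree q \<le> D" for q
  proof -
    have "degree (map_poly \<kappa> q) \<le> D" using that degree_map_poly_le le_trans by blast
    then show ?thesis by (subst poly_as_sum_of_monoms'[symmetric, of _ D])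
        (auto simp: poly_sum poly_monom coeff_map_poly)
  qed
  have "degree (map_poly (\<lambda>q. poly (map_poly \<kappa> q) x) f) \<le> D"
    using deg_f degree_map_poly_le le_trans by blast
  then have "ev f = (\<Sum>j\<le>D. poly (map_poly \<kappa> (coeff f j)) x * y ^ j)"
    unfolding ev_def by (subst poly_as_sum_of_monoms'[symmetric, of _ D])
        (auto simp: poly_sum poly_monom coeff_map_poly)
  also have "\<dots> = (\<Sum>j\<le>D. \<Sum>i\<le>D. \<kappa> (coeff (coeff f j) i) * x ^ i * y ^ j)"
    by (simp add: c1 deg_c sum_distrib_right)
  also have "\<dots> = (\<Sum>(i,j)\<in>{..D}\<times>{..D}. \<kappa> (coeff (coeff f j) i) * x ^ i * y ^ j)"
    by (subst sum.swap) (simp add: sum.cartesian_product)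
  also have "\<dots> = (\<Sum>(i,j)\<in>{(i,j). i + j \<le> D}. \<kappa> (coeff (coeff f j) i) * x ^ i * y ^ j)"
  proof (rule sum.mono_neutral_right)
    show "\<forall>i\<in>{..D} \<times> {..D} - {(i, j). i + j \<le> D}.
       (case i of (i, j) \<Rightarrow> \<kappa> (coeff (coeff f j) i) * x ^ i * y ^ j) = 0"
    proof
      fix t assume t: "t \<in> {..D} \<times> {..D} - {(i, j). i + j \<le> D}"
      obtain i j where ij: "t = (i, j)" by (cases t)
      have "\<not> i + j \<le> D" using t ij by simp
      then have "coeff (coeff f j) i = 0" using assms unfolding tdeg_le_def by (meson not_le)
      then show "(case t of (i, j) \<Rightarrow> \<kappa> (coeff (coeff f j) i) * x ^ i * y ^ j) = 0" by (simp add: ij)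
    qed
  qed auto
  finally show ?thesis .
qed

lemma ev_in_S: "tdeg_le f E \<Longrightarrow> ev f \<in> S E"
  by (subst ev_sum, assumption) (auto intro!: S_sum lowdeg.monomial)

lemma finite_mon: "finite {(i,j). i + j \<le> (D::nat)}"
  by (rule finite_subset[of _ "{..D}\<times>{..D}"]) auto

definition combs :: "(nat \<times> nat) set \<Rightarrow> 'r set" where
  "combs B = {f. \<exists>d. f = (\<Sum>(i,j)\<in>B. \<kappa> (d (i,j)) * x ^ i * y ^ j)}"

lemma combs_add: assumes "f \<in> combs B" "g \<in> combs B" shows "f + g \<in> combs B"
proof -
  from assms obtain d e where "f = (\<Sum>(i,j)\<in>B. \<kappa> (d (i,j)) * x ^ i * y ^ j)"
    "g = (\<Sum>(i,j)\<in>B. \<kappa> (e (i,j)) * x ^ i * y ^ j)" by (auto simp: combs_def)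
  then have "f + g = (\<Sum>(i,j)\<in>B. \<kappa> ((\<lambda>t. d t + e t) (i,j)) * x ^ i * y ^ j)"
    by (simp add: hom_add distrib_right split_def flip: sum.distrib)
  then show ?thesis unfolding combs_def by (intro CollectI exI[of _ "\<lambda>t. d t + e t"]) simp
qed

lemma combs_smult: assumes "f \<in> combs B" shows "\<kappa> c * f \<in> combs B"
proof -
  from assms obtain d where "f = (\<Sum>(i,j)\<in>B. \<kappa> (d (i,j)) * x ^ i * y ^ j)"
    by (auto simp: combs_def)
  then have "\<kappa> c * f = (\<Sum>(i,j)\<in>B. \<kappa> ((\<lambda>t. c * d t) (i,j)) * x ^ i * y ^ j)"
    by (simp add: hom_mult sum_distrib_left split_def mult.assoc)
  then show ?thesis unfolding combs_def by (intro CollectI exI[of _ "\<lambda>t. c * d t"]) simp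
qed

lemma combs_0: "0 \<in> combs B"
  unfolding combs_def by (auto intro!: exI[of _ "\<lambda>_. 0"])

lemma combs_sum: "(\<And>i. i \<in> A \<Longrightarrow> f i \<in> combs B) \<Longrightarrow> sum f A \<in> combs B"
  by (induction A rule: infinite_finite_induct) (auto intro: combs_add simp: combs_0)

lemma combs_monomial:
  assumes "finite B" "(a,b) \<in> B" shows "x ^ a * y ^ b \<in> combs B"
proof -
  have "(\<Sum>(i,j)\<in>B. \<kappa> ((\<lambda>t. if t = (a,b) then 1 else 0) (i,j)) * x ^ i * y ^ j)
     = (\<Sum>t\<in>B. if t = (a,b) then x ^ a * y ^ b else 0)"
    by (intro sum.cong) (auto simp: hom_one split: if_splits)
  also have "\<dots> = x ^ a * y ^ b" using assms by simp
  finally show ?thesis unfolding combs_def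
    by (intro CollectI exI[of _ "\<lambda>t. if t = (a,b) then 1 else 0"]) (rule sym)
qed

text \<open>Let (\<alpha>, \<beta>) be the exponent of the leading monomial of the relation in
  graded order. Every monomial divisible by it can be rewritten by smaller ones without raising the
  degree, so the monomials with a < \<alpha> or b < \<beta> span; there are at most (\<alpha> +
  \<beta>) (E + 1) of them.\<close>

lemma S_spanned:
  assumes "ev f = 0" "f \<noteq> 0" "tdeg_le f D"
  obtains B where "finite B" "card B \<le> D * (E + 1)" "S E \<subseteq> combs B"
proof -
  define c where "c = (\<lambda>(i,j). coeff (coeff f j) i)"
  define supp where "supp = {t. c t \<noteq> 0}"
  have supp_sub: "supp \<subseteq> {(i,j). i + j \<le> D}"
  proof clarify
    fix i j assume "(i,j) \<in> supp"
    then have "coeff (coeff f j) i \<noteq> 0" by (simp add: supp_def c_def)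
    then show "i + j \<le> D" using assms(3) unfolding tdeg_le_def by (metis not_le)
  qed
  then have fin: "finite supp" using finite_mon finite_subset by blast
  have "supp \<noteq> {}"
  proof
    assume "supp = {}"
    then have "f = 0" by (intro poly_eqI) (auto simp: supp_def c_def)
    then show False using assms by simp
  qed
  \<comment> \<open>The graded lexicographic order encoded as one number: exponents in
    \<open>supp\<close> are at most \<open>D\<close>, so the factor \<open>D + 1\<close> keeps the
    total degree dominant.\<close>
  define key where "key = (\<lambda>(i,j). (i + j) * (D + 1) + (i::nat))"
  obtain t0 where t0: "t0 \<in> supp" "\<And>t. t \<in> supp \<Longrightarrow> key t \<le> key t0"
  proof -
    obtain t where t: "t \<in> supp" "key t = Max (key ` supp)"
      using obtains_MAX[OF fin \<open>supp \<noteq> {}\<close>, of key] by metis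
    have "key u \<le> key t" if "u \<in> supp" for u
      unfolding t(2) using fin that by (intro Max_ge) auto
    with t(1) that show ?thesis by blast
  qed
  obtain \<alpha> \<beta> where ab: "t0 = (\<alpha>, \<beta>)" by (cases t0)
  have abD: "\<alpha> + \<beta> \<le> D" using t0(1) ab supp_sub by auto
  have c0: "c (\<alpha>,\<beta>) \<noteq> 0" using t0 ab by (auto simp: supp_def)
  have smaller: "i + j < \<alpha> + \<beta> \<or> (i + j = \<alpha> + \<beta> \<and> i < \<alpha>)"
    if "(i,j) \<in> supp" "(i,j) \<noteq> (\<alpha>,\<beta>)" for i j
  proof (rule ccontr)
    assume n: "\<not> ?thesis"
    have le: "key (i,j) \<le> key (\<alpha>,\<beta>)" using t0(2)[OF that(1)] ab by simp
    have iD: "i \<le> D" "\<alpha> \<le> D" using that supp_sub abD by auto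
    show False
    proof (cases "i + j = \<alpha> + \<beta>")
      case True then show False using n le that(2) by (auto simp: key_def)
    next
      case False
      then have "i + j \<ge> \<alpha> + \<beta> + 1" using n by auto
      then have "(i + j) * (D + 1) \<ge> (\<alpha> + \<beta> + 1) * (D + 1)" by (rule mult_le_mono1)
      then show False using le iD by (auto simp: key_def algebra_simps)
    qed
  qed
  define B where "B = {(a,b). a + b \<le> E \<and> (a < \<alpha> \<or> b < \<beta>)}"
  have B_sub: "B \<subseteq> ({..<\<alpha>}\<times>{..E}) \<union> ({..E}\<times>{..<\<beta>})" by (auto simp: B_def)
  have finB: "finite B" by (rule finite_subset[OF B_sub]) auto
  have "card B \<le> card (({..<\<alpha>}\<times>{..E}) \<union> ({..E}\<times>{..<\<beta>}))" by (rule card_mono[OF _ B_sub]) auto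
  also have "\<dots> \<le> \<alpha> * (E+1) + (E+1) * \<beta>" by (rule order_trans[OF card_Un_le]) simp
  also have "\<dots> = (\<alpha> + \<beta>) * (E + 1)" by (simp add: algebra_simps)
  also have "\<dots> \<le> D * (E + 1)" using abD by (rule mult_le_mono1)
  finally have cardB: "card B \<le> D * (E + 1)" .
  have lead: "x ^ \<alpha> * y ^ \<beta> = (\<Sum>(i,j)\<in>supp - {(\<alpha>,\<beta>)}. \<kappa> (- c (i,j) / c (\<alpha>,\<beta>)) * x ^ i * y ^ j)"
  proof -
    have "0 = (\<Sum>(i,j)\<in>{(i,j). i + j \<le> D}. \<kappa> (c (i,j)) * x ^ i * y ^ j)"
      using ev_sum[OF assms(3)] assms(1) by (simp add: c_def)
    also have "\<dots> = (\<Sum>(i,j)\<in>supp. \<kappa> (c (i,j)) * x ^ i * y ^ j)"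
      by (rule sum.mono_neutral_right[OF finite_mon supp_sub]) (auto simp: supp_def)
    also have "\<dots> = \<kappa> (c (\<alpha>,\<beta>)) * x ^ \<alpha> * y ^ \<beta> + (\<Sum>(i,j)\<in>supp - {(\<alpha>,\<beta>)}. \<kappa> (c (i,j)) * x ^ i * y ^ j)"
      by (subst sum.remove[OF fin t0(1)]) (simp add: ab)
    finally have *: "\<kappa> (c (\<alpha>,\<beta>)) * x ^ \<alpha> * y ^ \<beta> = - (\<Sum>(i,j)\<in>supp - {(\<alpha>,\<beta>)}. \<kappa> (c (i,j)) * x ^ i * y ^ j)"
      by (simp add: eq_neg_iff_add_eq_0)
    have "x ^ \<alpha> * y ^ \<beta> = \<kappa> (inverse (c (\<alpha>,\<beta>)) * c (\<alpha>,\<beta>)) * x ^ \<alpha> * y ^ \<beta>"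
      using c0 by (simp add: hom_one)
    also have "\<dots> = \<kappa> (inverse (c (\<alpha>,\<beta>))) * (\<kappa> (c (\<alpha>,\<beta>)) * x ^ \<alpha> * y ^ \<beta>)"
      by (simp add: hom_mult mult.assoc)
    also have "\<dots> = (\<Sum>(i,j)\<in>supp - {(\<alpha>,\<beta>)}. \<kappa> (- c (i,j) / c (\<alpha>,\<beta>)) * x ^ i * y ^ j)"
    proof -
      have t: "\<kappa> (inverse (c (\<alpha>,\<beta>))) * - (\<kappa> (c t) * u) = \<kappa> (- c t / c (\<alpha>,\<beta>)) * u" for t u
      proof -
        have "\<kappa> (- c t / c (\<alpha>,\<beta>)) = \<kappa> (inverse (c (\<alpha>,\<beta>)) * - c t)" by (simp add: divide_inverse mult.commute)
        then show ?thesis by (simp only: hom_mult hom_uminus) (simp add: algebra_simps)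
      qed
      show ?thesis
        unfolding * sum_negf[symmetric] sum_distrib_left
        by (intro sum.cong refl) (simp only: split_def t mult.assoc prod.collapse)
    qed
    finally show ?thesis .
  qed
  have mon: "x ^ a * y ^ b \<in> combs B" if "a + b \<le> E" for a b
    using that
  \<comment> \<open>The same order as \<open>key\<close>, now with room for exponents up to
    \<open>E\<close>.\<close>
  proof (induction "(a + b) * (E + 1) + a" arbitrary: a b rule: less_induct)
    case less
    show ?case
    proof (cases "(a,b) \<in> B")
      case True then show ?thesis by (rule combs_monomial[OF finB])
    next
      case False
      then have ge: "a \<ge> \<alpha>" "b \<ge> \<beta>" using less.prems by (auto simp: B_def)
      have "x ^ a * y ^ b = x ^ (a - \<alpha>) * y ^ (b - \<beta>) * (x ^ \<alpha> * y ^ \<beta>)"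
      proof -
        have "x ^ a = x ^ (a - \<alpha>) * x ^ \<alpha>" "y ^ b = y ^ (b - \<beta>) * y ^ \<beta>"
          using ge by (simp_all add: power_add[symmetric])
        then show ?thesis by (simp add: mult_ac)
      qed
      also have "\<dots> = (\<Sum>(i,j)\<in>supp - {(\<alpha>,\<beta>)}. \<kappa> (- c (i,j) / c (\<alpha>,\<beta>)) * (x ^ (a - \<alpha> + i) * y ^ (b - \<beta> + j)))"
        unfolding lead by (simp add: sum_distrib_left split_def power_add mult_ac)
      also have "\<dots> \<in> combs B"
      proof (intro combs_sum)
        fix t assume t: "t \<in> supp - {(\<alpha>,\<beta>)}"
        obtain i j where t_eq: "t = (i, j)" by (cases t)
        have ij: "(i,j) \<in> supp" "(i,j) \<noteq> (\<alpha>,\<beta>)" using t t_eq by auto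
        let ?a = "a - \<alpha> + i" and ?b = "b - \<beta> + j"
        from smaller[OF ij] have sm: "?a + ?b < a + b \<or> (?a + ?b = a + b \<and> ?a < a)" using ge by auto
        then have le: "?a + ?b \<le> E" using less.prems by auto
        have "(?a + ?b) * (E + 1) + ?a < (a + b) * (E + 1) + a"
        proof (cases "?a + ?b = a + b")
          case True then show ?thesis using sm by auto
        next
          case False
          then have "?a + ?b + 1 \<le> a + b" using sm by auto
          then have "(?a + ?b + 1) * (E + 1) \<le> (a + b) * (E + 1)" by (rule mult_le_mono1)
          then show ?thesis using le by (simp add: algebra_simps)
        qed
        from combs_smult[OF less.hyps[OF this le]]
        show "(case t of (i, j) \<Rightarrow> \<kappa> (- c (i,j) / c (\<alpha>,\<beta>)) * (x ^ (a - \<alpha> + i) * y ^ (b - \<beta> + j))) \<in> combs B"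
          by (simp add: t_eq)
      qed
      finally show ?thesis .
    qed
  qed
  have "S E \<subseteq> combs B"
  proof
    fix g assume "g \<in> S E"
    then show "g \<in> combs B"
    proof induction
      case (monomial a b d)
      then show ?case using combs_smult[OF mon[of a b], of d] by (simp add: mult.assoc)
    qed (rule combs_add)
  qed
  with finB cardB that show ?thesis by blast
qed

definition independent_family :: "'t set \<Rightarrow> ('t \<Rightarrow> 'r) \<Rightarrow> bool" where
  "independent_family T f \<longleftrightarrow> (\<forall>c. (\<Sum>t\<in>T. \<kappa> (c t) * f t) = 0 \<longrightarrow> (\<forall>t\<in>T. c t = 0))"

end

locale finite_plane = plane \<kappa> x y for \<kappa> :: "'a::{field,finite} \<Rightarrow> 'r::comm_ring_1" and x y
begin

text \<open>Dimension by counting: over a field with Q elements, the Q^(card T) combinations of an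
  independent family are distinct, and all lie among the at most Q^(card B) combinations of a
  spanning set.\<close>

lemma card_independent_family:
  assumes rel: "ev f = 0" "f \<noteq> 0" "tdeg_le f D"
    and T: "finite T" "\<And>t. t \<in> T \<Longrightarrow> g t \<in> S E" "independent_family T g"
  shows "card T \<le> D * (E + 1)"
proof -
  obtain B where B: "finite B" "card B \<le> D * (E + 1)" "S E \<subseteq> combs B"
    using S_spanned[OF rel] by blast
  define \<Phi> where "\<Phi> = (\<lambda>c. \<Sum>t\<in>T. \<kappa> (c t) * g t)"
  define \<Psi> where "\<Psi> = (\<lambda>d. \<Sum>(i,j)\<in>B. \<kappa> (d (i,j)) * x ^ i * y ^ j)"
  let ?T = "T \<rightarrow>\<^sub>E (UNIV :: 'a set)" and ?B = "B \<rightarrow>\<^sub>E (UNIV :: 'a set)"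
  have "inj_on \<Phi> ?T"
  proof (rule inj_onI)
    fix c d assume cd: "c \<in> ?T" "d \<in> ?T" "\<Phi> c = \<Phi> d"
    then have "(\<Sum>t\<in>T. \<kappa> (c t - d t) * g t) = 0"
      by (simp add: \<Phi>_def hom_diff left_diff_distrib sum_subtractf)
    then have "\<forall>t\<in>T. c t - d t = 0"
      using T(3)[unfolded independent_family_def, rule_format, of "\<lambda>t. c t - d t"] by blast
    then show "c = d" using cd by (intro PiE_ext) auto
  qed
  moreover have "\<Phi> ` ?T \<subseteq> \<Psi> ` ?B"
  proof clarify
    fix c
    have "\<Phi> c \<in> S E" unfolding \<Phi>_def by (intro S_sum S_smult T(2))
    then have "\<Phi> c \<in> combs B" using B by blast
    then obtain d where d: "\<Phi> c = (\<Sum>(i,j)\<in>B. \<kappa> (d (i,j)) * x ^ i * y ^ j)"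
      by (auto simp: combs_def)
    have "\<Phi> c = \<Psi> (restrict d B)" unfolding d \<Psi>_def by (intro sum.cong refl) auto
    moreover have "restrict d B \<in> ?B" by simp
    ultimately show "\<Phi> c \<in> \<Psi> ` ?B" by (rule image_eqI)
  qed
  moreover have "finite ?B" by (intro finite_PiE B(1)) simp
  ultimately have "card ?T \<le> card ?B"
    by (metis card_image surj_card_le)
  then have le: "CARD('a) ^ card T \<le> CARD('a) ^ card B"
    by (simp only: card_PiE[OF T(1)] card_PiE[OF B(1)] prod_constant)
  have "card {0, 1 :: 'a} \<le> CARD('a)" by (rule card_mono) auto
  then have "CARD('a) > 1" by (simp add: card_insert_if)
  with le have "card T \<le> card B" using power_le_imp_le_exp by blast
  with B(2) show ?thesis by simp
qed

end

section \<open>Intersection and height bounds\<close>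

lemma fun_sum_apply: "(sum f A) P = (\<Sum>a\<in>A. f a P)" for f :: "'t \<Rightarrow> 'i \<Rightarrow> 'r::comm_ring_1"
  by (induction A rule: infinite_finite_induct) auto

lemma fun_prod_apply: "(prod f A) P = (\<Prod>a\<in>A. f a P)" for f :: "'t \<Rightarrow> 'i \<Rightarrow> 'r::comm_ring_1"
  by (induction A rule: infinite_finite_induct) auto

lemma fun_power_apply: "(f ^ n) P = f P ^ n" for f :: "'i \<Rightarrow> 'r::comm_ring_1"
  by (induction n) auto

abbreviation fun_const :: "'a::field \<Rightarrow> 'i \<Rightarrow> 'a fps" where
  "fun_const c \<equiv> (\<lambda>_. fps_const c)"

interpretation fps_hom: coeff_hom "fps_const :: 'a::field \<Rightarrow> 'a fps"
  by unfold_locales auto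

interpretation fun_hom: coeff_hom "fun_const :: 'a::field \<Rightarrow> 'i \<Rightarrow> 'a fps"
  by unfold_locales (auto simp: fun_eq_iff)

section \<open>Order of vanishing and independence of powers\<close>

definition vanishes :: "'a::field fps \<Rightarrow> nat \<Rightarrow> bool" where
  "vanishes f M \<longleftrightarrow> (\<forall>j<M. f $ j = 0)"

lemma vanishes_mult: "vanishes f M \<Longrightarrow> vanishes (f * g) M"
  by (auto simp: vanishes_def fps_mult_nth intro!: sum.neutral)

lemma vanishes_mult_left: "vanishes g M \<Longrightarrow> vanishes (f * g) M"
  using vanishes_mult[of g M f] by (simp add: mult.commute)

lemma vanishes_add: "vanishes f M \<Longrightarrow> vanishes g M \<Longrightarrow> vanishes (f + g) M"
  by (simp add: vanishes_def)

lemma vanishes_uminus: "vanishes f M \<Longrightarrow> vanishes (- f) M"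
  by (simp add: vanishes_def)

lemma vanishes_sum: "(\<And>i. i \<in> A \<Longrightarrow> vanishes (f i) M) \<Longrightarrow> vanishes (sum f A) M"
  by (induction A rule: infinite_finite_induct) (auto intro: vanishes_add simp: vanishes_def)

lemma vanishes_power: "f $ 0 = 0 \<Longrightarrow> vanishes (f ^ M) M"
  using startsby_zero_power_prefix[of f M] by (simp add: vanishes_def)

lemma vanishes_cancel_unit:
  assumes "vanishes (f * u) M" "u $ 0 \<noteq> 0" shows "vanishes f M"
proof -
  have "u * inverse u = 1" using assms(2) by (simp add: inverse_mult_eq_1')
  then have "f = f * u * inverse u" by (simp add: mult.assoc)
  then show ?thesis using vanishes_mult[OF assms(1), of "inverse u"] by metis
qed

lemma fps_prod_nth_0: "(prod f A) $ 0 = (\<Prod>a\<in>A. f a $ 0)" for f :: "'t \<Rightarrow> 'a::field fps"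
  by (induction A rule: infinite_finite_induct) auto

text \<open>Evaluating at the centre shows that the constant term of \<phi> is a root of q.
  Splitting off this linear factor and cancelling the nonzero series \<phi> - \<phi>(0) lowers the
  degree.\<close>

lemma fps_poly_transcendental:
  fixes \<phi> :: "'a::field fps"
  assumes "\<phi> \<noteq> fps_const (\<phi> $ 0)" "poly (map_poly fps_const q) \<phi> = 0"
  shows "q = 0"
  using assms(2)
proof (induction "degree q" arbitrary: q rule: less_induct)
  case less
  show ?case
  proof (rule ccontr)
    assume q: "q \<noteq> 0"
    have nth0: "(poly (map_poly fps_const r) \<phi>) $ 0 = poly r (\<phi> $ 0)" for r :: "'a poly"
    proof (induction r)
      case (pCons a r)
      then show ?case by (simp add: Polynomial.map_poly_pCons)
    qed simp
    have "poly q (\<phi> $ 0) = 0" using nth0[of q] less.prems by simp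
    then obtain r where r: "q = [:- (\<phi> $ 0), 1:] * r" by (auto simp: poly_eq_0_iff_dvd)
    interpret plane fps_const \<phi> 0 ..
    have "map_poly fps_const q = map_poly fps_const [:- (\<phi> $ 0), 1:] * map_poly fps_const r"
      unfolding r by (rule map_mult)
    then have "(\<phi> - fps_const (\<phi> $ 0)) * poly (map_poly fps_const r) \<phi> = 0"
      using less.prems by (auto simp: Polynomial.map_poly_pCons simp flip: fps_const_neg)
    then have "poly (map_poly fps_const r) \<phi> = 0" by (metis assms(1) mult_eq_0_iff right_minus_eq)
    moreover have "r \<noteq> 0" using q r by auto
    moreover have "degree q = Suc (degree r)"
      unfolding r using \<open>r \<noteq> 0\<close> by (subst degree_mult_eq) auto
    ultimately have "r = 0" using less.hyps[of r] by simp
    with \<open>r \<noteq> 0\<close> show False ..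
  qed
qed

lemma fps_powers_independent:
  fixes \<phi> :: "'a::field fps"
  assumes "\<phi> \<noteq> fps_const (\<phi> $ 0)" "(\<Sum>l<L. fps_const (c l) * \<phi> ^ l) = 0" "l < L"
  shows "c l = 0"
proof -
  interpret plane fps_const \<phi> 0 ..
  define q where "q = (\<Sum>l<L. monom (c l) l)"
  have map_sum: "map_poly fps_const (\<Sum>l\<in>A. monom (c l) l) = (\<Sum>l\<in>A. monom (fps_const (c l)) l)"
    if "finite A" for A
    using that by (induction A rule: finite_induct) (simp_all add: map_add map_poly_monom)
  have "poly (map_poly fps_const q) \<phi> = 0"
    unfolding q_def using assms(2) by (simp add: map_sum poly_sum poly_monom)
  then have "q = 0" using assms(1) fps_poly_transcendental by blast
  then have "coeff q l = 0" by simp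
  then show ?thesis using assms(3) by (simp add: q_def coeff_sum)
qed

text \<open>Division by g^(L - 1) turns these forms into powers of the nonconstant f / g, which is a
  power series because \<open>g $ 0 \<noteq> 0\<close>.\<close>

lemma fps_homogeneous_independent:
  fixes f g :: "'a::field fps"
  assumes g: "g $ 0 \<noteq> 0" and nc: "\<nexists>a. f = fps_const a * g"
    and sum0: "(\<Sum>l<L. fps_const (c l) * (f ^ l * g ^ (L - 1 - l))) = 0" and l: "l < L"
  shows "c l = 0"
proof -
  define \<phi> where "\<phi> = f * inverse g"
  have f: "f = \<phi> * g" using g by (simp add: \<phi>_def mult.assoc inverse_mult_eq_1)
  have "\<phi> \<noteq> fps_const (\<phi> $ 0)" using nc f by metis
  moreover have "(\<Sum>l<L. fps_const (c l) * (f ^ l * g ^ (L - 1 - l)))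
      = (\<Sum>l<L. fps_const (c l) * \<phi> ^ l) * g ^ (L - 1)"
    unfolding sum_distrib_right
  proof (intro sum.cong refl)
    fix i assume "i \<in> {..<L}"
    then have "g ^ i * g ^ (L - 1 - i) = g ^ (L - 1)" by (simp flip: power_add)
    then show "fps_const (c i) * (f ^ i * g ^ (L - 1 - i)) = fps_const (c i) * \<phi> ^ i * g ^ (L - 1)"
      unfolding f power_mult_distrib by (simp add: mult.assoc)
  qed
  then have "(\<Sum>l<L. fps_const (c l) * \<phi> ^ l) * g ^ (L - 1) = 0" using sum0 by simp
  moreover have "g ^ (L - 1) \<noteq> 0" using g by auto
  ultimately have "(\<Sum>l<L. fps_const (c l) * \<phi> ^ l) = 0" by (simp only: mult_eq_0_iff) auto
  with \<open>\<phi> \<noteq> fps_const (\<phi> $ 0)\<close> l show ?thesis using fps_powers_independent[of \<phi> c L l] by simp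
qed

text \<open>Read the relation as a polynomial in \<open>W\<close>. Once the coefficients of lower
  powers are zero, division by \<open>W ^ i\<close> shows that the coefficient of
  \<open>W ^ i\<close> is a multiple of \<open>W\<close>, so it vanishes to order \<open>M\<close>
  at every index in \<open>I\<close>; by \<open>jets\<close> only the zero combination does
  that.\<close>

lemma power_family_independent:
  fixes g :: "'t \<Rightarrow> 'i \<Rightarrow> 'a::field fps" and W :: "'i \<Rightarrow> 'a fps"
  assumes T: "finite T"
    and jets: "\<And>c t. (\<And>P. P \<in> I \<Longrightarrow> vanishes (\<Sum>t\<in>T. fps_const (c t) * g t P) M) \<Longrightarrow> t \<in> T \<Longrightarrow> c t = 0"
    and W: "\<And>P. P \<in> I \<Longrightarrow> W P \<noteq> 0" "\<And>P. P \<in> I \<Longrightarrow> vanishes (W P) M"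
    and sum0: "(\<Sum>(t,i)\<in>T\<times>{..<J}. fun_const (c (t,i)) * (W ^ i * g t)) = 0"
    and ti: "t \<in> T" "i < J"
  shows "c (t,i) = 0"
  using ti
proof (induction i arbitrary: t rule: less_induct)
  case (less i)
  define h where "h = (\<lambda>i P. \<Sum>t\<in>T. fps_const (c (t,i)) * g t P)"
  have hz: "h i' P = 0" if "i' < i" for i' P
    unfolding h_def using that less by (intro sum.neutral) auto
  have "vanishes (h i P) M" if P: "P \<in> I" for P
  proof -
    have "0 = (\<Sum>(t,i)\<in>T\<times>{..<J}. fun_const (c (t,i)) * (W ^ i * g t)) P" by (simp add: sum0)
    also have "\<dots> = (\<Sum>t\<in>T. \<Sum>i<J. fps_const (c (t,i)) * (W P ^ i * g t P))"
      by (simp add: fun_sum_apply split_def fun_power_apply sum.cartesian_product)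
    also have "\<dots> = (\<Sum>i<J. W P ^ i * h i P)"
      by (subst sum.swap) (simp add: h_def sum_distrib_left mult_ac)
    also have "\<dots> = (\<Sum>i'\<in>{i..<J}. W P ^ i' * h i' P)"
      by (rule sum.mono_neutral_right) (auto simp: hz not_le)
    also have "\<dots> = (\<Sum>i'\<in>{i..<J}. W P ^ i * (W P ^ (i' - i) * h i' P))"
      by (intro sum.cong refl) (simp add: mult.assoc[symmetric] power_add[symmetric])
    finally have "W P ^ i * (\<Sum>i'\<in>{i..<J}. W P ^ (i' - i) * h i' P) = 0"
      by (simp add: sum_distrib_left)
    then have "(\<Sum>i'\<in>{i..<J}. W P ^ (i' - i) * h i' P) = 0" using W(1)[OF P] by simp
    moreover have "{i..<J} = insert i {i<..<J}" using less.prems(2) by auto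
    ultimately have "h i P + (\<Sum>i'\<in>{i<..<J}. W P ^ (i' - i) * h i' P) = 0" by simp
    then have "h i P = - (\<Sum>i'\<in>{i<..<J}. W P ^ (i' - i) * h i' P)" by (simp add: eq_neg_iff_add_eq_0)
    moreover have "vanishes (\<Sum>i'\<in>{i<..<J}. W P ^ (i' - i) * h i' P) M"
    proof (intro vanishes_sum vanishes_mult)
      fix i' assume "i' \<in> {i<..<J}"
      then have "W P ^ (i' - i) = W P * W P ^ (i' - i - 1)" by (metis greaterThanLessThan_iff power_minus_mult mult.commute zero_less_diff)
      then show "vanishes (W P ^ (i' - i)) M" using vanishes_mult[OF W(2)[OF P]] by simp
    qed
    ultimately show ?thesis using vanishes_uminus by simp
  qed
  then show ?case using jets[of "\<lambda>t. c (t,i)"] less.prems(1) unfolding h_def by simp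
qed

text \<open>Branches at distinct rational points, each parametrised by x minus its value there. Ring
  elements are functions on the whole index type, while zeros are counted on \<open>I\<close>
  only.\<close>

locale multi_curve =
  fixes x y :: "'i \<Rightarrow> 'a::{field,finite} fps" and I :: "'i set"
  assumes x_eq: "\<And>P. x P = fps_const (x P $ 0) + fps_X"
    and inj: "inj_on (\<lambda>P. (x P $ 0, y P $ 0)) I" and fin: "finite I"
begin

sublocale finite_plane "fun_const :: 'a \<Rightarrow> 'i \<Rightarrow> 'a fps" x y ..

text \<open>In place of resultants: the powers \<open>W^i\<close>, \<open>i < J\<close>, times \<open>card I * M\<close> functions with prescribed
  jets are independent, whereas functions of degree \<open>O(J w)\<close> span a space of dimension
  \<open>D J w + O(1)\<close>; now let \<open>J\<close> grow.\<close>

theorem bezout: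
  assumes rel: "ev f = 0" "f \<noteq> 0" "tdeg_le f D"
    and W: "W \<in> S w" "\<And>P. P \<in> I \<Longrightarrow> W P \<noteq> 0" "\<And>P. P \<in> I \<Longrightarrow> vanishes (W P) M"
  shows "card I * M \<le> D * w"
proof (rule linear_growth_bound)
  \<comment> \<open>Over a finite field, multiplying over all other coordinate values interpolates:
    \<open>A P * B P\<close> is a unit on the branch at P and vanishes to order \<open>M\<close> on
    every other branch of \<open>I\<close>, because distinct centres differ in x or in y. The
    \<open>g (P,j)\<close> with \<open>j < M\<close> then realise all jets of order \<open>M\<close>
    at P.\<close>
  define A where "A = (\<lambda>P. \<Prod>a\<in>UNIV - {x P $ 0}. (x - fun_const a) ^ M)"
  define B where "B = (\<lambda>P. \<Prod>b\<in>UNIV - {y P $ 0}. (y - fun_const b) ^ M)"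
  define g where "g = (\<lambda>(P,j). (x - fun_const (x P $ 0)) ^ j * (A P * B P))"
  \<comment> \<open>A bound for the degrees of the \<open>g (P,j)\<close>; what matters is that it
    does not depend on \<open>J\<close>.\<close>
  define E0 where "E0 = M + (CARD('a) * M + CARD('a) * M)"
  have lin: "x - fun_const a \<in> S 1" "y - fun_const a \<in> S 1" for a
    using S_x S_y by (auto intro: S_diff)
  have A_S: "A P \<in> S (CARD('a) * M)" for P
  proof -
    have "A P \<in> S (\<Sum>a\<in>UNIV - {x P $ 0}. M)"
      unfolding A_def using S_power[OF lin(1), of _ M] by (intro S_prod) simp
    then show ?thesis by (rule S_mono) (simp add: card_Diff_singleton)
  qed
  have B_S: "B P \<in> S (CARD('a) * M)" for P
  proof -
    have "B P \<in> S (\<Sum>a\<in>UNIV - {y P $ 0}. M)"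
      unfolding B_def using S_power[OF lin(2), of _ M] by (intro S_prod) simp
    then show ?thesis by (rule S_mono) (simp add: card_Diff_singleton)
  qed
  have g_S: "g (P,j) \<in> S E0" if "j < M" for P j
  proof -
    have "(x - fun_const (x P $ 0)) ^ j \<in> S M"
      using S_power[OF lin(1), of "x P $ 0" j] that by (auto intro: S_mono)
    then show ?thesis unfolding g_def E0_def by (simp add: S_mult A_S B_S)
  qed
  have AB_unit: "(A P * B P) P $ 0 \<noteq> 0" for P
    by (simp add: A_def B_def fun_prod_apply fun_power_apply fps_prod_nth_0 fps_power_zeroth)
  have g_other: "vanishes (g (P',j) P) M" if "P \<in> I" "P' \<in> I" "P \<noteq> P'" for P P' j
  proof -
    have "x P $ 0 \<noteq> x P' $ 0 \<or> y P $ 0 \<noteq> y P' $ 0" using inj that by (auto simp: inj_on_def)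
    then have "vanishes (A P' P) M \<or> vanishes (B P' P) M"
    proof
      assume "x P $ 0 \<noteq> x P' $ 0"
      then have "A P' P = (x P - fps_const (x P $ 0)) ^ M * (\<Prod>a\<in>UNIV - {x P' $ 0} - {x P $ 0}. (x P - fps_const a) ^ M)"
        unfolding A_def by (subst prod.remove[of _ "x P $ 0"]) (auto simp: fun_prod_apply fun_power_apply)
      then have "vanishes (A P' P) M" by (simp add: vanishes_mult vanishes_power)
      then show ?thesis ..
    next
      assume "y P $ 0 \<noteq> y P' $ 0"
      then have "B P' P = (y P - fps_const (y P $ 0)) ^ M * (\<Prod>a\<in>UNIV - {y P' $ 0} - {y P $ 0}. (y P - fps_const a) ^ M)"
        unfolding B_def by (subst prod.remove[of _ "y P $ 0"]) (auto simp: fun_prod_apply fun_power_apply)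
      then have "vanishes (B P' P) M" by (simp add: vanishes_mult vanishes_power)
      then show ?thesis ..
    qed
    then have "vanishes (A P' P * B P' P) M" using vanishes_mult vanishes_mult_left by metis
    then show ?thesis by (simp add: g_def vanishes_mult_left)
  qed
  have jets: "c t = 0"
    if van: "\<And>P. P \<in> I \<Longrightarrow> vanishes (\<Sum>t\<in>I\<times>{..<M}. fps_const (c t) * g t P) M" and t: "t \<in> I\<times>{..<M}" for c t
  proof -
    obtain P j where Pj: "t = (P,j)" "P \<in> I" "j < M" using t by auto
    define q where "q = (\<Sum>j<M. fps_const (c (P,j)) * fps_X ^ j)"
    define R where "R = (\<Sum>P'\<in>I-{P}. \<Sum>j<M. fps_const (c (P',j)) * g (P',j) P)"
    have xP: "x P - fps_const (x P $ 0) = fps_X" using x_eq[of P] by (metis add_diff_cancel_left')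
    have "(\<Sum>t\<in>I\<times>{..<M}. fps_const (c t) * g t P) = (\<Sum>P'\<in>I. \<Sum>j<M. fps_const (c (P',j)) * g (P',j) P)"
      by (simp add: sum.cartesian_product split_def)
    also have "\<dots> = (\<Sum>j<M. fps_const (c (P,j)) * g (P,j) P) + R"
      unfolding R_def by (rule sum.remove[OF fin Pj(2)])
    also have "(\<Sum>j<M. fps_const (c (P,j)) * g (P,j) P) = q * (A P * B P) P"
      unfolding q_def sum_distrib_right
      by (intro sum.cong refl) (simp add: g_def fun_power_apply xP mult.assoc)
    finally have eq: "q * (A P * B P) P = (\<Sum>t\<in>I\<times>{..<M}. fps_const (c t) * g t P) + - R" by simp
    have "vanishes R M" unfolding R_def
      using g_other Pj by (auto intro!: vanishes_sum vanishes_mult_left)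
    then have "vanishes (q * (A P * B P) P) M"
      unfolding eq by (intro vanishes_add vanishes_uminus van Pj)
    then have "vanishes q M" using AB_unit vanishes_cancel_unit by blast
    then have "q $ j = 0" using Pj(3) by (simp add: vanishes_def)
    moreover have "q $ j = c (P,j)" using Pj(3)
      by (simp add: q_def fps_sum_nth if_distrib[of "\<lambda>z. _ * z"] sum.delta cong: if_cong)
    ultimately show ?thesis by (simp add: Pj)
  qed
  fix J :: nat assume "J > 0"
  define G where "G = (\<lambda>(t,i). W ^ i * g t)"
  have "card ((I \<times> {..<M}) \<times> {..<J}) \<le> D * ((E0 + J * w) + 1)"
  proof (rule card_independent_family[OF rel])
    show "finite ((I \<times> {..<M}) \<times> {..<J})" using fin by auto
    fix t assume "t \<in> (I \<times> {..<M}) \<times> {..<J}"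
    then obtain P j i where t: "t = ((P,j),i)" "j < M" "i < J" by auto
    have "W ^ i \<in> S (J * w)" using S_power[OF W(1), of i] t(3) by (auto intro: S_mono)
    then have "W ^ i * g (P,j) \<in> S (J * w + E0)" using g_S t by (intro S_mult) auto
    then show "G t \<in> S (E0 + J * w)" by (simp add: G_def t add.commute)
  next
    show "independent_family ((I \<times> {..<M}) \<times> {..<J}) G"
      unfolding independent_family_def
    proof (intro allI impI ballI)
      fix c t assume s: "(\<Sum>t\<in>(I \<times> {..<M}) \<times> {..<J}. fun_const (c t) * G t) = 0"
        and t: "t \<in> (I \<times> {..<M}) \<times> {..<J}"
      obtain u i where ui: "t = (u,i)" "u \<in> I \<times> {..<M}" "i < J" using t by auto
      have "c (u,i) = 0"
      proof (rule power_family_independent[where T = "I \<times> {..<M}" and I = I and g = g and W = W and M = M and J = J])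
        show "(\<Sum>(t, i)\<in>(I \<times> {..<M}) \<times> {..<J}. fun_const (c (t, i)) * (W ^ i * g t)) = 0"
          using s by (simp add: G_def split_def)
      qed (use fin jets W ui in auto)
      then show "c t = 0" by (simp add: ui)
    qed
  qed
  then show "card I * M * J \<le> D * (E0 + J * w + 1)"
    by (simp add: card_cartesian_product)
qed

end

locale arc =
  fixes x y :: "'a::{field,finite} fps"
  assumes x_eq: "x = fps_const (x $ 0) + fps_X"
begin

sublocale finite_plane fps_const x y ..

lemma x_transcendental: "poly (map_poly fps_const q) x = 0 \<Longrightarrow> q = 0"
proof (rule fps_poly_transcendental)
  show "x \<noteq> fps_const (x $ 0)"
  proof
    assume "x = fps_const (x $ 0)"
    then have "x $ 1 = 0" by (metis fps_nth_fps_const one_neq_zero)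
    moreover have "x $ 1 = 1" by (subst x_eq) simp
    ultimately show False by simp
  qed
qed

text \<open>The one-point case of \<open>bezout\<close>, for the constant family over
  \<open>unit\<close>.\<close>

lemma order_bound:
  assumes rel: "ev f = 0" "f \<noteq> 0" "tdeg_le f D"
    and u: "u \<in> S w" "u \<noteq> 0" "vanishes u M"
  shows "M \<le> D * w"
proof -
  interpret m: multi_curve "\<lambda>_::unit. x" "\<lambda>_. y" UNIV
    by unfold_locales (auto intro: x_eq simp: inj_on_def)
  have S: "(\<lambda>_. g) \<in> m.S E" if "g \<in> S E" for g E
    using that
  proof induction
    case (monomial a b c)
    then show ?case using lowdeg.monomial[of a b E "fun_const :: 'a \<Rightarrow> unit \<Rightarrow> 'a fps" c "\<lambda>_. x" "\<lambda>_. y"]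
      by (simp add: times_fun_def fun_power_apply fun_eq_iff cong: rev_conj_cong)
  next
    case (add f g) then show ?case using m.S_add[of "\<lambda>_. f" E "\<lambda>_. g"] by (simp add: plus_fun_def)
  qed
  have "m.ev f = (\<lambda>_. ev f)"
    by (simp add: fun_eq_iff m.ev_sum[OF rel(3)] ev_sum[OF rel(3)] fun_sum_apply fun_power_apply split_def)
  then have "m.ev f = 0" using rel(1) by (simp add: fun_eq_iff)
  from m.bezout[OF this rel(2,3) S[OF u(1)]] u(2,3) show ?thesis by simp
qed

text \<open>Put \<phi> = f / g, so that \<phi>^e = B / A. The products \<phi>^i (B / A)^j with i < e
  and j < J are the distinct powers \<phi>^(i + e j), hence e J independent functions; yet after
  clearing denominators their degree is at most e + J b. As J grows this forces e <= D b: a high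
  power of a nonconstant quotient of linear functions is not a quotient of functions of low
  degree.\<close>

lemma height_bound:
  assumes rel: "ev r = 0" "r \<noteq> 0" "tdeg_le r D"
    and fg: "f \<in> S 1" "g \<in> S 1" "g $ 0 \<noteq> 0" "\<nexists>a. f = fps_const a * g"
    and AB: "A \<in> S b" "B \<in> S b" "A \<noteq> 0" "A * f ^ e = B * g ^ e"
  shows "e \<le> D * b"
proof (rule linear_growth_bound)
  fix J :: nat assume J: "J > 0"
  define F where "F = (\<lambda>(i,j). f ^ i * g ^ (e - 1 - i) * (B ^ j * A ^ (J - 1 - j)))"
  have "card ({..<e} \<times> {..<J}) \<le> D * ((e + J * b) + 1)"
  proof (rule card_independent_family[OF rel])
    show "finite ({..<e} \<times> {..<J})" by simp
    fix t assume "t \<in> {..<e} \<times> {..<J}"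
    then obtain i j where t: "t = (i,j)" "i < e" "j < J" by auto
    have "f ^ i * g ^ (e - 1 - i) * (B ^ j * A ^ (J - 1 - j)) \<in>
        S ((i * 1 + (e - 1 - i) * 1) + (j * b + (J - 1 - j) * b))"
      by (intro S_mult S_power fg AB)
    moreover have "j * b + (J - 1 - j) * b \<le> J * b"
      using t(3) by (simp flip: add_mult_distrib)
    ultimately show "F t \<in> S (e + J * b)"
      unfolding F_def t using t(2) by (auto elim!: S_mono)
  next
    show "independent_family ({..<e} \<times> {..<J}) F"
      unfolding independent_family_def
    proof (intro allI impI ballI)
      fix c t assume s: "(\<Sum>t\<in>{..<e} \<times> {..<J}. fps_const (c t) * F t) = 0" and "t \<in> {..<e} \<times> {..<J}"
      then obtain i j where t: "t = (i,j)" "i < e" "j < J" by auto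
      have e: "e > 0" using t by simp
      \<comment> \<open>The identity (B / A)^j = \<phi>^(e j) with denominators cleared.\<close>
      have AB': "B ^ j * A ^ (J - 1 - j) * g ^ (e * (J - 1)) = A ^ (J - 1) * f ^ (e * j) * g ^ (e * (J - 1 - j))"
        if "j < J" for j
      proof -
        have "g ^ (e * (J - 1)) = (g ^ e) ^ j * g ^ (e * (J - 1 - j))"
          using that by (simp flip: power_mult power_add add_mult_distrib2)
        then have "B ^ j * A ^ (J - 1 - j) * g ^ (e * (J - 1)) = (B * g ^ e) ^ j * A ^ (J - 1 - j) * g ^ (e * (J - 1 - j))"
          by (simp add: power_mult_distrib mult_ac)
        also have "\<dots> = (A ^ j * A ^ (J - 1 - j)) * f ^ (e * j) * g ^ (e * (J - 1 - j))"
          unfolding AB(4)[symmetric] by (simp add: power_mult_distrib power_mult mult_ac)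
        also have "A ^ j * A ^ (J - 1 - j) = A ^ (J - 1)" using that by (simp flip: power_add)
        finally show ?thesis .
      qed
      \<comment> \<open>The pair (i, j) consists of the remainder and the quotient of the exponent l
        = i + e j modulo \<open>e\<close>.\<close>
      define d where "d = (\<lambda>l. c (l mod e, l div e))"
      define H where "H = (\<lambda>l. f ^ l * g ^ (e * J - 1 - l))"
      have trm: "fps_const (c (i,j)) * F (i,j) * g ^ (e * (J - 1)) = A ^ (J - 1) * (fps_const (d (i + e * j)) * H (i + e * j))"
        if ij: "i < e" "j < J" for i j
      proof -
        have d: "d (i + e * j) = c (i,j)" using ij by (simp add: d_def)
        have "e * (J - 1 - j) + (e - 1 - i) = e * J - 1 - (i + e * j)"
        proof -
          obtain k where "J = Suc (j + k)" using ij(2) less_imp_Suc_add by blast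
          then have "e * J = e * (J - 1 - j) + e * j + e" by (simp add: algebra_simps)
          then show ?thesis using ij by simp
        qed
        then have g: "g ^ (e - 1 - i) * g ^ (e * (J - 1 - j)) = g ^ (e * J - 1 - (i + e * j))"
          by (simp add: add.commute flip: power_add)
        have "F (i,j) * g ^ (e * (J - 1)) = f ^ i * g ^ (e - 1 - i) * (B ^ j * A ^ (J - 1 - j) * g ^ (e * (J - 1)))"
          by (simp add: F_def mult_ac)
        also have "\<dots> = A ^ (J - 1) * ((f ^ i * f ^ (e * j)) * (g ^ (e - 1 - i) * g ^ (e * (J - 1 - j))))"
          unfolding AB'[OF ij(2)] by (simp add: mult_ac)
        also have "\<dots> = A ^ (J - 1) * H (i + e * j)"
          unfolding g by (simp add: H_def power_add)
        finally show ?thesis unfolding d by (simp add: mult_ac)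
      qed
      have bij: "bij_betw (\<lambda>(i,j). i + e * j) ({..<e} \<times> {..<J}) {..<e * J}"
      proof (rule bij_betw_byWitness[where f' = "\<lambda>l. (l mod e, l div e)"])
        show "\<forall>a\<in>{..<e} \<times> {..<J}. ((case a of (i,j) \<Rightarrow> i + e * j) mod e, (case a of (i,j) \<Rightarrow> i + e * j) div e) = a" by auto
        show "(\<lambda>(i,j). i + e * j) ` ({..<e} \<times> {..<J}) \<subseteq> {..<e * J}"
        proof clarsimp
          fix i j assume "i < e" "j < J"
          then have "i + e * j < e + e * j" by simp
          also have "\<dots> = e * Suc j" by simp
          also have "\<dots> \<le> e * J" using \<open>j < J\<close> by (intro mult_le_mono2) simp
          finally show "i + e * j < e * J" .
        qed
        show "(\<lambda>l. (l mod e, l div e)) ` {..<e * J} \<subseteq> {..<e} \<times> {..<J}"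
          using e by (auto simp: less_mult_imp_div_less mult.commute)
      qed auto
      have "(\<Sum>l<e * J. fps_const (d l) * H l) = (\<Sum>(i,j)\<in>{..<e} \<times> {..<J}. fps_const (d (i + e * j)) * H (i + e * j))"
        by (subst sum.reindex_bij_betw[OF bij, symmetric]) (simp add: split_def)
      then have "A ^ (J - 1) * (\<Sum>l<e * J. fps_const (d l) * H l)
          = (\<Sum>t\<in>{..<e} \<times> {..<J}. fps_const (c t) * F t * g ^ (e * (J - 1)))"
        by (simp only:) (unfold sum_distrib_left, intro sum.cong refl, auto simp: trm simp del: One_nat_def)
      also have "\<dots> = 0" using s by (simp flip: sum_distrib_right)
      finally have "(\<Sum>l<e * J. fps_const (d l) * H l) = 0" using AB(3) by (simp only: mult_eq_0_iff power_eq_0_iff) auto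
      then have "d (i + e * j) = 0" unfolding H_def
      proof (rule fps_homogeneous_independent[OF fg(3,4)])
        have "i + e * j < e + e * j" using t by simp
        also have "\<dots> = e * Suc j" by simp
        also have "\<dots> \<le> e * J" using \<open>j < J\<close> by (intro mult_le_mono2) simp
        finally show "i + e * j < e * J" .
      qed
      then show "c t = 0" using t by (simp add: d_def)
    qed
  qed
  then show "e * J \<le> D * (e + J * b + 1)" by (simp add: card_cartesian_product)
qed

end

section \<open>Frobenius Wronskians\<close>

text \<open>The derivation h d/dx. On a curve f = 0 the derivative of y has denominator f_y; taking
  for \<open>h\<close> a multiple of f_y makes the derivation map polynomials in x and y to
  polynomials.\<close>

definition wderiv :: "'a::field fps \<Rightarrow> 'a fps \<Rightarrow> 'a fps" where
  "wderiv h f = h * fps_deriv f"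

lemma wderiv_add: "wderiv h (f + g) = wderiv h f + wderiv h g"
  by (simp add: wderiv_def algebra_simps)

lemma wderiv_0 [simp]: "wderiv h 0 = 0"
  by (simp add: wderiv_def)

lemma wderiv_sum: "wderiv h (sum f A) = (\<Sum>a\<in>A. wderiv h (f a))"
  by (induction A rule: infinite_finite_induct) (auto simp: wderiv_add)

lemma wderiv_mult: "wderiv h (f * g) = wderiv h f * g + f * wderiv h g"
  by (simp add: wderiv_def algebra_simps)

lemma wderiv_power_char:
  assumes "of_nat p = (0::'a::field)" shows "wderiv h ((f::'a fps) ^ p) = 0"
proof -
  show ?thesis using assms by (simp add: wderiv_def fps_deriv_power)
qed

lemma wderiv_pow_const:
  "(wderiv h ^^ j) (\<Sum>i\<in>A. fps_const (c i) * u i) = (\<Sum>i\<in>A. fps_const (c i) * (wderiv h ^^ j) (u i))"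
  by (induction j) (auto simp: wderiv_sum wderiv_mult, auto simp: wderiv_def)

text \<open>Since \<open>h\<close> is a unit, the iterates at the centre determine the Taylor
  coefficients recursively. Each step divides by an index j, hence the condition on the
  characteristic.\<close>

lemma vanishes_if_wderivs_vanish:
  assumes h: "h $ 0 \<noteq> 0" and char: "\<And>j. 0 < j \<Longrightarrow> j < M \<Longrightarrow> of_nat j \<noteq> (0::'a::field)"
    and "\<And>j. j < M \<Longrightarrow> ((wderiv h ^^ j) f) $ 0 = (0::'a)"
  shows "vanishes f M"
  using char assms(3)
proof (induction M arbitrary: f)
  case 0 show ?case by (simp add: vanishes_def)
next
  case (Suc M)
  have "vanishes (wderiv h f) M"
    using Suc.prems(2)[of "Suc _"] by (intro Suc.IH Suc.prems(1)) (auto simp: funpow_swap1)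
  then have "vanishes (fps_deriv f * h) M" by (simp add: wderiv_def mult.commute)
  then have d: "vanishes (fps_deriv f) M" using h vanishes_cancel_unit by blast
  show ?case unfolding vanishes_def
  proof (intro allI impI)
    fix j assume j: "j < Suc M"
    show "f $ j = 0"
    proof (cases j)
      case 0 then show ?thesis using Suc.prems(2)[of 0] by simp
    next
      case (Suc i)
      then have "fps_deriv f $ i = 0" using d j by (simp add: vanishes_def)
      then have "of_nat j * f $ j = 0" using Suc by simp
      then show ?thesis using Suc.prems(1)[of j] j Suc by (simp del: of_nat_Suc)
    qed
  qed
qed

text \<open>Integration by parts: differentiate a relation and subtract the one with a further
  derivative on \<open>u\<close>. This moves the derivative to \<open>v\<close> at the cost of one
  order.\<close>

lemma sum_wderiv_swap:
  assumes "\<And>j. j < L \<Longrightarrow> (\<Sum>i\<in>A. (wderiv h ^^ j) (u i) * v i) = 0"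
  shows "j + b < L \<Longrightarrow> (\<Sum>i\<in>A. (wderiv h ^^ j) (u i) * (wderiv h ^^ b) (v i)) = 0"
proof (induction b arbitrary: j)
  case 0 then show ?case using assms by simp
next
  case (Suc b)
  have "0 = wderiv h (\<Sum>i\<in>A. (wderiv h ^^ j) (u i) * (wderiv h ^^ b) (v i))"
    using Suc.IH[of j] Suc.prems by simp
  also have "\<dots> = (\<Sum>i\<in>A. (wderiv h ^^ Suc j) (u i) * (wderiv h ^^ b) (v i))
      + (\<Sum>i\<in>A. (wderiv h ^^ j) (u i) * (wderiv h ^^ Suc b) (v i))"
    by (simp add: wderiv_sum wderiv_mult sum.distrib)
  also have "(\<Sum>i\<in>A. (wderiv h ^^ Suc j) (u i) * (wderiv h ^^ b) (v i)) = 0"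
    using Suc.IH[of "Suc j"] Suc.prems by simp
  finally show ?case by simp
qed

lemma idom_kernel:
  fixes a :: "nat \<Rightarrow> nat \<Rightarrow> 'b::idom"
  shows "det (mat N N (\<lambda>(j,i). a j i)) = 0 \<longleftrightarrow>
    (\<exists>v. (\<exists>i<N. v i \<noteq> 0) \<and> (\<forall>j<N. (\<Sum>i<N. a j i * v i) = 0))" (is "?l \<longleftrightarrow> ?r")
proof -
  let ?A = "mat N N (\<lambda>(j,i). a j i)"
  have A: "?A \<in> carrier_mat N N" by simp
  have mv: "vec_index (?A *\<^sub>v v) j = (\<Sum>i<N. a j i * vec_index v i)" if "v \<in> carrier_vec N" "j < N" for v j
    using that by (auto simp: scalar_prod_def lessThan_atLeast0 intro!: sum.cong)
  have "?l \<longleftrightarrow> (\<exists>v. v \<in> carrier_vec N \<and> v \<noteq> 0\<^sub>v N \<and> ?A *\<^sub>v v = 0\<^sub>v N)"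
    by (rule det_0_iff_vec_prod_zero[OF A])
  also have "\<dots> \<longleftrightarrow> ?r"
  proof
    assume "\<exists>v. v \<in> carrier_vec N \<and> v \<noteq> 0\<^sub>v N \<and> ?A *\<^sub>v v = 0\<^sub>v N"
    then obtain v where v: "v \<in> carrier_vec N" "v \<noteq> 0\<^sub>v N" "?A *\<^sub>v v = 0\<^sub>v N" by auto
    have "\<exists>i<N. vec_index v i \<noteq> 0"
    proof (rule ccontr)
      assume "\<not> ?thesis"
      then have "v = 0\<^sub>v N" using v(1) by (intro eq_vecI) auto
      with v(2) show False ..
    qed
    moreover have "(\<Sum>i<N. a j i * vec_index v i) = 0" if "j < N" for j
      using mv[OF v(1) that] v(3) that by simp
    ultimately show ?r by (intro exI[of _ "vec_index v"]) auto
  next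
    assume ?r
    then obtain v where v: "\<exists>i<N. v i \<noteq> 0" "\<And>j. j < N \<Longrightarrow> (\<Sum>i<N. a j i * v i) = 0" by auto
    let ?v = "vec N v"
    have "?v \<noteq> 0\<^sub>v N" using v(1) by (metis index_vec index_zero_vec(1))
    moreover have "?A *\<^sub>v ?v = 0\<^sub>v N"
    proof (rule eq_vecI)
      fix j assume "j < dim_vec (0\<^sub>v N)"
      then have j: "j < N" by simp
      then have "vec_index (?A *\<^sub>v ?v) j = (\<Sum>i<N. a j i * v i)" by (subst mv) (auto intro!: sum.cong)
      then show "vec_index (?A *\<^sub>v ?v) j = vec_index (0\<^sub>v N) j" using v(2) j by simp
    qed simp
    ultimately show "\<exists>v. v \<in> carrier_vec N \<and> v \<noteq> 0\<^sub>v N \<and> ?A *\<^sub>v v = 0\<^sub>v N"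
      by (intro exI[of _ ?v]) auto
  qed
  finally show ?thesis .
qed

text \<open>At a rational point \<open>u i ^ p\<close> and \<open>u i\<close> have the same value, so the first two rows agree
  there; this is the source of the high vanishing order.\<close>

definition frob_wronskian :: "nat \<Rightarrow> 'a::field fps \<Rightarrow> nat \<Rightarrow> (nat \<Rightarrow> 'a fps) \<Rightarrow> 'a fps" where
  "frob_wronskian p h N u =
     det (mat N N (\<lambda>(j,i). if j = 0 then u i ^ p else (wderiv h ^^ (j - 1)) (u i)))"

text \<open>Passes from a kernel vector of power series to one of constants: take the coefficients
  of the lowest power of the variable that occurs in any \<open>v i\<close>. Comparing that
  coefficient in all rows shows that every derivative of the constant combination vanishes at the
  centre.\<close>

lemma kernel_vanishing:
  fixes u v :: "nat \<Rightarrow> 'a::field fps"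
  assumes h: "h $ 0 \<noteq> 0" and char: "\<And>j. 0 < j \<Longrightarrow> j < p \<Longrightarrow> of_nat j \<noteq> (0::'a)"
    and v: "\<exists>i<N. v i \<noteq> 0" and rows: "\<And>j. (\<Sum>i<N. (wderiv h ^^ j) (u i) * v i) = 0"
  shows "\<exists>c. (\<exists>i<N. c i \<noteq> 0) \<and> vanishes (\<Sum>i<N. fps_const (c i) * u i) p"
proof -
  have ex: "\<exists>e. \<exists>i<N. v i $ e \<noteq> 0" using v by (auto simp: fps_eq_iff)
  define e where "e = (LEAST e. \<exists>i<N. v i $ e \<noteq> 0)"
  have e: "\<exists>i<N. v i $ e \<noteq> 0" unfolding e_def by (rule LeastI_ex[OF ex])
  have small: "v i $ k = 0" if "i < N" "k < e" for i k
    using not_less_Least[of k "\<lambda>e. \<exists>i<N. v i $ e \<noteq> 0"] that unfolding e_def by blast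
  have "vanishes (\<Sum>i<N. fps_const (v i $ e) * u i) p"
  proof (rule vanishes_if_wderivs_vanish[OF h char])
    fix j
    have "((wderiv h ^^ j) (u i) * v i) $ e = (wderiv h ^^ j) (u i) $ 0 * v i $ e" if "i < N" for i
    proof -
      have "((wderiv h ^^ j) (u i) * v i) $ e = (\<Sum>k=0..e. (wderiv h ^^ j) (u i) $ k * v i $ (e - k))"
        by (simp add: fps_mult_nth)
      also have "\<dots> = (\<Sum>k\<in>{0}. (wderiv h ^^ j) (u i) $ k * v i $ (e - k))"
        by (rule sum.mono_neutral_right) (auto simp: small that)
      finally show ?thesis by simp
    qed
    then have "(\<Sum>i<N. (wderiv h ^^ j) (u i) * v i) $ e = (\<Sum>i<N. (wderiv h ^^ j) (u i) $ 0 * v i $ e)"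
      by (simp add: fps_sum_nth)
    moreover have "(wderiv h ^^ j) (\<Sum>i<N. fps_const (v i $ e) * u i) $ 0
        = (\<Sum>i<N. (wderiv h ^^ j) (u i) $ 0 * v i $ e)"
      unfolding wderiv_pow_const by (simp add: fps_sum_nth mult.commute)
    ultimately show "(wderiv h ^^ j) (\<Sum>i<N. fps_const (v i $ e) * u i) $ 0 = 0"
      by (simp only: rows fps_zero_nth)
  qed
  then show ?thesis using e by (intro exI[of _ "\<lambda>i. v i $ e"]) auto
qed

text \<open>Let \<open>v\<close> be a kernel vector. The p-th powers are constants for the
  derivation, so all derivatives of \<open>v\<close> stay orthogonal to the vector of the
  \<open>u i ^ p\<close>. Hence the Wronskian of \<open>v\<close> is zero and \<open>v\<close>
  satisfies a linear differential equation of order below \<open>N\<close>. Together with the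
  remaining rows this makes \<open>u\<close> orthogonal to all derivatives of \<open>v\<close>, and
  by parts all derivatives of \<open>u\<close> orthogonal to \<open>v\<close>;
  \<open>kernel_vanishing\<close> then produces a combination that \<open>ind\<close>
  forbids.\<close>

lemma frob_wronskian_nonzero:
  fixes u :: "nat \<Rightarrow> 'a::field fps"
  assumes h: "h $ 0 \<noteq> 0" and char: "\<And>j. 0 < j \<Longrightarrow> j < p \<Longrightarrow> of_nat j \<noteq> (0::'a)" "of_nat p = (0::'a)"
    and ind: "\<And>c. \<exists>i<N. c i \<noteq> 0 \<Longrightarrow> \<not> vanishes (\<Sum>i<N. fps_const (c i) * u i) p"
    and one: "\<exists>i<N. u i = 1"
  shows "frob_wronskian p h N u \<noteq> 0"
proof
  assume "frob_wronskian p h N u = 0"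
  then obtain v where v: "\<exists>i<N. v i \<noteq> 0" and
    rows: "\<And>j. j < N \<Longrightarrow> (\<Sum>i<N. (if j = 0 then u i ^ p else (wderiv h ^^ (j - 1)) (u i)) * v i) = 0"
    unfolding frob_wronskian_def by (subst (asm) idom_kernel) blast
  have N: "N > 0" using one by auto
  have F0: "(\<Sum>i<N. u i ^ p * v i) = 0" using rows[of 0] N by simp
  have R: "(\<Sum>i<N. (wderiv h ^^ j) (u i) * v i) = 0" if "j < N - 1" for j
    using rows[of "Suc j"] that by simp
  have F: "(\<Sum>i<N. u i ^ p * (wderiv h ^^ b) (v i)) = 0" for b
  proof (induction b)
    case 0 then show ?case using F0 by simp
  next
    case (Suc b)
    then have "0 = wderiv h (\<Sum>i<N. u i ^ p * (wderiv h ^^ b) (v i))" by simp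
    also have "\<dots> = (\<Sum>i<N. u i ^ p * (wderiv h ^^ Suc b) (v i))"
      by (simp add: wderiv_sum wderiv_mult wderiv_power_char[OF char(2)])
    finally show ?case by simp
  qed
  \<comment> \<open>The vector of the \<open>u i ^ p\<close> is nonzero, some \<open>u i\<close>
    being 1, and is killed by the Wronskian matrix of \<open>v\<close>. So the transpose is singular
    too, and its kernel vector is a differential equation common to all \<open>v i\<close>.\<close>
  obtain w where w: "\<exists>b<N. w b \<noteq> 0" "\<And>i. i < N \<Longrightarrow> (\<Sum>b<N. (wderiv h ^^ b) (v i) * w b) = 0"
  proof -
    let ?B = "mat N N (\<lambda>(i,b). (wderiv h ^^ b) (v i))"
    have "det (mat N N (\<lambda>(b,i). (wderiv h ^^ b) (v i))) = 0"
      unfolding idom_kernel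
    proof (intro exI[of _ "\<lambda>i. u i ^ p"] conjI allI impI)
      show "\<exists>i<N. u i ^ p \<noteq> 0" using one by (metis power_one zero_neq_one)
    next
      fix b assume "b < N"
      show "(\<Sum>i<N. (wderiv h ^^ b) (v i) * u i ^ p) = 0" using F[of b] by (simp add: mult.commute)
    qed
    also have "mat N N (\<lambda>(b,i). (wderiv h ^^ b) (v i)) = transpose_mat ?B" by (intro eq_matI) auto
    finally have "det ?B = 0" by (simp add: det_transpose[of _ N])
    then show ?thesis unfolding idom_kernel using that by blast
  qed
  define l where "l = Max {b. b < N \<and> w b \<noteq> 0}"
  have l: "l < N" "w l \<noteq> 0" "\<And>b. b < N \<Longrightarrow> w b \<noteq> 0 \<Longrightarrow> b \<le> l"
  proof -
    have fin: "finite {b. b < N \<and> w b \<noteq> 0}" by simp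
    have "l \<in> {b. b < N \<and> w b \<noteq> 0}" unfolding l_def using w(1) by (intro Max_in fin) auto
    then show "l < N" "w l \<noteq> 0" by auto
    show "b \<le> l" if "b < N" "w b \<noteq> 0" for b unfolding l_def using that by (intro Max_ge fin) auto
  qed
  \<comment> \<open>Differentiating the equation expresses \<open>w l\<close> times the derivative
    of order \<open>l + q\<close> through lower ones.\<close>
  have dep: "\<exists>e. \<forall>i<N. w l * (wderiv h ^^ (l + q)) (v i) = (\<Sum>b<l + q. e b * (wderiv h ^^ b) (v i))" for q
  proof (induction q)
    case 0
    have "w l * (wderiv h ^^ l) (v i) = (\<Sum>b<l. - w b * (wderiv h ^^ b) (v i))" if "i < N" for i
    proof -
      have "0 = (\<Sum>b<N. w b * (wderiv h ^^ b) (v i))" using w(2)[OF that] by (simp add: mult.commute)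
      also have "\<dots> = (\<Sum>b<Suc l. w b * (wderiv h ^^ b) (v i))"
        using l(1,3) by (intro sum.mono_neutral_right) (auto simp: not_less Suc_le_eq, meson leD less_le_trans lessI not_less_eq)
      finally have "w l * (wderiv h ^^ l) (v i) = - (\<Sum>b<l. w b * (wderiv h ^^ b) (v i))"
        by (simp add: eq_neg_iff_add_eq_0 add.commute)
      then show ?thesis by (simp add: sum_negf)
    qed
    then show ?case by (intro exI[of _ "\<lambda>b. - w b"]) simp
  next
    case (Suc q)
    then obtain e where e: "\<And>i. i < N \<Longrightarrow> w l * (wderiv h ^^ (l + q)) (v i) = (\<Sum>b<l + q. e b * (wderiv h ^^ b) (v i))" by auto
    define e' where "e' = (\<lambda>b. (if b < l + q then wderiv h (e b) else 0) + (if b > 0 then e (b - 1) else 0) - (if b = l + q then wderiv h (w l) else 0))"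
    have "w l * (wderiv h ^^ (l + Suc q)) (v i) = (\<Sum>b<l + Suc q. e' b * (wderiv h ^^ b) (v i))" if "i < N" for i
    proof -
      let ?v = "\<lambda>b. (wderiv h ^^ b) (v i)"
      have "wderiv h (w l * ?v (l + q)) = wderiv h (\<Sum>b<l + q. e b * ?v b)" using e[OF that] by simp
      then have "wderiv h (w l) * ?v (l + q) + w l * ?v (l + Suc q)
          = (\<Sum>b<l + q. wderiv h (e b) * ?v b) + (\<Sum>b<l + q. e b * ?v (Suc b))"
        by (simp add: wderiv_mult wderiv_sum sum.distrib)
      then have "w l * ?v (l + Suc q)
          = (\<Sum>b<l + q. wderiv h (e b) * ?v b) + (\<Sum>b<l + q. e b * ?v (Suc b)) - wderiv h (w l) * ?v (l + q)"
        by (simp only: eq_diff_eq add.commute)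
      also have "(\<Sum>b<l + q. e b * ?v (Suc b)) = (\<Sum>b<l + Suc q. (if b > 0 then e (b - 1) else 0) * ?v b)"
        by (simp only: add_Suc_right sum.lessThan_Suc_shift) simp
      also have "(\<Sum>b<l + q. wderiv h (e b) * ?v b) = (\<Sum>b<l + Suc q. (if b < l + q then wderiv h (e b) else 0) * ?v b)"
        by simp
      also have "wderiv h (w l) * ?v (l + q) = (\<Sum>b<l + Suc q. (if b = l + q then wderiv h (w l) else 0) * ?v b)"
        by simp
      finally show ?thesis unfolding e'_def
        by (simp only: left_diff_distrib distrib_right sum_subtractf sum.distrib)
    qed
    then show ?case by blast
  qed
  \<comment> \<open>Orders below \<open>l\<close> come from the rows by parts, since l <= N - 1;
    higher orders follow by the differential equation.\<close>
  have s0: "(\<Sum>i<N. u i * (wderiv h ^^ b) (v i)) = 0" for b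
  proof (induction b rule: less_induct)
    case (less b)
    show ?case
    proof (cases "b < l")
      case True
      then have "b < N - 1" using l(1) by simp
      then show ?thesis using sum_wderiv_swap[where L = "N - 1" and A = "{..<N}" and h = h and u = u and v = v and j = 0 and b = b] R by simp
    next
      case False
      then obtain q where q: "b = l + q" by (metis le_iff_add not_less)
      obtain e where e: "\<And>i. i < N \<Longrightarrow> w l * (wderiv h ^^ b) (v i) = (\<Sum>b'<b. e b' * (wderiv h ^^ b') (v i))"
        using dep[of q] q by auto
      have "w l * (\<Sum>i<N. u i * (wderiv h ^^ b) (v i)) = (\<Sum>i<N. u i * (w l * (wderiv h ^^ b) (v i)))"
        by (simp add: sum_distrib_left mult_ac)
      also have "\<dots> = (\<Sum>i<N. \<Sum>b'<b. e b' * (u i * (wderiv h ^^ b') (v i)))"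
        by (intro sum.cong refl) (simp add: e sum_distrib_left mult_ac)
      also have "\<dots> = (\<Sum>b'<b. e b' * (\<Sum>i<N. u i * (wderiv h ^^ b') (v i)))"
        by (subst sum.swap) (simp add: sum_distrib_left)
      also have "\<dots> = 0" using less by (intro sum.neutral) auto
      finally show ?thesis using l(2) by simp
    qed
  qed
  have "(\<Sum>i<N. (wderiv h ^^ j) (v i) * u i) = 0" for j using s0[of j] by (simp add: mult.commute)
  then have "(\<Sum>i<N. (wderiv h ^^ 0) (v i) * (wderiv h ^^ j) (u i)) = 0" for j
    using sum_wderiv_swap[where L = "Suc j" and A = "{..<N}" and h = h and u = v and v = u and j = 0 and b = j] by simp
  then have "\<And>j. (\<Sum>i<N. (wderiv h ^^ j) (u i) * v i) = 0" by (simp add: mult.commute)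
  from kernel_vanishing[OF h char(1) v this] ind show False by blast
qed

text \<open>Expand along the first row: the cofactors are orthogonal to all other rows. Derivatives
  of the determinant fall on the cofactors alone, and at the centre \<open>u i ^ p\<close> may be
  replaced by \<open>u i\<close>, because Frobenius fixes the rational value. What results is zero
  by parts.\<close>

lemma frob_wronskian_vanishes:
  fixes u :: "nat \<Rightarrow> 'a::field fps"
  assumes h: "h $ 0 \<noteq> 0" and char: "\<And>j. 0 < j \<Longrightarrow> j < p \<Longrightarrow> of_nat j \<noteq> (0::'a)" "of_nat p = (0::'a)"
    and frob: "\<And>a::'a. a ^ p = a" and N: "N > 0" "N - 1 \<le> p"
  shows "vanishes (frob_wronskian p h N u) (N - 1)"
proof -
  let ?A = "mat N N (\<lambda>(j,i). if j = 0 then u i ^ p else (wderiv h ^^ (j - 1)) (u i))"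
  define c where "c = (\<lambda>i. cofactor ?A 0 i)"
  have A: "?A \<in> carrier_mat N N" by simp
  have W: "frob_wronskian p h N u = (\<Sum>i<N. u i ^ p * c i)"
    unfolding frob_wronskian_def using laplace_expansion_row[OF A N(1)] N by (simp add: c_def)
  have R: "(\<Sum>i<N. (wderiv h ^^ j) (u i) * c i) = 0" if "j < N - 1" for j
  proof -
    have j: "Suc j < N" using that by simp
    have "(?A * adj_mat ?A) $$ (Suc j, 0) = (det ?A \<cdot>\<^sub>m 1\<^sub>m N) $$ (Suc j, 0)"
      using adj_mat(2)[OF A] by simp
    also have "\<dots> = 0" using j N by simp
    also have "(?A * adj_mat ?A) $$ (Suc j, 0) = (\<Sum>i<N. (wderiv h ^^ j) (u i) * c i)"
      using j N by (simp add: adj_mat_def scalar_prod_def c_def lessThan_atLeast0)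
    finally show ?thesis .
  qed
  have F: "(wderiv h ^^ b) (\<Sum>i<N. u i ^ p * c i) = (\<Sum>i<N. u i ^ p * (wderiv h ^^ b) (c i))" for b
    by (induction b) (auto simp: wderiv_sum wderiv_mult wderiv_power_char[OF char(2)])
  show ?thesis unfolding W
  proof (rule vanishes_if_wderivs_vanish[OF h])
    fix j assume "0 < j" "j < N - 1"
    then show "of_nat j \<noteq> (0::'a)" using char(1) N by simp
  next
    fix j assume j: "j < N - 1"
    have "(wderiv h ^^ j) (\<Sum>i<N. u i ^ p * c i) $ 0 = (\<Sum>i<N. u i * (wderiv h ^^ j) (c i)) $ 0"
      unfolding F by (simp add: fps_sum_nth fps_power_zeroth frob)
    also have "(\<Sum>i<N. u i * (wderiv h ^^ j) (c i)) = 0"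
      using sum_wderiv_swap[where L = "N - 1" and A = "{..<N}" and h = h and u = u and v = c and j = 0 and b = j] R j by simp
    finally show "(wderiv h ^^ j) (\<Sum>i<N. u i ^ p * c i) $ 0 = 0" by simp
  qed
qed

section \<open>The Stohr-Voloch bound\<close>

lemma tdeg_le_pderiv:
  fixes f :: "'a::field poly poly"
  assumes "tdeg_le f E" shows "tdeg_le (pderiv f) (E - 1)" "tdeg_le (map_poly pderiv f) (E - 1)"
proof -
  have of_nat_coeff: "coeff (of_nat n * q) i = of_nat n * coeff q i" for n i and q :: "'a poly"
    by (simp add: of_nat_poly)
  show "tdeg_le (pderiv f) (E - 1)"
    unfolding tdeg_le_def
  proof (intro allI impI)
    fix i j assume "E - 1 < i + j"
    then have "E < i + Suc j" by simp
    then have "coeff (coeff f (Suc j)) i = 0" using assms unfolding tdeg_le_def by simp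
    then show "coeff (coeff (pderiv f) j) i = 0" by (simp only: coeff_pderiv of_nat_coeff) simp
  qed
  show "tdeg_le (map_poly pderiv f) (E - 1)"
    unfolding tdeg_le_def
  proof (intro allI impI)
    fix i j assume "E - 1 < i + j"
    then have "E < Suc i + j" by simp
    then have "coeff (coeff f j) (Suc i) = 0" using assms unfolding tdeg_le_def by simp
    then show "coeff (coeff (map_poly pderiv f) j) i = 0" by (simp add: coeff_map_poly coeff_pderiv)
  qed
qed

context arc begin

lemma deriv_x: "fps_deriv x = 1"
  by (subst x_eq) simp

lemma deriv_ev: "fps_deriv (ev f) = ev (map_poly pderiv f) + ev (pderiv f) * fps_deriv y"
proof (induction f)
  case (pCons q f)
  have Q: "fps_deriv (poly (map_poly fps_const q) x) = poly (map_poly fps_const (pderiv q)) x" for q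
  proof (induction q)
    case (pCons a q)
    have "map_poly fps_const (pCons a q) = pCons (fps_const a) (map_poly fps_const q)"
      by (simp add: Polynomial.map_poly_pCons)
    moreover have "map_poly fps_const (pderiv (pCons a q)) = map_poly fps_const q + pCons 0 (map_poly fps_const (pderiv q))"
      by (simp only: pderiv_pCons map_add) (simp add: Polynomial.map_poly_pCons)
    ultimately show ?case using pCons.IH by (simp add: deriv_x)
  qed simp
  have 1: "map_poly pderiv (pCons q f) = pCons (pderiv q) (map_poly pderiv f)"
    by (simp add: Polynomial.map_poly_pCons)
  have 2: "ev (pderiv (pCons q f)) = ev f + y * ev (pderiv f)"
    by (simp add: pderiv_pCons ev_add ev_pCons)
  show ?case unfolding 1 2 ev_pCons using pCons.IH by (simp add: Q algebra_simps)
qed simp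

end

text \<open>Newton approximation, one coefficient at a time. It supplies the branch through a point
  where the derivative with respect to y is nonzero.\<close>

lemma fps_hensel:
  fixes q :: "'a::field fps poly"
  assumes root: "poly q (fps_const c) $ 0 = 0" and simple: "poly (pderiv q) (fps_const c) $ 0 \<noteq> 0"
  shows "\<exists>y. y $ 0 = c \<and> poly q y = 0"
proof -
  have nth0: "poly r y $ 0 = poly r (fps_const (y $ 0)) $ 0" for r :: "'a fps poly" and y
    by (induction r) auto
  have taylor: "\<exists>s. poly r (y + d) = poly r y + d * poly (pderiv r) y + d ^ 2 * s"
    for r :: "'a fps poly" and y d
  proof (induction r)
    case (pCons a r)
    then obtain s where s: "poly r (y + d) = poly r y + d * poly (pderiv r) y + d ^ 2 * s" by auto
    have "poly (pCons a r) (y + d) = poly (pCons a r) y + d * poly (pderiv (pCons a r)) y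
        + d ^ 2 * (poly (pderiv r) y + (y + d) * s)"
      by (simp only: poly_pCons s pderiv_pCons poly_add) (simp add: algebra_simps power2_eq_square)
    then show ?case by blast
  qed simp
  define P where "P = (\<lambda>n y. y $ 0 = c \<and> vanishes (poly q y) (Suc n))"
  define Q where "Q = (\<lambda>n y y'. vanishes (y' - y :: 'a fps) (Suc n))"
  have "\<exists>Y. \<forall>n. P n (Y n) \<and> Q n (Y n) (Y (Suc n))"
  proof (rule dependent_nat_choice)
    show "\<exists>y. P 0 y" using root by (intro exI[of _ "fps_const c"]) (simp add: P_def vanishes_def)
  next
    fix y n assume y: "P n y"
    define b where "b = poly (pderiv q) y $ 0"
    have b: "b \<noteq> 0" using simple y nth0[of "pderiv q" y] by (simp add: b_def P_def)
    \<comment> \<open>Solves the linear equation for the coefficient of index \<open>Suc n\<close>;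
      the quadratic Taylor term starts at index 2 n + 2 and does not interfere.\<close>
    define a where "a = - (poly q y $ Suc n) / b"
    define d where "d = fps_const a * fps_X ^ Suc n"
    obtain s where s: "poly q (y + d) = poly q y + d * poly (pderiv q) y + d ^ 2 * s" using taylor by blast
    have d_nth: "(d * g) $ k = (if k < Suc n then 0 else a * g $ (k - Suc n))" for g k
      unfolding d_def by (simp only: mult.assoc fps_mult_left_const_nth fps_X_power_mult_nth) simp
    have "vanishes (poly q (y + d)) (Suc (Suc n))"
      unfolding vanishes_def
    proof (intro allI impI)
      fix k assume k: "k < Suc (Suc n)"
      have "(d ^ 2 * s) $ k = 0"
        using k d_nth[of "d * s" k] d_nth[of s 0] by (simp add: power2_eq_square mult.assoc split: if_splits)
      then have "poly q (y + d) $ k = poly q y $ k + (d * poly (pderiv q) y) $ k" by (simp add: s)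
      also have "\<dots> = 0"
      proof (cases "k = Suc n")
        case True then show ?thesis using b by (simp add: d_nth a_def b_def)
      next
        case False then show ?thesis using k y by (simp add: d_nth P_def vanishes_def)
      qed
      finally show "poly q (y + d) $ k = 0" .
    qed
    moreover have "vanishes d (Suc n)" using d_nth[of 1] by (simp add: vanishes_def)
    ultimately show "\<exists>y'. P (Suc n) y' \<and> Q n y y'"
      using y by (intro exI[of _ "y + d"]) (simp add: P_def Q_def vanishes_def)
  qed
  then obtain Y where Y: "\<And>n. P n (Y n)" "\<And>n. Q n (Y n) (Y (Suc n))" by blast
  define y where "y = Abs_fps (\<lambda>n. Y n $ n)"
  have stable: "Y (n + k) $ j = Y n $ j" if "j \<le> n" for n k j
  proof (induction k)
    case (Suc k)
    have "Y (Suc (n + k)) $ j = Y (n + k) $ j" using Y(2)[of "n + k"] that by (simp add: Q_def vanishes_def)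
    with Suc show ?case by simp
  qed simp
  have agree: "vanishes (y - Y n) (Suc n)" for n
    unfolding vanishes_def
  proof (intro allI impI)
    fix j assume "j < Suc n"
    then have "Y (j + (n - j)) $ j = Y j $ j" by (intro stable) simp
    then show "(y - Y n) $ j = 0" using \<open>j < Suc n\<close> by (simp add: y_def)
  qed
  have "vanishes (poly q y) (Suc n)" for n
  proof -
    obtain s where s: "poly q (Y n + (y - Y n)) = poly q (Y n) + (y - Y n) * poly (pderiv q) (Y n) + (y - Y n) ^ 2 * s"
      using taylor by blast
    then have "poly q y = poly q (Y n) + (y - Y n) * (poly (pderiv q) (Y n) + (y - Y n) * s)"
      by (simp add: algebra_simps power2_eq_square)
    moreover have "vanishes (poly q (Y n)) (Suc n)" using Y(1)[of n] by (simp add: P_def)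
    ultimately show ?thesis using vanishes_add vanishes_mult[OF agree] by metis
  qed
  then have "poly q y = 0" by (intro fps_ext) (auto simp: vanishes_def)
  moreover have "y $ 0 = c" using Y(1)[of 0] by (simp add: y_def P_def)
  ultimately show ?thesis by blast
qed

lemma card_monomials: "2 * card {(a,b). a + b \<le> m} = (m + 1) * (m + 2)"
proof -
  have "{(a,b). a + b \<le> m} = Sigma {..m} (\<lambda>a. {..m - a})" by auto
  then have "card {(a,b). a + b \<le> m} = (\<Sum>a\<le>m. Suc (m - a))" by simp
  also have "\<dots> = (\<Sum>a<Suc m. Suc (Suc m - Suc a))" by (simp add: lessThan_Suc_atMost)
  also have "\<dots> = (\<Sum>a<Suc m. Suc a)" by (rule sum.nat_diff_reindex)
  finally have "card {(a,b). a + b \<le> m} = (\<Sum>a<Suc m. Suc a)" .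
  moreover have "2 * (\<Sum>a<n. Suc a) = n * (n + 1)" for n by (induction n) auto
  ultimately show ?thesis by simp
qed

section \<open>The Wronskian of all monomials of degree at most m\<close>

context multi_curve begin

lemma arc_at: "arc (x P)"
  by unfold_locales (rule x_eq)

lemma ev_apply: "ev f P = plane.ev fps_const (x P) (y P) f"
proof -
  interpret a: arc "x P" "y P" by (rule arc_at)
  obtain E where "tdeg_le f E" using tdeg_le_exists by blast
  then show ?thesis by (simp add: ev_sum a.ev_sum fun_sum_apply fun_power_apply split_def)
qed

definition dderiv :: "('i \<Rightarrow> 'a fps) \<Rightarrow> ('i \<Rightarrow> 'a fps) \<Rightarrow> 'i \<Rightarrow> 'a fps" where
  "dderiv h f = (\<lambda>P. wderiv (h P) (f P))"

lemma dderiv_mult: "dderiv h (f * g) = dderiv h f * g + f * dderiv h g"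
  by (simp add: dderiv_def wderiv_mult fun_eq_iff)

lemma dderiv_add: "dderiv h (f + g) = dderiv h f + dderiv h g"
  by (simp add: dderiv_def wderiv_add fun_eq_iff)

lemma dderiv_in_S:
  assumes h: "dderiv h x \<in> S D" "dderiv h y \<in> S D" and f: "f \<in> S E"
  shows "dderiv h f \<in> S (E + D)"
  using f
proof induction
  case (monomial a b c)
  have pow: "dderiv h (z ^ a) \<in> S (a + D)" if "z \<in> S 1" "dderiv h z \<in> S D" for z a
  proof (induction a)
    case 0
    have "dderiv h (z ^ 0) = 0" by (simp add: dderiv_def wderiv_def fun_eq_iff)
    then show ?case by (simp only: S_zero)
  next
    case (Suc a)
    have "dderiv h z * z ^ a \<in> S (D + a * 1)" by (intro S_mult S_power that)
    then have 1: "dderiv h z * z ^ a \<in> S (Suc a + D)" by (rule S_mono) simp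
    have "z * dderiv h (z ^ a) \<in> S (1 + (a + D))" by (intro S_mult Suc that)
    then have 2: "z * dderiv h (z ^ a) \<in> S (Suc a + D)" by (rule S_mono) simp
    show ?case unfolding power_Suc dderiv_mult by (rule S_add[OF 1 2])
  qed
  have c: "dderiv h (fun_const c * x ^ a * y ^ b) = fun_const c * (dderiv h (x ^ a) * y ^ b + x ^ a * dderiv h (y ^ b))"
  proof -
    have "dderiv h (fun_const c) = 0" by (simp add: dderiv_def wderiv_def fun_eq_iff)
    then show ?thesis by (simp only: dderiv_mult mult.assoc) (simp add: algebra_simps)
  qed
  have "dderiv h (x ^ a) * y ^ b \<in> S ((a + D) + b * 1)" by (intro S_mult S_power pow S_x S_y h)
  moreover have "x ^ a * dderiv h (y ^ b) \<in> S (a * 1 + (b + D))" by (intro S_mult S_power pow S_x S_y h)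
  ultimately have "dderiv h (x ^ a) * y ^ b + x ^ a * dderiv h (y ^ b) \<in> S (E + D)"
    using monomial by (intro S_add; elim S_mono; simp)
  then show ?case unfolding c by (rule S_smult)
next
  case (add f g) then show ?case unfolding dderiv_add by (intro S_add)
qed

text \<open>There are K + 1 monomials, where K = m (m + 3) / 2. The determinant has degree p m from
  the Frobenius row and m + j D from the derivatives of order j < K, and it vanishes to order K on
  each branch. So \<open>bezout\<close> gives card I * K <= D (p m + K m + D K (K - 1) / 2), and the
  bound follows from m^2 / 2 <= K <= 2 m^2.\<close>

theorem stohr_voloch:
  assumes rel: "ev f = 0" "f \<noteq> 0" "tdeg_le f D"
    and h: "h \<in> S D" "(\<lambda>P. h P * fps_deriv (y P)) \<in> S D" "\<And>P. P \<in> I \<Longrightarrow> h P $ 0 \<noteq> 0"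
    and char: "\<And>j. 0 < j \<Longrightarrow> j < p \<Longrightarrow> of_nat j \<noteq> (0::'a)" "of_nat p = (0::'a)" "\<And>a::'a. a ^ p = a"
    and m: "m > 0" "D * m < p"
    and indep: "\<And>P u. P \<in> I \<Longrightarrow> u \<noteq> 0 \<Longrightarrow> tdeg_le u m \<Longrightarrow> plane.ev fps_const (x P) (y P) u \<noteq> 0"
  shows "real (card I) \<le> 2 * real D * real p / real m + 2 * (real D * real m)\<^sup>2"
proof (cases "I = {}")
  case True then show ?thesis by simp
next
  case False
  then obtain P0 where P0: "P0 \<in> I" by blast
  \<comment> \<open>Otherwise \<open>f\<close> itself would be a relation of degree at most
    \<open>m\<close>, against \<open>indep\<close>.\<close>
  have mD: "m < D"
  proof (rule ccontr)
    assume "\<not> m < D"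
    then have "tdeg_le f m" by (intro tdeg_le_mono[OF rel(3)]) simp
    from indep[OF P0 rel(2) this] rel(1) show False by (simp flip: ev_apply)
  qed
  define T where "T = {(a,b). a + b \<le> m}"
  define N where "N = card T"
  have finT: "finite T" unfolding T_def by (rule finite_mon)
  have N: "2 * N = (m + 1) * (m + 2)" unfolding N_def T_def by (rule card_monomials)
  obtain e where e: "bij_betw e {..<N} T"
    using ex_bij_betw_nat_finite[OF finT] by (auto simp: N_def atLeast0LessThan)
  define K where "K = N - 1"
  have K: "2 * K = m * (m + 3)" using N by (simp add: K_def algebra_simps)
  have K_pos: "K > 0" using K m(1) by (cases K) auto
  have N_K: "N = Suc K" using K_pos by (simp add: K_def)
  have K_p: "K < p"
  proof -
    have "2 * K \<le> 2 * (D * m)"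
    proof -
      have "m + 3 \<le> 2 * D" using mD m(1) by simp
      then have "m * (m + 3) \<le> m * (2 * D)" by (rule mult_le_mono2)
      then show ?thesis using K by (simp add: mult_ac)
    qed
    then show ?thesis using m(2) by simp
  qed
  define u where "u = (\<lambda>i. x ^ fst (e i) * y ^ snd (e i))"
  define W where "W = (\<lambda>P. frob_wronskian p (h P) N (\<lambda>i. u i P))"
  define w where "w = p * m + (\<Sum>j<K. m + j * D)"
  have e_T: "fst (e i) + snd (e i) \<le> m" if "i < N" for i
    using bij_betwE[OF e] that by (auto simp: T_def split_def)
  have u_S: "u i \<in> S m" if "i < N" for i
    using lowdeg.monomial[OF e_T[OF that], of fun_const 1 x y] by (simp add: u_def mult.assoc fun_eq_iff flip: one_fun_def)
  have W_S: "W \<in> S w"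
  proof -
    define a where "a = (\<lambda>j i. if j = 0 then u i ^ p else (dderiv h ^^ (j - 1)) (u i))"
    have dx: "dderiv h x = h"
      by (simp add: dderiv_def wderiv_def arc.deriv_x[OF arc_at])
    have dy: "dderiv h y = (\<lambda>P. h P * fps_deriv (y P))"
      by (simp add: dderiv_def wderiv_def)
    have d_pow: "(dderiv h ^^ j) (u i) \<in> S (m + j * D)" if "i < N" for i j
    proof (induction j)
      case 0 then show ?case using u_S[OF that] by simp
    next
      case (Suc j)
      from dderiv_in_S[OF _ _ this, of h D] h(1,2) show ?case by (simp add: dx dy add_ac)
    qed
    have d_app: "(dderiv h ^^ j) g P = (wderiv (h P) ^^ j) (g P)" for j g P
      by (induction j) (auto simp: dderiv_def)
    define deg where "deg = (\<lambda>j. if j = 0 then p * m else m + (j - 1) * D)"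
    have a_S: "a j i \<in> S (deg j)" if "i < N" for j i
      using S_power[OF u_S[OF that], of p] d_pow[OF that] by (simp add: a_def deg_def)
    have "W = (\<Sum>\<pi> | \<pi> permutes {0..<N}. fun_const (signof \<pi>) * (\<Prod>j = 0..<N. a j (\<pi> j)))"
    proof
      fix P
      have sg: "signof \<pi> = fps_const (signof \<pi> :: 'a)" for \<pi> :: "nat \<Rightarrow> nat" by (simp add: sign_def)
      have "W P = (\<Sum>\<pi> | \<pi> permutes {0..<N}. signof \<pi> * (\<Prod>j = 0..<N. a j (\<pi> j) P))"
        unfolding W_def frob_wronskian_def
        by (subst det_def'[of _ N]) (auto intro!: sum.cong prod.cong arg_cong2[of _ _ _ _ "(*)"]
            simp: a_def fun_power_apply d_app permutes_in_image[of _ "{0..<N}"])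
      then show "W P = (\<Sum>\<pi> | \<pi> permutes {0..<N}. fun_const (signof \<pi>) * (\<Prod>j = 0..<N. a j (\<pi> j))) P"
        by (simp add: fun_sum_apply fun_prod_apply sg)
    qed
    moreover have "(\<Prod>j = 0..<N. a j (\<pi> j)) \<in> S (\<Sum>j = 0..<N. deg j)" if "\<pi> permutes {0..<N}" for \<pi>
      using permutes_in_image[OF that] by (intro S_prod a_S) auto
    moreover have "(\<Sum>j = 0..<N. deg j) = w"
      unfolding N_K w_def by (simp only: sum.atLeast0_lessThan_Suc_shift) (simp add: deg_def atLeast0LessThan)
    ultimately show ?thesis by (auto intro!: S_sum S_smult)
  qed
  have W_van: "vanishes (W P) K" if "P \<in> I" for P
    unfolding W_def K_def
    by (rule frob_wronskian_vanishes[OF h(3)[OF that] char(1,2,3)]) (use N_K K_p in auto)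
  have W_nz: "W P \<noteq> 0" if P: "P \<in> I" for P
    unfolding W_def
  proof (rule frob_wronskian_nonzero[OF h(3)[OF P] char(1,2)])
    interpret a: arc "x P" "y P" by (rule arc_at)
    fix c :: "nat \<Rightarrow> 'a" assume c: "\<exists>i<N. c i \<noteq> 0"
    define U where "U = (\<Sum>i<N. monom (monom (c i) (fst (e i))) (snd (e i)))"
    have U_coeff: "coeff (coeff U b) a = (\<Sum>i<N. if e i = (a,b) then c i else 0)" for a b
      unfolding U_def by (auto simp: coeff_sum coeff_monom intro!: sum.cong)
    have U_deg: "tdeg_le U m"
      unfolding tdeg_le_def U_coeff using e_T by (auto intro!: sum.neutral) fastforce
    have U_nz: "U \<noteq> 0"
    proof -
      obtain i where i: "i < N" "c i \<noteq> 0" using c by auto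
      have "(if e i' = e i then c i' else 0) = (if i' = i then c i else 0)" if "i' < N" for i'
        using bij_betw_imp_inj_on[OF e] that i by (auto simp: inj_on_def)
      then have "coeff (coeff U (snd (e i))) (fst (e i)) = (\<Sum>i'<N. if i' = i then c i else 0)"
        unfolding U_coeff by (intro sum.cong) auto
      also have "\<dots> = c i" using i by simp
      finally show ?thesis using i by auto
    qed
    have U_ev: "a.ev U = (\<Sum>i<N. fps_const (c i) * u i P)"
    proof -
      have mon: "a.ev (monom (monom c a) b) = fps_const c * (x P ^ a * y P ^ b)" for c a b
        by (simp add: a.ev_def map_poly_monom poly_monom mult.assoc)
      have "a.ev (\<Sum>i\<in>A. monom (monom (c i) (fst (e i))) (snd (e i))) = (\<Sum>i\<in>A. fps_const (c i) * u i P)" if "finite A" for A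
        using that by (induction A rule: finite_induct) (auto simp: a.ev_add mon u_def fun_power_apply)
      then show ?thesis by (simp add: U_def)
    qed
    show "\<not> vanishes (\<Sum>i<N. fps_const (c i) * u i P) p"
    proof
      assume "vanishes (\<Sum>i<N. fps_const (c i) * u i P) p"
      \<comment> \<open>By \<open>indep\<close> this function is nonzero, so
        \<open>order_bound\<close> limits its order to D m, which is below p.\<close>
      then have van: "vanishes (a.ev U) p" by (simp add: U_ev)
      have "a.ev f = 0" using rel(1) by (simp flip: ev_apply)
      from a.order_bound[OF this rel(2,3) a.ev_in_S[OF U_deg] indep[OF P U_nz U_deg] van] m(2)
      show False by simp
    qed
  next
    have "(0,0) \<in> T" by (simp add: T_def)
    then obtain i where "i < N" "e i = (0,0)" using bij_betw_imp_surj_on[OF e] by (metis imageE lessThan_iff)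
    then show "\<exists>i<N. u i P = 1" by (intro exI[of _ i]) (simp add: u_def)
  qed
  have "card I * K \<le> D * w" by (rule bezout[OF rel W_S W_nz W_van])
  moreover have "2 * w = 2 * p * m + 2 * K * m + D * (K * (K - 1))"
  proof -
    have "2 * (\<Sum>j<n. m + j * D) = 2 * n * m + D * (n * (n - 1))" for n
    proof (induction n)
      case (Suc n) then show ?case by (cases n) (auto simp: algebra_simps)
    qed simp
    then show ?thesis by (simp add: w_def)
  qed
  ultimately have "2 * (card I * K) \<le> D * (2 * p * m + 2 * K * m + D * (K * (K - 1)))"
    by (metis mult.left_commute mult_le_mono2)
  also have "\<dots> \<le> D * (2 * p * m + 2 * K * m + D * (K * K))" by simp
  finally have "real (2 * (card I * K)) \<le> real (D * (2 * p * m + 2 * K * m + D * (K * K)))" by (simp only: of_nat_le_iff)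
  then have "real K * real (card I) * 2 \<le> real K * (2 * real D * real m + real D * real D * real K) + 2 * real D * real p * real m"
    by (simp add: algebra_simps)
  then have *: "real (card I) * 2 \<le> (2 * real D * real m + real D * real D * real K) + 2 * real D * real p * real m / real K"
    using K_pos by (simp add: field_simps)
  have K2: "real K * 2 = real m * (real m + 3)"
    using arg_cong[OF K, of real] by (simp add: algebra_simps)
  have m1: "real m \<ge> 1" "real D \<ge> 1" using m(1) mD by auto
  have "2 * real D * real p * real m / real K \<le> 2 * (2 * real D * real p / real m)"
  proof -
    have "real m * real m \<le> 2 * real K" using K2 by (simp add: algebra_simps)
    then have "real m / real K \<le> 2 / real m" using K_pos m1 by (simp add: field_simps)
    from mult_left_mono[OF this, of "2 * real D * real p"] show ?thesis by simp
  qed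
  moreover have "2 * real D * real m \<le> 2 * (real D * real m)\<^sup>2"
  proof -
    have "1 * 1 \<le> real D * real m" using m1 by (intro mult_mono) auto
    then have "1 * (real D * real m) \<le> (real D * real m) * (real D * real m)" by (intro mult_right_mono) auto
    then show ?thesis by (simp add: power2_eq_square)
  qed
  moreover have "real D * real D * real K \<le> 2 * (real D * real m)\<^sup>2"
  proof -
    have "real K \<le> 2 * (real m * real m)"
    proof -
      have "real m * 1 \<le> real m * real m" using m1 by (intro mult_left_mono) auto
      then show ?thesis using K2 by (simp add: algebra_simps)
    qed
    from mult_left_mono[OF this, of "real D * real D"] show ?thesis by (simp add: power2_eq_square mult_ac)
  qed
  ultimately show ?thesis using * by linarith
qed

end

section \<open>Unit equations on branches of low degree\<close>

lemma vanishes_mult_nth: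
  assumes "vanishes f s" "vanishes g t" shows "(f * g) $ (s + t) = f $ s * g $ t"
proof -
  have "(f * g) $ (s + t) = (\<Sum>i=0..s + t. f $ i * g $ (s + t - i))" by (simp add: fps_mult_nth)
  also have "\<dots> = (\<Sum>i\<in>{s}. f $ i * g $ (s + t - i))"
  proof (rule sum.mono_neutral_right)
    show "\<forall>i\<in>{0..s + t} - {s}. f $ i * g $ (s + t - i) = 0"
    proof
      fix i assume i: "i \<in> {0..s + t} - {s}"
      show "f $ i * g $ (s + t - i) = 0"
      proof (cases "i < s")
        case True then show ?thesis using assms(1) by (simp add: vanishes_def)
      next
        case False
        then have "s + t - i < t" using i by auto
        then show ?thesis using assms(2) by (simp add: vanishes_def)
      qed
    qed
  qed auto
  finally show ?thesis by simp
qed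

text \<open>Compare the lowest coefficients of f X g' and g X f': the operator X d/dX keeps every
  exponent in place and brings it down as a factor. In characteristic p this determines the orders
  only modulo p.\<close>

lemma wronskian_zero_subdegree:
  fixes f g :: "'a::field fps"
  assumes "f * fps_deriv g = g * fps_deriv f" "f \<noteq> 0" "g \<noteq> 0"
  shows "of_nat (subdegree f) = (of_nat (subdegree g) :: 'a)"
proof -
  have van: "vanishes f (subdegree f)" for f :: "'a fps"
    unfolding vanishes_def by (intro allI impI nth_less_subdegree_zero)
  have nth: "(fps_X * fps_deriv f) $ i = of_nat i * f $ i" for f :: "'a fps" and i
  proof (cases i)
    case (Suc j) then show ?thesis by (simp add: fps_X_mult_nth)
  qed simp
  have van': "vanishes (fps_X * fps_deriv f) (subdegree f)" for f :: "'a fps"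
    unfolding vanishes_def nth by (intro allI impI) (simp only: nth_less_subdegree_zero mult_zero_right)
  have "f * (fps_X * fps_deriv g) = g * (fps_X * fps_deriv f)" using assms(1) by (metis mult.left_commute)
  then have "(f * (fps_X * fps_deriv g)) $ (subdegree f + subdegree g)
      = (g * (fps_X * fps_deriv f)) $ (subdegree g + subdegree f)" by (simp only: add.commute)
  then have "f $ subdegree f * (of_nat (subdegree g) * g $ subdegree g)
      = g $ subdegree g * (of_nat (subdegree f) * f $ subdegree f)"
    by (simp only: vanishes_mult_nth van van' nth)
  then show ?thesis using assms(2,3) by simp
qed

lemma stable_chain:
  fixes A :: "nat \<Rightarrow> 'b set"
  assumes "\<And>t. A t \<subseteq> A (Suc t)" "\<And>t. A t \<subseteq> U" "finite U"
  shows "\<exists>t\<le>card U. A t = A (Suc t)"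
proof (rule ccontr)
  assume "\<not> ?thesis"
  then have ne: "A t \<subset> A (Suc t)" if "t \<le> card U" for t using that assms(1) by blast
  have fin: "finite (A t)" for t using assms(2,3) finite_subset by blast
  have "t \<le> card (A t)" if "t \<le> Suc (card U)" for t
    using that
  proof (induction t)
    case (Suc t)
    then have "card (A t) < card (A (Suc t))" by (intro psubset_card_mono fin ne) simp
    with Suc show ?case by simp
  qed simp
  from this[of "Suc (card U)"] have "Suc (card U) \<le> card (A (Suc (card U)))" by simp
  also have "\<dots> \<le> card U" by (intro card_mono assms)
  finally show False by simp
qed

text \<open>A branch that lies on a curve of small degree \<open>m\<close>. The derivation is scaled
  so that the logarithmic derivatives \<open>\<xi>\<close> of x and \<open>\<eta>\<close> of y have
  degree at most \<open>m\<close>; differentiating a monomial then multiplies it by a function of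
  degree at most \<open>m\<close>, however large its exponents are.\<close>

locale small_arc = arc x y for x y :: "'a::{field,finite} fps" +
  fixes r :: "'a poly poly" and m p :: nat and \<xi> \<eta> hh :: "'a fps"
  assumes rel: "ev r = 0" "r \<noteq> 0" "tdeg_le r m"
    and \<xi>: "\<xi> \<in> S m" and \<eta>: "\<eta> \<in> S m"
    and dx: "wderiv hh x = x * \<xi>" and dy: "wderiv hh y = y * \<eta>" and hh: "hh \<noteq> 0"
    and char: "\<And>j. 0 < j \<Longrightarrow> j < p \<Longrightarrow> of_nat j \<noteq> (0::'a)"
    and unit_x: "x $ 0 \<noteq> 0" and unit_y: "y $ 0 \<noteq> 0"
begin

lemma x_nz: "x \<noteq> 0" and y_nz: "y \<noteq> 0" using unit_x unit_y by auto

abbreviation "d \<equiv> wderiv hh"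

lemma d_pow: "z ^ a * (of_nat a * \<zeta>) = d (z ^ a)" if "d z = z * \<zeta>"
proof (induction a)
  case 0 show ?case by (simp add: wderiv_def)
next
  case (Suc a)
  have "d (z ^ Suc a) = z * \<zeta> * z ^ a + z * d (z ^ a)" using that by (simp add: wderiv_mult)
  then show ?case by (simp add: Suc[symmetric] algebra_simps)
qed

lemma d_mon: "d (x ^ a * y ^ b) = x ^ a * y ^ b * (of_nat a * \<xi> + of_nat b * \<eta>)"
  unfolding wderiv_mult d_pow[OF dx, symmetric] d_pow[OF dy, symmetric] by (simp add: algebra_simps)

lemma weight_S: "of_nat a * \<xi> + of_nat b * \<eta> \<in> S m"
  by (intro S_add S_of_nat \<xi> \<eta>)

lemma d_S: assumes "f \<in> S E" shows "d f \<in> S (E + m)"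
  using assms
proof induction
  case (monomial a b c)
  have "d (fps_const c * x ^ a * y ^ b) = fps_const c * x ^ a * y ^ b * (of_nat a * \<xi> + of_nat b * \<eta>)"
    unfolding mult.assoc wderiv_mult[of hh "fps_const c"] d_mon by (simp add: wderiv_def mult.assoc)
  then show ?case using S_mult[OF lowdeg.monomial[OF monomial] weight_S] by simp
next
  case (add f g) then show ?case by (simp only: wderiv_add S_add)
qed

text \<open>Subtract the multiple of \<open>g\<close> that removes the coefficient at the order of
  \<open>g\<close>. If the difference were nonzero, its Wronskian with \<open>g\<close> would still
  be zero, so the two orders agree modulo p, and hence agree, as m w < p keeps both below p. But the
  difference has no term at that order.\<close>

lemma wronskian_zero_imp_proportional:
  assumes S: "f \<in> S w" "g \<in> S w" and g: "g \<noteq> 0" and eq: "f * fps_deriv g = g * fps_deriv f" and w: "m * w < p"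
  shows "\<exists>a. f = fps_const a * g"
proof -
  define a where "a = f $ subdegree g / g $ subdegree g"
  define u where "u = f - fps_const a * g"
  have sub: "subdegree v < p" if "v \<in> S w" "v \<noteq> 0" for v
  proof -
    have "vanishes v (subdegree v)" unfolding vanishes_def by (intro allI impI nth_less_subdegree_zero)
    from order_bound[OF rel that this] w show ?thesis by linarith
  qed
  have "u = 0"
  proof (rule ccontr)
    assume u: "u \<noteq> 0"
    have u_S: "u \<in> S w" unfolding u_def by (intro S_diff S_smult S)
    have "u * fps_deriv g = g * fps_deriv u"
      using eq by (simp add: u_def algebra_simps)
    then have eq: "of_nat (subdegree u) = (of_nat (subdegree g) :: 'a)"
      by (rule wronskian_zero_subdegree) (use u g in auto)
    have "subdegree u = subdegree g"
    proof (rule ccontr)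
      assume ne: "subdegree u \<noteq> subdegree g"
      define s t where "s = min (subdegree u) (subdegree g)" and "t = max (subdegree u) (subdegree g)"
      have st: "s < t" "t < p" using ne sub[OF u_S u] sub[OF S(2) g] by (auto simp: s_def t_def)
      have "(of_nat t :: 'a) = of_nat s" using eq by (auto simp: s_def t_def min_def max_def)
      then have "of_nat (t - s) = (0::'a)" using st by (simp add: of_nat_diff)
      moreover have "0 < t - s" "t - s < p" using st by linarith+
      ultimately show False using char by blast
    qed
    moreover have "u $ subdegree g = 0" using g by (simp add: u_def a_def)
    ultimately show False using nth_subdegree_nonzero[OF u] by simp
  qed
  then show ?thesis by (intro exI[of _ a]) (simp add: u_def)
qed

text \<open>Short for commensurable: f / g has height at most \<open>E\<close> in the sense of
  low-degree numerator and denominator.\<close>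

definition comm :: "nat \<Rightarrow> 'a fps \<Rightarrow> 'a fps \<Rightarrow> bool" where
  "comm E f g \<longleftrightarrow> (\<exists>A\<in>S E. \<exists>B\<in>S E. A \<noteq> 0 \<and> B \<noteq> 0 \<and> A * f = B * g)"

lemma comm_mono: "comm E f g \<Longrightarrow> E \<le> E' \<Longrightarrow> comm E' f g"
  unfolding comm_def using S_mono by blast

lemma comm_refl: "comm E f f"
  unfolding comm_def by (intro bexI[of _ 1]) auto

lemma comm_sym: "comm E f g \<Longrightarrow> comm E g f"
  unfolding comm_def by metis

lemma comm_trans: assumes "comm E f g" "comm E g h" shows "comm (2 * E) f h"
proof -
  from assms obtain A B A' B' where *: "A \<in> S E" "B \<in> S E" "A \<noteq> 0" "B \<noteq> 0" "A * f = B * g"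
    "A' \<in> S E" "B' \<in> S E" "A' \<noteq> 0" "B' \<noteq> 0" "A' * g = B' * h"
    unfolding comm_def by blast
  have "A' * A * f = B * (A' * g)" using *(5) by (simp add: mult_ac)
  then have "A' * A * f = B * B' * h" using *(10) by (simp add: mult_ac)
  moreover have "A' * A \<in> S (2 * E)" "B * B' \<in> S (2 * E)" using * by (auto simp: mult_2 intro: S_mult)
  moreover have "A' * A \<noteq> 0" "B * B' \<noteq> 0" using * by auto
  ultimately show ?thesis unfolding comm_def by blast
qed

text \<open>The elimination behind Mason's theorem. Differentiate the relation and cancel the term
  \<open>iz\<close> against the original; this leaves a shorter relation with coefficients of degree
  at most 2 E + m <= 3 E. If it is trivial, some other nonzero term has zero Wronskian with the term
  \<open>iz\<close>, and the two are proportional. The degree triples at most \<open>card T\<close>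
  times.\<close>

lemma relation_imp_comm:
  fixes e f :: "'t \<Rightarrow> nat" and c :: "'t \<Rightarrow> 'a fps"
  assumes "finite T" "\<And>i. i \<in> T \<Longrightarrow> c i \<in> S E" "m \<le> E" "\<And>i. i \<in> T \<Longrightarrow> e i + f i \<le> B"
    "m * (3 ^ card T * E + B) < p"
    "(\<Sum>i\<in>T. c i * (x ^ e i * y ^ f i)) = 0" "iz \<in> T" "c iz \<noteq> 0"
  shows "\<exists>i\<in>T. \<exists>j\<in>T. i \<noteq> j \<and> comm (3 ^ card T * E) (x ^ e i * y ^ f i) (x ^ e j * y ^ f j)"
  using assms
proof (induction "card T" arbitrary: T c E iz)
  case 0
  then show ?case by auto
next
  case (Suc q)
  define M where "M = (\<lambda>i. x ^ e i * y ^ f i)"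
  define wt where "wt = (\<lambda>i. of_nat (e i) * \<xi> + of_nat (f i) * \<eta>)"
  have M_nz: "M i \<noteq> 0" for i using x_nz y_nz by (simp add: M_def)
  have d_cM: "d (g * M i) = (d g + wt i * g) * M i" for g i
    unfolding M_def wderiv_mult[of hh g] d_mon by (simp add: wt_def algebra_simps)
  \<comment> \<open>The coefficients after this cancellation. Up to a product of two monomials,
    \<open>c' i\<close> is also the Wronskian of the terms \<open>iz\<close> and
    \<open>i\<close>.\<close>
  define c' where "c' = (\<lambda>i. c iz * (d (c i) + wt i * c i) - c i * (d (c iz) + wt iz * c iz))"
  define T' where "T' = T - {iz}"
  have T': "finite T'" "card T' = q" "T = insert iz T'" "iz \<notin> T'" using Suc.prems Suc.hyps(2) by (auto simp: T'_def)
  have cardT: "3 ^ card T * E = 3 ^ q * (3 * E)" by (simp flip: Suc.hyps(2))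
  have sum0: "(\<Sum>i\<in>T. c i * M i) = 0" using Suc.prems by (simp add: M_def)
  have E_le: "E \<le> 3 ^ card T * E" by simp
  show ?case
  proof (cases "\<exists>i\<in>T'. c' i \<noteq> 0")
    case True
    then obtain i1 where i1: "i1 \<in> T'" "c' i1 \<noteq> 0" by blast
    have "0 = d (\<Sum>i\<in>T. c i * M i)" by (simp add: sum0)
    also have "\<dots> = (\<Sum>i\<in>T. (d (c i) + wt i * c i) * M i)" by (simp add: wderiv_sum d_cM)
    finally have d0: "(\<Sum>i\<in>T. (d (c i) + wt i * c i) * M i) = 0" by simp
    have "(\<Sum>i\<in>T. c' i * M i) = c iz * (\<Sum>i\<in>T. (d (c i) + wt i * c i) * M i)
        - (d (c iz) + wt iz * c iz) * (\<Sum>i\<in>T. c i * M i)"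
      unfolding c'_def sum_distrib_left sum_subtractf[symmetric]
      by (intro sum.cong refl) (simp add: algebra_simps)
    then have "(\<Sum>i\<in>T. c' i * M i) = 0" by (simp only: d0 sum0) simp
    moreover have "c' iz = 0" by (simp add: c'_def)
    ultimately have sum': "(\<Sum>i\<in>T'. c' i * M i) = 0" using T' by simp
    have c'_S: "c' i \<in> S (3 * E)" if "i \<in> T'" for i
    proof -
      have D: "d (c j) + wt j * c j \<in> S (E + m)" if "j \<in> T" for j
        using d_S[OF Suc.prems(2)[OF that]] S_mult[OF Suc.prems(2)[OF that] weight_S[of "e j" "f j"]]
        by (intro S_add) (auto simp: wt_def mult.commute)
      have "c' i \<in> S (E + (E + m))"
        unfolding c'_def using that T' Suc.prems by (intro S_diff S_mult D Suc.prems(2)) auto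
      then show ?thesis by (rule S_mono) (use Suc.prems in simp)
    qed
    have "\<exists>i\<in>T'. \<exists>j\<in>T'. i \<noteq> j \<and> comm (3 ^ card T' * (3 * E)) (x ^ e i * y ^ f i) (x ^ e j * y ^ f j)"
    proof (rule Suc.hyps(1)[of T' c' "3 * E" i1])
      show "q = card T'" using T' by simp
      show "finite T'" by (rule T')
      show "m \<le> 3 * E" using Suc.prems(3) by simp
      show "m * (3 ^ card T' * (3 * E) + B) < p" using Suc.prems(5) by (simp add: cardT T'(2))
      show "(\<Sum>i\<in>T'. c' i * (x ^ e i * y ^ f i)) = 0" using sum' by (simp add: M_def)
    qed (use c'_S i1 Suc.prems T' in auto)
    moreover have "3 ^ card T' * (3 * E) = 3 ^ card T * E" by (simp only: cardT T'(2))
    ultimately have "\<exists>i\<in>T'. \<exists>j\<in>T'. i \<noteq> j \<and> comm (3 ^ card T * E) (x ^ e i * y ^ f i) (x ^ e j * y ^ f j)"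
      by (simp only:)
    then show ?thesis using T'(3) by (meson insertI2)
  next
    case False
    have "\<exists>j\<in>T'. c j \<noteq> 0"
    proof (rule ccontr)
      assume "\<not> ?thesis"
      then have "(\<Sum>i\<in>T'. c i * M i) = 0" by (intro sum.neutral) auto
      then have "c iz * M iz = 0" using sum0 T' by simp
      then show False using M_nz Suc.prems(8) by simp
    qed
    then obtain j where j: "j \<in> T'" "c j \<noteq> 0" by blast
    define P Q where "P = c j * M j" and "Q = c iz * M iz"
    have "d P * Q - P * d Q = c' j * (M j * M iz)"
      unfolding P_def Q_def d_cM c'_def by (simp add: algebra_simps)
    also have "c' j = 0" using False j by blast
    finally have "hh * (P * fps_deriv Q) = hh * (Q * fps_deriv P)"
      unfolding wderiv_def by (auto simp: algebra_simps)
    then have eq: "P * fps_deriv Q = Q * fps_deriv P" using hh by (simp only: mult_cancel_left) auto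
    have MS: "M i \<in> S B" if "i \<in> T" for i
      using lowdeg.monomial[of "e i" "f i" B fps_const 1 x y] Suc.prems(4)[OF that] by (simp add: M_def)
    have PQ: "P \<in> S (E + B)" "Q \<in> S (E + B)"
      unfolding P_def Q_def using j T' Suc.prems by (auto intro!: S_mult MS Suc.prems(2))
    have "m * (E + B) \<le> m * (3 ^ card T * E + B)" using E_le by simp
    then have "m * (E + B) < p" using Suc.prems(5) by linarith
    then obtain a where a: "P = fps_const a * Q"
      using wronskian_zero_imp_proportional[OF PQ _ eq] M_nz Suc.prems(8) by (auto simp: Q_def)
    have "fps_const a * c iz \<noteq> 0" using a j(2) M_nz by (auto simp: P_def Q_def)
    moreover have "c j \<in> S (3 ^ card T * E)" "fps_const a * c iz \<in> S (3 ^ card T * E)"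
      using S_mono[OF Suc.prems(2) E_le] Suc.prems(7) j(1) T'(3) by (auto intro!: S_smult)
    moreover have "c j * M j = fps_const a * c iz * M iz" using a by (simp add: P_def Q_def mult_ac)
    ultimately have "comm (3 ^ card T * E) (M j) (M iz)" unfolding comm_def using j(2) by blast
    then show ?thesis using j(1) T' by (auto simp: M_def)
  qed
qed

text \<open>Commensurability with a fixed bound is not transitive. By pigeonhole some bound \<open>E = K^t m\<close>
  gives the same relation as \<open>K E\<close>, which makes it an equivalence relation, and the classes then
  cannot be linked by \<open>relation_imp_comm\<close>.\<close>

lemma unit_partition:
  fixes e f :: "nat \<Rightarrow> nat" and c :: "nat \<Rightarrow> 'a fps" and q :: nat
  defines "K \<equiv> 3 ^ q * (q + 1)"
  assumes c: "\<And>i. i < q \<Longrightarrow> c i \<in> S m" and deg: "\<And>i. i < q \<Longrightarrow> e i + f i \<le> B"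
    and p: "m * (K ^ (q * q + 1) * m + B) < p"
    and sum0: "(\<Sum>i<q. c i * (x ^ e i * y ^ f i)) = 0" and q: "q > 0"
  obtains E where "E \<le> K ^ (q * q) * m"
    "\<And>i j l. i < q \<Longrightarrow> j < q \<Longrightarrow> l < q \<Longrightarrow> comm E (x ^ e i * y ^ f i) (x ^ e j * y ^ f j) \<Longrightarrow>
       comm E (x ^ e j * y ^ f j) (x ^ e l * y ^ f l) \<Longrightarrow> comm E (x ^ e i * y ^ f i) (x ^ e l * y ^ f l)"
    "\<And>i. i < q \<Longrightarrow> (\<Sum>j | j < q \<and> comm E (x ^ e i * y ^ f i) (x ^ e j * y ^ f j). c j * (x ^ e j * y ^ f j)) = 0"
proof -
  define M where "M = (\<lambda>i. x ^ e i * y ^ f i)"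
  have M_nz: "M i \<noteq> 0" for i using x_nz y_nz by (simp add: M_def)
  define G where "G = (\<lambda>t. {(i,j). i < q \<and> j < q \<and> comm (K ^ t * m) (M i) (M j)})"
  have K: "K \<ge> 2"
  proof -
    have "1 * 2 \<le> 3 ^ q * (q + 1)" using q by (intro mult_mono) auto
    then show ?thesis by (simp add: K_def)
  qed
  have "\<exists>t\<le>card ({..<q}\<times>{..<q}). G t = G (Suc t)"
  proof (rule stable_chain)
    show "G t \<subseteq> G (Suc t)" for t
    proof -
      have "K ^ t * m \<le> K ^ Suc t * m" using K by simp
      then show ?thesis unfolding G_def using comm_mono by fast
    qed
  qed (auto simp: G_def)
  then obtain t where t: "t \<le> q * q" "G t = G (Suc t)" by (auto simp: card_cartesian_product)
  define E where "E = K ^ t * m"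
  have E_m: "m \<le> E" using K by (simp add: E_def)
  have E_le: "E \<le> K ^ (q * q) * m" unfolding E_def using t(1) K by (intro mult_le_mono1 power_increasing) auto
  have up: "comm E (M i) (M j)" if "comm E' (M i) (M j)" "E' \<le> K * E" "i < q" "j < q" for i j E'
  proof -
    have "comm (K ^ Suc t * m) (M i) (M j)" using comm_mono[OF that(1)] that(2) by (simp add: E_def mult.assoc)
    then have "(i,j) \<in> G (Suc t)" using that by (simp add: G_def)
    then have "(i,j) \<in> G t" using t(2) by simp
    then show ?thesis by (simp add: G_def E_def)
  qed
  have tr: "comm E (M i) (M l)" if "i < q" "j < q" "l < q" "comm E (M i) (M j)" "comm E (M j) (M l)" for i j l
    using up[OF comm_trans[OF that(4,5)]] that K by simp
  define R where "R = (\<lambda>i j. i < q \<and> j < q \<and> comm E (M i) (M j))"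
  define \<rho> where "\<rho> = (\<lambda>j. LEAST i. R i j)"
  have R_refl: "R i i" if "i < q" for i using that by (simp add: R_def comm_refl)
  have R_sym: "R i j \<Longrightarrow> R j i" for i j using comm_sym by (auto simp: R_def)
  have R_trans: "R i j \<Longrightarrow> R j l \<Longrightarrow> R i l" for i j l using tr by (auto simp: R_def)
  have \<rho>: "R (\<rho> j) j" if "j < q" for j unfolding \<rho>_def by (rule LeastI[of _ j]) (rule R_refl[OF that])
  have \<rho>_cong: "\<rho> i = \<rho> j" if "R i j" for i j
  proof -
    have "R l i \<longleftrightarrow> R l j" for l using that R_sym R_trans by meson
    then show ?thesis by (simp add: \<rho>_def)
  qed
  have "\<exists>AB. fst AB \<in> S E \<and> snd AB \<in> S E \<and> fst AB \<noteq> 0 \<and> snd AB \<noteq> 0 \<and> fst AB * M j = snd AB * M (\<rho> j)" if "j < q" for j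
  proof -
    have "comm E (M j) (M (\<rho> j))" using R_sym[OF \<rho>[OF that]] by (simp add: R_def)
    then show ?thesis unfolding comm_def by fastforce
  qed
  then obtain AB where AB: "\<And>j. j < q \<Longrightarrow> fst (AB j) \<in> S E \<and> snd (AB j) \<in> S E \<and> fst (AB j) \<noteq> 0 \<and> snd (AB j) \<noteq> 0 \<and>
      fst (AB j) * M j = snd (AB j) * M (\<rho> j)" by metis
  define A where "A = (\<lambda>j. fst (AB j))"
  define A' where "A' = (\<lambda>j. \<Prod>l\<in>{..<q} - {j}. A l)"
  \<comment> \<open>A common denominator: multiplied by \<open>Pall\<close>, every term becomes a
    low-degree multiple of the monomial of its class representative, and \<open>C i\<close> collects
    the coefficients of one class. The class sums vanish as soon as all \<open>C i\<close>
    do.\<close>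
  define Pall where "Pall = (\<Prod>l<q. A l)"
  have Pall: "Pall = A j * A' j" if "j < q" for j
    unfolding Pall_def A'_def using that by (intro prod.remove) auto
  have Pall_nz: "Pall \<noteq> 0" unfolding Pall_def using AB by (simp add: A_def)
  define C where "C = (\<lambda>i. \<Sum>j | j < q \<and> \<rho> j = i. c j * (A' j * snd (AB j)))"
  have C_M: "C i * M i = Pall * (\<Sum>j | j < q \<and> \<rho> j = i. c j * M j)" for i
    unfolding C_def sum_distrib_left sum_distrib_right
  proof (intro sum.cong refl)
    fix j assume "j \<in> {j. j < q \<and> \<rho> j = i}"
    then have j: "j < q" "\<rho> j = i" by auto
    have "c j * (A' j * snd (AB j)) * M i = c j * A' j * (snd (AB j) * M (\<rho> j))" using j by (simp add: mult_ac)
    also have "\<dots> = c j * A' j * (A j * M j)" using AB[OF j(1)] by (simp add: A_def)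
    also have "\<dots> = Pall * (c j * M j)" by (simp add: Pall[OF j(1)] mult_ac)
    finally show "c j * (A' j * snd (AB j)) * M i = Pall * (c j * M j)" .
  qed
  have C_S: "C i \<in> S ((q + 1) * E)" for i
    unfolding C_def
  proof (intro S_sum)
    fix j assume "j \<in> {j. j < q \<and> \<rho> j = i}"
    then have j: "j < q" by auto
    have "A' j \<in> S (\<Sum>l\<in>{..<q} - {j}. E)" unfolding A'_def using AB by (intro S_prod) (auto simp: A_def)
    moreover have "(\<Sum>l\<in>{..<q} - {j}. E) = (q - 1) * E" using j by (simp add: card_Diff_singleton)
    ultimately have "c j * (A' j * snd (AB j)) \<in> S (m + ((q - 1) * E + E))"
      using AB[OF j] c[OF j] by (intro S_mult) auto
    moreover have "m + ((q - 1) * E + E) \<le> (q + 1) * E"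
      using E_m q by (cases q) auto
    ultimately show "c j * (A' j * snd (AB j)) \<in> S ((q + 1) * E)" by (rule S_mono)
  qed
  define T where "T = \<rho> ` {..<q}"
  have T_sub: "T \<subseteq> {..<q}" using \<rho> by (auto simp: T_def R_def)
  then have T_card: "card T \<le> q" using card_mono[of "{..<q}" T] by simp
  have C0: "C i = 0" if "i \<in> T" for i
  proof (rule ccontr)
    assume nz: "C i \<noteq> 0"
    have "(\<Sum>i\<in>T. C i * M i) = Pall * (\<Sum>i\<in>T. \<Sum>j\<in>{j\<in>{..<q}. \<rho> j = i}. c j * M j)"
      by (simp add: C_M sum_distrib_left)
    also have "(\<Sum>i\<in>T. \<Sum>j\<in>{j\<in>{..<q}. \<rho> j = i}. c j * M j) = (\<Sum>j<q. c j * M j)"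
      unfolding T_def by (rule sum.group) auto
    also have "\<dots> = 0" using sum0 by (simp add: M_def)
    finally have s: "(\<Sum>i\<in>T. C i * (x ^ e i * y ^ f i)) = 0" by (simp add: M_def)
    \<comment> \<open>The origin of \<open>K\<close>: the \<open>C i\<close> have degree (q + 1) E,
      and the elimination triples this at most \<open>q\<close> times.\<close>
    have le: "3 ^ card T * ((q + 1) * E) \<le> K * E"
    proof -
      have "(3::nat) ^ card T \<le> 3 ^ q" using T_card by (intro power_increasing) auto
      then have "3 ^ card T * ((q + 1) * E) \<le> 3 ^ q * ((q + 1) * E)" by (rule mult_le_mono1)
      then show ?thesis by (simp only: K_def mult.assoc)
    qed
    have "K * E \<le> K ^ (q * q + 1) * m" using mult_le_mono2[OF E_le, of K] by simp
    then have "m * (3 ^ card T * ((q + 1) * E) + B) \<le> m * (K ^ (q * q + 1) * m + B)"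
      using le by (intro mult_le_mono2 add_le_mono1) linarith
    then have small: "m * (3 ^ card T * ((q + 1) * E) + B) < p" using p by linarith
    have "\<exists>i\<in>T. \<exists>j\<in>T. i \<noteq> j \<and> comm (3 ^ card T * ((q + 1) * E)) (x ^ e i * y ^ f i) (x ^ e j * y ^ f j)"
    proof (rule relation_imp_comm[where c = C and B = B and iz = i])
      show "finite T" by (simp add: T_def)
      show "m \<le> (q + 1) * E" using E_m by simp
    qed (use C_S T_sub deg small s that nz in auto)
    then obtain i j where ij: "i \<in> T" "j \<in> T" "i \<noteq> j" "comm (3 ^ card T * ((q + 1) * E)) (M i) (M j)"
      by (auto simp: M_def)
    \<comment> \<open>By the choice of \<open>t\<close>, commensurability at bound
      \<open>K * E\<close> falls back to \<open>E\<close>, so two distinct representatives would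
      share a class.\<close>
    then have "R i j" using up[OF ij(4) le] T_sub by (auto simp: R_def)
    then have "\<rho> i = \<rho> j" by (rule \<rho>_cong)
    moreover have "\<rho> i = i" if "i \<in> T" for i
      using that \<rho>_cong \<rho> unfolding T_def by auto
    ultimately show False using ij by simp
  qed
  show ?thesis
  proof (rule that[of E])
    show "E \<le> K ^ (q * q) * m" by (rule E_le)
  next
    fix i assume i: "i < q"
    have "Pall * (\<Sum>j | j < q \<and> \<rho> j = \<rho> i. c j * M j) = 0"
      using C_M[of "\<rho> i"] C0[of "\<rho> i"] i by (simp add: T_def)
    then have "(\<Sum>j | j < q \<and> \<rho> j = \<rho> i. c j * M j) = 0" using Pall_nz by simp
    moreover have "\<rho> j = \<rho> i \<longleftrightarrow> comm E (M i) (M j)" if "j < q" for j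
    proof
      assume "\<rho> j = \<rho> i"
      then have "R i j" using \<rho>[OF i] \<rho>[OF that] R_sym R_trans by metis
      then show "comm E (M i) (M j)" by (simp add: R_def)
    next
      assume "comm E (M i) (M j)"
      then have "R i j" using that i by (simp add: R_def)
      then show "\<rho> j = \<rho> i" using \<rho>_cong by metis
    qed
    then have "{j. j < q \<and> \<rho> j = \<rho> i} = {j. j < q \<and> comm E (M i) (M j)}" by auto
    ultimately show "(\<Sum>j | j < q \<and> comm E (x ^ e i * y ^ f i) (x ^ e j * y ^ f j). c j * (x ^ e j * y ^ f j)) = 0"
      by (simp add: M_def)
  next
    show "comm E (x ^ e i * y ^ f i) (x ^ e l * y ^ f l)"
      if "i < q" "j < q" "l < q" "comm E (x ^ e i * y ^ f i) (x ^ e j * y ^ f j)"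
        "comm E (x ^ e j * y ^ f j) (x ^ e l * y ^ f l)" for i j l
      using that by (rule tr[unfolded M_def])
  qed
qed

end

text \<open>Here \<open>aij\<close> says that the terms \<open>i\<close> and \<open>j\<close> of
  \<open>x^k y^n, x^n y^k, x^n, x^k, y^n, y^k\<close> (numbered from 0) are commensurable. The pairs 03, 15, 24,
  whose quotients are \<open>n\<close>-th powers, never are. The classes can only form four perfect matchings.\<close>

lemma six_terms_partition:
  assumes trans:
    "a01 \<and> a12 \<longrightarrow> a02" "a01 \<and> a02 \<longrightarrow> a12" "a02 \<and> a12 \<longrightarrow> a01"
    "a01 \<and> a14 \<longrightarrow> a04" "a01 \<and> a04 \<longrightarrow> a14" "a04 \<and> a14 \<longrightarrow> a01"
    "a02 \<and> a25 \<longrightarrow> a05" "a02 \<and> a05 \<longrightarrow> a25" "a05 \<and> a25 \<longrightarrow> a02"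
    "a04 \<and> a45 \<longrightarrow> a05" "a04 \<and> a05 \<longrightarrow> a45" "a05 \<and> a45 \<longrightarrow> a04"
    "a12 \<and> a23 \<longrightarrow> a13" "a12 \<and> a13 \<longrightarrow> a23" "a13 \<and> a23 \<longrightarrow> a12"
    "a13 \<and> a34 \<longrightarrow> a14" "a13 \<and> a14 \<longrightarrow> a34" "a14 \<and> a34 \<longrightarrow> a13"
    "a23 \<and> a35 \<longrightarrow> a25" "a23 \<and> a25 \<longrightarrow> a35" "a25 \<and> a35 \<longrightarrow> a23"
    "a34 \<and> a45 \<longrightarrow> a35" "a34 \<and> a35 \<longrightarrow> a45" "a35 \<and> a45 \<longrightarrow> a34"
    "\<not> (a01 \<and> a13)" "\<not> (a02 \<and> a23)" "\<not> (a04 \<and> a34)" "\<not> (a05 \<and> a35)"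
    "\<not> (a01 \<and> a05)" "\<not> (a12 \<and> a25)" "\<not> (a13 \<and> a35)" "\<not> (a14 \<and> a45)"
    "\<not> (a02 \<and> a04)" "\<not> (a12 \<and> a14)" "\<not> (a23 \<and> a34)" "\<not> (a25 \<and> a45)"
    and types: "\<not> ((a04 \<or> a12 \<or> a35) \<and> (a01 \<or> a23 \<or> a45))" "\<not> (a02 \<and> a25)"
    and singles: "a01 \<or> a02 \<or> a04 \<or> a05" "a01 \<or> a12 \<or> a13 \<or> a14" "a02 \<or> a12 \<or> a23 \<or> a25"
      "a13 \<or> a23 \<or> a34 \<or> a35" "a04 \<or> a14 \<or> a34 \<or> a45" "a05 \<or> a25 \<or> a35 \<or> a45"
    and swaps: "\<not> (a01 \<and> \<not> a02 \<and> \<not> a04 \<and> \<not> a05)" "\<not> (a23 \<and> \<not> a02 \<and> \<not> a12 \<and> \<not> a25)"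
      "\<not> (a45 \<and> \<not> a04 \<and> \<not> a14 \<and> \<not> a34)"
  shows "(a04 \<and> a35 \<and> a12 \<and> \<not> a01 \<and> \<not> a02 \<and> \<not> a05 \<and> \<not> a13 \<and> \<not> a23 \<and> \<not> a34 \<and> \<not> a14 \<and> \<not> a25 \<and> \<not> a45) \<or>
         (a04 \<and> a13 \<and> a25 \<and> \<not> a01 \<and> \<not> a02 \<and> \<not> a05 \<and> \<not> a12 \<and> \<not> a14 \<and> \<not> a23 \<and> \<not> a34 \<and> \<not> a35 \<and> \<not> a45) \<or>
         (a05 \<and> a34 \<and> a12 \<and> \<not> a01 \<and> \<not> a02 \<and> \<not> a04 \<and> \<not> a13 \<and> \<not> a14 \<and> \<not> a23 \<and> \<not> a25 \<and> \<not> a35 \<and> \<not> a45) \<or>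
         (a02 \<and> a14 \<and> a35 \<and> \<not> a01 \<and> \<not> a04 \<and> \<not> a05 \<and> \<not> a12 \<and> \<not> a13 \<and> \<not> a23 \<and> \<not> a25 \<and> \<not> a34 \<and> \<not> a45)"
  using assms by satx

lemma add_eq_0_cases:
  fixes a b :: "'b::ab_group_add"
  shows "a + b = 0 \<Longrightarrow> a + b = 0" "- a + - b = 0 \<Longrightarrow> a + b = 0" "a + - b = 0 \<Longrightarrow> a = b" "- a + b = 0 \<Longrightarrow> a = b"
  by (auto simp: eq_neg_iff_add_eq_0 neg_eq_iff_add_eq_0 minus_equation_iff simp flip: eq_iff_diff_eq_0 minus_add_distrib)

text \<open>In the application X = x^k, Y = y^k, U = x^n, V = y^n, and each claim refutes one
  matching of \<open>six_terms_partition\<close>. Elimination fixes c X, c Y or c V, possibly up to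
  a sign. One choice leads to c X = - \<eta> and c Y = \<xi>, that is X + Y = 1; the other leads to
  an equality excluded by \<open>ne\<close>.\<close>

lemma matching_contradictions:
  fixes c \<xi> \<eta> X Y U V :: "'b::idom"
  assumes c: "c = \<xi> - \<eta>" and nz: "c \<noteq> 0" "\<xi> \<noteq> 0" "\<eta> \<noteq> 0" "X \<noteq> 0" "Y \<noteq> 0" "U \<noteq> 0" "V \<noteq> 0"
    and Z: "X + Y \<noteq> 1" and ne: "X * V \<noteq> Y * U" "U \<noteq> X" "V \<noteq> Y"
  shows "\<not> (c * (X * V) + \<eta> * V = 0 \<and> \<xi> * X + \<eta> * Y = 0 \<and> c * (Y * U) = \<xi> * U)"
    and "\<not> (c * (X * V) + \<eta> * V = 0 \<and> c * (Y * U) + \<xi> * X = 0 \<and> \<xi> * U = \<eta> * Y)"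
    and "\<not> (c * (X * V) = \<eta> * Y \<and> \<xi> * X = \<eta> * V \<and> c * (Y * U) = \<xi> * U)"
    and "\<not> (c * (X * V) + \<xi> * U = 0 \<and> c * (Y * U) = \<eta> * V \<and> \<xi> * X + \<eta> * Y = 0)"
proof -
  have Z': "\<not> (c * X = - \<eta> \<and> c * Y = \<xi>)"
  proof
    assume "c * X = - \<eta> \<and> c * Y = \<xi>"
    then have "c * (X + Y) = c * 1" unfolding distrib_left by (simp add: c)
    with nz(1) Z show False by (simp only: mult_cancel_left) auto
  qed
  have cX: "c * X = - \<eta>" if "c * (X * V) + \<eta> * V = 0"
  proof -
    have "(c * X + \<eta>) * V = 0" using that by (simp add: algebra_simps)
    then show ?thesis using nz by (simp add: eq_neg_iff_add_eq_0)
  qed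
  have cY: "c * Y = \<xi>" if "c * (Y * U) = \<xi> * U"
  proof -
    have "(c * Y) * U = \<xi> * U" using that by (simp add: algebra_simps)
    then show ?thesis using nz by simp
  qed
  show "\<not> (c * (X * V) + \<eta> * V = 0 \<and> \<xi> * X + \<eta> * Y = 0 \<and> c * (Y * U) = \<xi> * U)"
    using cX cY Z' by blast
  show "\<not> (c * (X * V) + \<eta> * V = 0 \<and> c * (Y * U) + \<xi> * X = 0 \<and> \<xi> * U = \<eta> * Y)"
  proof (intro notI, elim conjE)
    assume 1: "c * (X * V) + \<eta> * V = 0" and 2: "c * (Y * U) + \<xi> * X = 0" and 3: "\<xi> * U = \<eta> * Y"
    note cX = cX[OF 1]
    have "\<eta> * ((c * Y) * (c * Y)) = c * (c * Y) * (\<eta> * Y)" by (simp only: mult_ac)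
    also have "\<dots> = c * \<xi> * (c * (Y * U))" unfolding 3[symmetric] by (simp only: mult_ac)
    also have "c * (Y * U) = - (\<xi> * X)" using 2 by (simp add: eq_neg_iff_add_eq_0)
    also have "c * \<xi> * - (\<xi> * X) = - (\<xi> * \<xi> * (c * X))" by (simp add: algebra_simps)
    also have "\<dots> = \<eta> * (\<xi> * \<xi>)" unfolding cX by (simp add: algebra_simps)
    finally have "c * Y = \<xi> \<or> c * Y = - \<xi>" using nz(3) by (intro iffD1[OF square_eq_iff]) simp
    then have cY: "c * Y = - \<xi>" using cX Z' by blast
    have "\<xi> * (c * U) = c * (\<eta> * Y)" unfolding 3[symmetric] by (simp only: mult_ac)
    also have "\<dots> = \<eta> * (c * Y)" by (simp only: mult_ac)
    also have "\<dots> = \<xi> * (c * X)" unfolding cX cY by (simp add: algebra_simps)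
    finally have "U = X" using nz by simp
    with ne show False by simp
  qed
  show "\<not> (c * (X * V) = \<eta> * Y \<and> \<xi> * X = \<eta> * V \<and> c * (Y * U) = \<xi> * U)"
  proof (intro notI, elim conjE)
    assume 1: "c * (X * V) = \<eta> * Y" and 2: "\<xi> * X = \<eta> * V" and 3: "c * (Y * U) = \<xi> * U"
    note cY = cY[OF 3]
    have "\<eta> * ((c * V) * (c * V)) = c * c * V * (\<eta> * V)" by (simp only: mult_ac)
    also have "\<dots> = c * \<xi> * (c * (X * V))" unfolding 2[symmetric] by (simp only: mult_ac)
    also have "\<dots> = \<eta> * (\<xi> * (c * Y))" unfolding 1 by (simp only: mult_ac)
    also have "\<dots> = \<eta> * (\<xi> * \<xi>)" unfolding cY ..
    finally have "c * V = \<xi> \<or> c * V = - \<xi>" using nz(3) by (intro iffD1[OF square_eq_iff]) simp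
    moreover have "c * V \<noteq> \<xi>"
    proof
      assume "c * V = \<xi>"
      then have "c * V = c * Y" using cY by simp
      then show False using nz(1) ne(3) by simp
    qed
    ultimately have cV: "c * V = - \<xi>" by blast
    have "\<xi> * (c * X) = c * (\<eta> * V)" unfolding 2[symmetric] by (simp only: mult_ac)
    also have "\<dots> = \<eta> * (c * V)" by (simp only: mult_ac)
    also have "\<dots> = \<xi> * (- \<eta>)" unfolding cV by (simp add: algebra_simps)
    finally have "c * X = - \<eta>" using nz(2) by (simp only: mult_cancel_left) auto
    with cY Z' show False by blast
  qed
  show "\<not> (c * (X * V) + \<xi> * U = 0 \<and> c * (Y * U) = \<eta> * V \<and> \<xi> * X + \<eta> * Y = 0)"
  proof (intro notI, elim conjE)
    assume 1: "c * (X * V) + \<xi> * U = 0" and 2: "c * (Y * U) = \<eta> * V" and 3: "\<xi> * X + \<eta> * Y = 0"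
    have 1: "\<xi> * U = - (c * (X * V))" using 1 by (simp add: eq_neg_iff_add_eq_0 add.commute)
    have 3: "\<xi> * X = - (\<eta> * Y)" using 3 by (simp add: eq_neg_iff_add_eq_0)
    have "(\<eta> * V) * ((c * Y) * (c * Y)) = c * Y * c * V * (\<eta> * Y)" by (simp only: mult_ac)
    also have "\<dots> = - (c * Y * c * V * (\<xi> * X))" unfolding 3 by simp
    also have "\<dots> = \<xi> * (c * Y * - (c * (X * V)))" by (simp add: algebra_simps)
    also have "\<dots> = \<xi> * \<xi> * (c * (Y * U))" unfolding 1[symmetric] by (simp only: mult_ac)
    also have "\<dots> = (\<eta> * V) * (\<xi> * \<xi>)" unfolding 2 by (simp only: mult_ac)
    finally have "c * Y = \<xi> \<or> c * Y = - \<xi>" using nz(3,7) by (intro iffD1[OF square_eq_iff]) simp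
    then show False
    proof
      assume cY: "c * Y = \<xi>"
      have "\<xi> * (c * X) = c * (\<xi> * X)" by (simp only: mult_ac)
      also have "\<dots> = - (\<eta> * (c * Y))" unfolding 3 by (simp add: algebra_simps)
      also have "\<dots> = \<xi> * (- \<eta>)" unfolding cY by simp
      finally have "c * X = - \<eta>" using nz(2) by (simp only: mult_cancel_left) auto
      with cY Z' show False by blast
    next
      assume cY: "c * Y = - \<xi>"
      have "\<xi> * (c * X) = c * (\<xi> * X)" by (simp only: mult_ac)
      also have "\<dots> = - (\<eta> * (c * Y))" unfolding 3 by (simp add: algebra_simps)
      also have "\<dots> = \<xi> * \<eta>" unfolding cY by simp
      finally have cX: "c * X = \<eta>" using nz(2) by simp
      have "c * (X * V) = c * X * V" by (simp only: mult_ac)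
      also have "\<dots> = c * (Y * U)" unfolding cX 2 ..
      finally have "X * V = Y * U" using nz(1) by simp
      with ne show False by simp
    qed
  qed
qed

section \<open>Heights of the quotients in the six-term relation\<close>

context small_arc begin

lemma comm_cancel: assumes "comm E (w * f) (w * g)" "w \<noteq> 0" shows "comm E f g"
proof -
  from assms(1) obtain A B where AB: "A \<in> S E" "B \<in> S E" "A \<noteq> 0" "B \<noteq> 0" "A * (w * f) = B * (w * g)"
    unfolding comm_def by blast
  then have "w * (A * f) = w * (B * g)" by (simp only: mult_ac)
  then have "A * f = B * g" using assms(2) by (simp only: mult_cancel_left) auto
  with AB show ?thesis unfolding comm_def by blast
qed

lemma x_not_const: "\<nexists>a. x = fps_const a * 1"
proof
  assume "\<exists>a. x = fps_const a * 1"
  then obtain a where "x = fps_const a" by auto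
  then have "poly (map_poly fps_const [:-a, 1:]) x = 0" by (simp add: Polynomial.map_poly_pCons flip: fps_const_neg)
  from x_transcendental[OF this] show False by simp
qed

lemma comm_x: assumes "comm E (x ^ a) 1" shows "a \<le> m * E"
proof -
  from assms obtain A B where AB: "A \<in> S E" "B \<in> S E" "A \<noteq> 0" "A * x ^ a = B * 1"
    unfolding comm_def by blast
  show ?thesis
    by (rule height_bound[OF rel S_x S_one _ x_not_const AB(1,2,3)]) (use AB(4) in auto)
qed

lemma comm_y: assumes "comm E (y ^ a) 1" "\<nexists>a. y = fps_const a * 1" shows "a \<le> m * E"
proof -
  from assms obtain A B where AB: "A \<in> S E" "B \<in> S E" "A \<noteq> 0" "A * y ^ a = B * 1"
    unfolding comm_def by blast
  show ?thesis
    by (rule height_bound[OF rel S_y S_one _ assms(2) AB(1,2,3)]) (use AB(4) in auto)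
qed

lemma comm_xy: assumes "comm E (x ^ a) (y ^ a)" "\<nexists>a. x = fps_const a * y" shows "a \<le> m * E"
proof -
  from assms obtain A B where AB: "A \<in> S E" "B \<in> S E" "A \<noteq> 0" "A * x ^ a = B * y ^ a"
    unfolding comm_def by blast
  show ?thesis by (rule height_bound[OF rel S_x S_y unit_y assms(2) AB(1,2,3,4)])
qed

text \<open>Eliminate y between the quotients x^(k-n) y^n and x^n y^(-k) by taking the powers k and
  n. What remains is x to the exponent n^2 - (n-k) k, the determinant of the exponents up to sign,
  and its height is at most (k + n) E.\<close>

lemma comm_determinant:
  assumes 1: "comm E (x ^ k * y ^ n) (x ^ n)" and 2: "comm E (x ^ n) (y ^ k)" and k: "k \<le> n"
  shows "n * n - (n - k) * k \<le> m * ((k + n) * E)"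
proof -
  have "comm E (x ^ k * y ^ n) (x ^ k * x ^ (n - k))" using 1 k by (simp flip: power_add)
  then have "comm E (y ^ n) (x ^ (n - k))" by (rule comm_cancel) (use x_nz in simp)
  then obtain A B where AB: "A \<in> S E" "B \<in> S E" "A \<noteq> 0" "B \<noteq> 0" "A * y ^ n = B * x ^ (n - k)"
    unfolding comm_def by blast
  from 2 obtain A' B' where AB': "A' \<in> S E" "B' \<in> S E" "A' \<noteq> 0" "B' \<noteq> 0" "A' * x ^ n = B' * y ^ k"
    unfolding comm_def by blast
  define N where "N = n * n - (n - k) * k"
  have "(n - k) * k \<le> n * n" using k by (intro mult_mono) auto
  then have N: "n * n = (n - k) * k + N" by (simp add: N_def)
  have "x ^ ((n - k) * k) * (A ^ k * A' ^ n * x ^ N) = A ^ k * (A' * x ^ n) ^ n"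
    by (simp add: N power_mult_distrib power_mult[symmetric] power_add mult_ac)
  also have "\<dots> = B' ^ n * (A * y ^ n) ^ k"
    unfolding AB'(5) by (simp add: power_mult_distrib power_mult[symmetric] mult_ac)
  also have "\<dots> = x ^ ((n - k) * k) * (B ^ k * B' ^ n * 1)"
    unfolding AB(5) by (simp add: power_mult_distrib power_mult[symmetric] mult_ac)
  finally have eq: "A ^ k * A' ^ n * x ^ N = B ^ k * B' ^ n * 1" using x_nz by (simp only: mult_cancel_left) auto
  have "A ^ k * A' ^ n \<in> S ((k + n) * E)" "B ^ k * B' ^ n \<in> S ((k + n) * E)"
    unfolding add_mult_distrib by (intro S_mult S_power AB AB')+
  moreover have "A ^ k * A' ^ n \<noteq> 0" "B ^ k * B' ^ n \<noteq> 0" using AB AB' by auto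
  ultimately have "comm ((k + n) * E) (x ^ N) 1" unfolding comm_def using eq by blast
  from comm_x[OF this] show ?thesis by (simp add: N_def)
qed

text \<open>The constant 5103 is the ratio \<open>3^6 (6 + 1)\<close> of \<open>unit_partition\<close> for six terms.\<close>

lemma degree_lower_bound:
  assumes kn: "0 < k" "k < n"
    and star: "(\<xi> - \<eta>) * (x ^ k * y ^ n - x ^ n * y ^ k) + \<xi> * (x ^ n - x ^ k) + \<eta> * (y ^ n - y ^ k) = 0"
    and nz: "\<xi> \<noteq> 0" "\<eta> \<noteq> 0" "\<xi> \<noteq> \<eta>" and Z: "x ^ k + y ^ k \<noteq> 1"
    and nc: "\<nexists>a. y = fps_const a * 1" "\<nexists>a. x = fps_const a * y"
    and p: "m * (5103 ^ 37 * m + 2 * n) < p"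
  shows "n \<le> 4 * (m * (5103 ^ 36 * m))"
proof (rule ccontr)
  assume n_large: "\<not> ?thesis"
  \<comment> \<open>Exponents and coefficients of the six terms, numbered as in
    \<open>six_terms_partition\<close>.\<close>
  define e f where "e = nth [k, n, n, k, 0, 0]" and "f = nth [n, k, 0, 0, n, k]"
  define c where "c = nth [\<xi> - \<eta>, \<eta> - \<xi>, \<xi>, - \<xi>, \<eta>, - \<eta>]"
  have six: "(\<Sum>i<6. g i) = g 0 + g 1 + g 2 + g 3 + g 4 + g (5::nat)" for g :: "nat \<Rightarrow> 'a fps"
    by (simp add: eval_nat_numeral)
  have lt6: "i < 6 \<longleftrightarrow> i = 0 \<or> i = 1 \<or> i = 2 \<or> i = 3 \<or> i = 4 \<or> i = (5::nat)" for i by auto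
  have c_S: "c i \<in> S m" if "i < 6" for i
  proof -
    have "\<xi> - \<eta> \<in> S m" "\<eta> - \<xi> \<in> S m" "- \<xi> \<in> S m" "- \<eta> \<in> S m"
      by (intro S_diff S_uminus \<xi> \<eta>)+
    then show ?thesis using that \<xi> \<eta> unfolding lt6 c_def by auto
  qed
  have ef: "e i + f i \<le> 2 * n" if "i < 6" for i
    using that kn unfolding lt6 e_def f_def by auto
  have p': "m * ((3 ^ 6 * (6 + 1)) ^ (6 * 6 + 1) * m + 2 * n) < p" using p by simp
  have sum0: "(\<Sum>i<6. c i * (x ^ e i * y ^ f i)) = 0"
    using star unfolding six c_def e_def f_def by (simp add: algebra_simps)
  obtain E where E0: "E \<le> (3 ^ 6 * (6 + 1)) ^ (6 * 6) * m"
    and tr: "\<And>i j l. i < 6 \<Longrightarrow> j < 6 \<Longrightarrow> l < 6 \<Longrightarrow> comm E (x ^ e i * y ^ f i) (x ^ e j * y ^ f j) \<Longrightarrow>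
       comm E (x ^ e j * y ^ f j) (x ^ e l * y ^ f l) \<Longrightarrow> comm E (x ^ e i * y ^ f i) (x ^ e l * y ^ f l)"
    and cls: "\<And>i. i < 6 \<Longrightarrow> (\<Sum>j | j < 6 \<and> comm E (x ^ e i * y ^ f i) (x ^ e j * y ^ f j). c j * (x ^ e j * y ^ f j)) = 0"
    by (rule unit_partition[where q = 6, OF c_S ef p' sum0 zero_less_numeral]) (assumption | rule that)+
  have E: "E \<le> 5103 ^ 36 * m" using E0 by simp
  define R where "R = (\<lambda>i j. comm E (x ^ e i * y ^ f i) (x ^ e j * y ^ f j))"
  define t where "t = (\<lambda>i. c i * (x ^ e i * y ^ f i))"
  have R_refl: "R i i" for i by (simp add: R_def comm_refl)
  have R_sym: "R i j = R j i" for i j unfolding R_def using comm_sym by blast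
  have R_tr: "R i j \<Longrightarrow> R j l \<Longrightarrow> R i l" if "i < 6" "j < 6" "l < 6" for i j l
    unfolding R_def using tr that by blast
  have sums: "(if R i 0 then t 0 else 0) + (if R i 1 then t 1 else 0) + (if R i 2 then t 2 else 0)
      + (if R i 3 then t 3 else 0) + (if R i 4 then t 4 else 0) + (if R i 5 then t 5 else 0) = 0" if "i < 6" for i
  proof -
    have "0 = (\<Sum>j\<in>{j\<in>{..<6}. R i j}. t j)" using cls[OF that] by (simp add: R_def t_def)
    also have "\<dots> = (\<Sum>j<6. if R i j then t j else 0)" by (rule sum.inter_filter) simp
    finally show ?thesis unfolding six by simp
  qed
  have nz': "x ^ a \<noteq> 0" "y ^ a \<noteq> 0" for a using x_nz y_nz by auto
  have t_nz: "t i \<noteq> 0" if "i < 6" for i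
    using that nz unfolding lt6 t_def c_def by (auto simp: x_nz y_nz)
  have Em: "4 * (m * E) < n" using n_large mult_le_mono2[OF E, of m] by linarith
  \<comment> \<open>The quotients in these three pairs are y^n, x^n and (x / y)^n up to inversion;
    their exponent exceeds the height bound.\<close>
  have n03: "\<not> R 0 3"
  proof
    assume "R 0 3"
    then have "comm E (x ^ k * y ^ n) (x ^ k * 1)" by (simp add: R_def e_def f_def)
    from comm_y[OF comm_cancel[OF this nz'(1)] nc(1)] Em kn show False by linarith
  qed
  have n15: "\<not> R 1 5"
  proof
    assume "R 1 5"
    then have "comm E (y ^ k * x ^ n) (y ^ k * 1)" by (simp add: R_def e_def f_def mult.commute)
    from comm_x[OF comm_cancel[OF this nz'(2)]] Em kn show False by linarith
  qed
  have n24: "\<not> R 2 4"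
  proof
    assume "R 2 4"
    then have "comm E (x ^ n) (y ^ n)" by (simp add: R_def e_def f_def)
    from comm_xy[OF this nc(2)] Em kn show False by linarith
  qed
  \<comment> \<open>Here the quotients are k-th powers of x, y or x / y, and in \<open>nk_le\<close>
    they are (n-k)-th powers. Both kinds together would make n = k + (n-k) too small, which is
    \<open>type1\<close>.\<close>
  have k_le: "k \<le> m * E" if "R 0 4 \<or> R 1 2 \<or> R 3 5"
    using that
  proof (elim disjE)
    assume "R 0 4"
    then have "comm E (y ^ n * x ^ k) (y ^ n * 1)" by (simp add: R_def e_def f_def mult.commute)
    from comm_x[OF comm_cancel[OF this nz'(2)]] show ?thesis .
  next
    assume "R 1 2"
    then have "comm E (x ^ n * y ^ k) (x ^ n * 1)" by (simp add: R_def e_def f_def)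
    from comm_y[OF comm_cancel[OF this nz'(1)] nc(1)] show ?thesis .
  next
    assume "R 3 5"
    then have "comm E (x ^ k) (y ^ k)" by (simp add: R_def e_def f_def)
    from comm_xy[OF this nc(2)] show ?thesis .
  qed
  have split_n: "z ^ n = z ^ k * z ^ (n - k)" for z :: "'a fps" using kn by (simp flip: power_add)
  have nk_le: "n - k \<le> m * E" if "R 0 1 \<or> R 2 3 \<or> R 4 5"
    using that
  proof (elim disjE)
    assume "R 0 1"
    then have "comm E (x ^ n * y ^ k) (x ^ k * y ^ n)" unfolding R_def e_def f_def using comm_sym by simp
    then have "comm E ((x ^ k * y ^ k) * x ^ (n - k)) ((x ^ k * y ^ k) * y ^ (n - k))"
      by (simp only: split_n mult_ac)
    from comm_cancel[OF this] have "comm E (x ^ (n - k)) (y ^ (n - k))" using nz' by simp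
    from comm_xy[OF this nc(2)] show ?thesis .
  next
    assume "R 2 3"
    then have "comm E (x ^ k * x ^ (n - k)) (x ^ k * 1)" unfolding R_def e_def f_def by (simp add: split_n[symmetric])
    from comm_x[OF comm_cancel[OF this nz'(1)]] show ?thesis .
  next
    assume "R 4 5"
    then have "comm E (y ^ k * y ^ (n - k)) (y ^ k * 1)" unfolding R_def e_def f_def by (simp add: split_n[symmetric])
    from comm_y[OF comm_cancel[OF this nz'(2)] nc(1)] show ?thesis .
  qed
  have type1: "\<not> ((R 0 4 \<or> R 1 2 \<or> R 3 5) \<and> (R 0 1 \<or> R 2 3 \<or> R 4 5))"
  proof
    assume "(R 0 4 \<or> R 1 2 \<or> R 3 5) \<and> (R 0 1 \<or> R 2 3 \<or> R 4 5)"
    then have "k \<le> m * E" "n - k \<le> m * E" using k_le nk_le by auto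
    with Em kn show False by linarith
  qed
  \<comment> \<open>The exponent n^2 - (n-k) k is at least n^2 / 2, while the height bound is at
    most 2 n m E. This is where the factor 4 of the statement comes from.\<close>
  have type2: "\<not> (R 0 2 \<and> R 2 5)"
  proof
    assume a: "R 0 2 \<and> R 2 5"
    then have "comm E (x ^ k * y ^ n) (x ^ n)" "comm E (x ^ n) (y ^ k)" by (auto simp: R_def e_def f_def)
    from comm_determinant[OF this] kn have "n * n - (n - k) * k \<le> m * ((k + n) * E)" by simp
    also have "\<dots> \<le> m * ((n + n) * E)" using kn by simp
    also have "\<dots> = 2 * (n * (m * E))" by (simp add: mult_ac)
    finally have "2 * (n * n - (n - k) * k) \<le> n * (4 * (m * E))" by (simp add: mult_ac)
    also have "\<dots> < n * n" using Em kn by simp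
    finally have "n * n < 2 * ((n - k) * k)" by linarith
    moreover have "2 * ((n - k) * k) \<le> n * n"
    proof -
      obtain j where "n = k + j" using kn by (metis less_imp_add_positive)
      then show ?thesis by (simp add: algebra_simps)
    qed
    ultimately show False by linarith
  qed
  \<comment> \<open>Equality is commensurability with bound 0, and then the height bounds force the
    exponent to be 0.\<close>
  have one_nz: "comm 0 f g" if "f = g" for f g using that comm_refl by simp
  have ne_x: "x ^ n \<noteq> x ^ k"
  proof
    assume "x ^ n = x ^ k"
    then have "comm 0 (x ^ k * x ^ (n - k)) (x ^ k * 1)" by (intro one_nz) (simp add: split_n[symmetric])
    from comm_x[OF comm_cancel[OF this nz'(1)]] kn show False by simp
  qed
  have ne_y: "y ^ n \<noteq> y ^ k"
  proof
    assume "y ^ n = y ^ k"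
    then have "comm 0 (y ^ k * y ^ (n - k)) (y ^ k * 1)" by (intro one_nz) (simp add: split_n[symmetric])
    from comm_y[OF comm_cancel[OF this nz'(2)] nc(1)] kn show False by simp
  qed
  have ne_xy: "x ^ k * y ^ n \<noteq> y ^ k * x ^ n"
  proof
    assume "x ^ k * y ^ n = y ^ k * x ^ n"
    then have "comm 0 ((x ^ k * y ^ k) * x ^ (n - k)) ((x ^ k * y ^ k) * y ^ (n - k))"
      by (intro one_nz) (simp only: split_n mult_ac)
    from comm_cancel[OF this] have "comm 0 (x ^ (n - k)) (y ^ (n - k))" using nz' by simp
    from comm_xy[OF this nc(2)] kn show False by simp
  qed
  have t_eq: "t 0 = (\<xi> - \<eta>) * (x ^ k * y ^ n)" "t 1 = - ((\<xi> - \<eta>) * (y ^ k * x ^ n))" "t 2 = \<xi> * x ^ n"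
    "t 3 = - (\<xi> * x ^ k)" "t 4 = \<eta> * y ^ n" "t 5 = - (\<eta> * y ^ k)"
    by (simp_all add: t_def c_def e_def f_def algebra_simps)
  note t_eq = t_eq t_eq(2)[unfolded One_nat_def]
  have s: "t 0 + (if R 0 1 then t 1 else 0) + (if R 0 2 then t 2 else 0) + (if R 0 4 then t 4 else 0) + (if R 0 5 then t 5 else 0) = 0"
    "(if R 0 1 then t 0 else 0) + t 1 + (if R 1 2 then t 2 else 0) + (if R 1 3 then t 3 else 0) + (if R 1 4 then t 4 else 0) = 0"
    "(if R 0 2 then t 0 else 0) + (if R 1 2 then t 1 else 0) + t 2 + (if R 2 3 then t 3 else 0) + (if R 2 5 then t 5 else 0) = 0"
    "(if R 1 3 then t 1 else 0) + (if R 2 3 then t 2 else 0) + t 3 + (if R 3 4 then t 4 else 0) + (if R 3 5 then t 5 else 0) = 0"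
    "(if R 0 4 then t 0 else 0) + (if R 1 4 then t 1 else 0) + (if R 3 4 then t 3 else 0) + t 4 + (if R 4 5 then t 5 else 0) = 0"
    "(if R 0 5 then t 0 else 0) + (if R 2 5 then t 2 else 0) + (if R 3 5 then t 3 else 0) + (if R 4 5 then t 4 else 0) + t 5 = 0"
    using sums[of 0] sums[of 1] sums[of 2] sums[of 3] sums[of 4] sums[of 5] n03 n15 n24
    by (simp_all only: R_refl R_sym[of 1 0] R_sym[of 2 0] R_sym[of 2 1] R_sym[of 3 0] R_sym[of 3 1] R_sym[of 3 2]
      R_sym[of 4 0] R_sym[of 4 1] R_sym[of 4 2] R_sym[of 4 3] R_sym[of 5 0] R_sym[of 5 1] R_sym[of 5 2] R_sym[of 5 3] R_sym[of 5 4]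
      if_True if_False add_0 add_0_right)
  have TR: "R i j \<and> R j l \<longrightarrow> R i l" "R i j \<and> R i l \<longrightarrow> R j l" "R i l \<and> R j l \<longrightarrow> R i j"
    if "i < 6" "j < 6" "l < 6" for i j l
    using R_tr[OF that] R_tr[OF that(2,1,3)] R_tr[OF that(1,3,2)] R_sym by blast+
  have N013: "\<not> (R 0 1 \<and> R 1 3)" using TR(1)[of 0 1 3] n03 by simp
  have N023: "\<not> (R 0 2 \<and> R 2 3)" using TR(1)[of 0 2 3] n03 by simp
  have N043: "\<not> (R 0 4 \<and> R 3 4)" using TR(3)[of 0 3 4] n03 by simp
  have N053: "\<not> (R 0 5 \<and> R 3 5)" using TR(3)[of 0 3 5] n03 by simp
  have N105: "\<not> (R 0 1 \<and> R 0 5)" using TR(2)[of 0 1 5] n15 by simp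
  have N125: "\<not> (R 1 2 \<and> R 2 5)" using TR(1)[of 1 2 5] n15 by simp
  have N135: "\<not> (R 1 3 \<and> R 3 5)" using TR(1)[of 1 3 5] n15 by simp
  have N145: "\<not> (R 1 4 \<and> R 4 5)" using TR(1)[of 1 4 5] n15 by simp
  have N204: "\<not> (R 0 2 \<and> R 0 4)" using TR(2)[of 0 2 4] n24 by simp
  have N214: "\<not> (R 1 2 \<and> R 1 4)" using TR(2)[of 1 2 4] n24 by simp
  have N234: "\<not> (R 2 3 \<and> R 3 4)" using TR(1)[of 2 3 4] n24 by simp
  have N254: "\<not> (R 2 5 \<and> R 4 5)" using TR(3)[of 2 4 5] n24 by simp
  note N = N013 N023 N043 N053 N105 N125 N135 N145 N204 N214 N234 N254
  have mc: "x ^ k \<noteq> 0" "y ^ k \<noteq> 0" "x ^ n \<noteq> 0" "y ^ n \<noteq> 0" "\<xi> - \<eta> \<noteq> 0" using nz' nz(3) by auto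
  note MC = matching_contradictions[OF refl mc(5) nz(1,2) mc(1-4) Z ne_xy ne_x ne_y]
  have "(R 0 4 \<and> R 3 5 \<and> R 1 2 \<and> \<not> R 0 1 \<and> \<not> R 0 2 \<and> \<not> R 0 5 \<and> \<not> R 1 3 \<and> \<not> R 2 3 \<and> \<not> R 3 4 \<and> \<not> R 1 4 \<and> \<not> R 2 5 \<and> \<not> R 4 5) \<or>
         (R 0 4 \<and> R 1 3 \<and> R 2 5 \<and> \<not> R 0 1 \<and> \<not> R 0 2 \<and> \<not> R 0 5 \<and> \<not> R 1 2 \<and> \<not> R 1 4 \<and> \<not> R 2 3 \<and> \<not> R 3 4 \<and> \<not> R 3 5 \<and> \<not> R 4 5) \<or>
         (R 0 5 \<and> R 3 4 \<and> R 1 2 \<and> \<not> R 0 1 \<and> \<not> R 0 2 \<and> \<not> R 0 4 \<and> \<not> R 1 3 \<and> \<not> R 1 4 \<and> \<not> R 2 3 \<and> \<not> R 2 5 \<and> \<not> R 3 5 \<and> \<not> R 4 5) \<or>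
         (R 0 2 \<and> R 1 4 \<and> R 3 5 \<and> \<not> R 0 1 \<and> \<not> R 0 4 \<and> \<not> R 0 5 \<and> \<not> R 1 2 \<and> \<not> R 1 3 \<and> \<not> R 2 3 \<and> \<not> R 2 5 \<and> \<not> R 3 4 \<and> \<not> R 4 5)" (is "?h1 \<or> ?h2 \<or> ?h3 \<or> ?h4")
  proof (rule six_terms_partition)
    show "R 0 1 \<or> R 0 2 \<or> R 0 4 \<or> R 0 5" using s(1) t_nz[of 0] by (auto split: if_splits)
    show "R 0 1 \<or> R 1 2 \<or> R 1 3 \<or> R 1 4" using s(2) t_nz[of 1] by (auto split: if_splits)
    show "R 0 2 \<or> R 1 2 \<or> R 2 3 \<or> R 2 5" using s(3) t_nz[of 2] by (auto split: if_splits)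
    show "R 1 3 \<or> R 2 3 \<or> R 3 4 \<or> R 3 5" using s(4) t_nz[of 3] by (auto split: if_splits)
    show "R 0 4 \<or> R 1 4 \<or> R 3 4 \<or> R 4 5" using s(5) t_nz[of 4] by (auto split: if_splits)
    show "R 0 5 \<or> R 2 5 \<or> R 3 5 \<or> R 4 5" using s(6) t_nz[of 5] by (auto split: if_splits)
    show "\<not> (R 0 1 \<and> \<not> R 0 2 \<and> \<not> R 0 4 \<and> \<not> R 0 5)"
    proof (intro notI, elim conjE)
      assume "R 0 1" "\<not> R 0 2" "\<not> R 0 4" "\<not> R 0 5"
      with s(1) have "(\<xi> - \<eta>) * (x ^ k * y ^ n - y ^ k * x ^ n) = 0" by (simp add: t_eq right_diff_distrib)
      then show False using nz(3) ne_xy by (simp only: mult_eq_0_iff right_minus_eq) auto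
    qed
    show "\<not> (R 2 3 \<and> \<not> R 0 2 \<and> \<not> R 1 2 \<and> \<not> R 2 5)"
    proof (intro notI, elim conjE)
      assume "R 2 3" "\<not> R 0 2" "\<not> R 1 2" "\<not> R 2 5"
      with s(3) have "\<xi> * (x ^ n - x ^ k) = 0" by (simp add: t_eq right_diff_distrib)
      then show False using nz(1) ne_x by (simp only: mult_eq_0_iff right_minus_eq) auto
    qed
    show "\<not> (R 4 5 \<and> \<not> R 0 4 \<and> \<not> R 1 4 \<and> \<not> R 3 4)"
    proof (intro notI, elim conjE)
      assume "R 4 5" "\<not> R 0 4" "\<not> R 1 4" "\<not> R 3 4"
      with s(5) have "\<eta> * (y ^ n - y ^ k) = 0" by (simp add: t_eq right_diff_distrib)
      then show False using nz(2) ne_y by (simp only: mult_eq_0_iff right_minus_eq) auto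
    qed
  qed ((rule TR; simp) | rule type1 | rule type2 | rule N)+
  then show False
  proof (elim disjE)
    assume h: "?h1"
    have A04: "t 0 + t 4 = 0" using s(1) h by (simp only: simp_thms if_True if_False add_0 add_0_right)
    have A35: "t 3 + t 5 = 0" using s(4) h by (simp only: simp_thms if_True if_False add_0 add_0_right)
    have A12: "t 1 + t 2 = 0" using s(2) h by (simp only: simp_thms if_True if_False add_0 add_0_right)
    have B04: "(\<xi> - \<eta>) * (x ^ k * y ^ n) + \<eta> * y ^ n = 0" by (rule add_eq_0_cases(1)) (use A04 in \<open>simp only: t_eq\<close>)
    have B35: "\<xi> * x ^ k + \<eta> * y ^ k = 0" by (rule add_eq_0_cases(2)) (use A35 in \<open>simp only: t_eq\<close>)
    have B12: "(\<xi> - \<eta>) * (y ^ k * x ^ n) = \<xi> * x ^ n" by (rule add_eq_0_cases(4)) (use A12 in \<open>simp only: t_eq\<close>)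
    show False by (rule notE[OF MC(1)]) (intro conjI B04 B35 B12)
  next
    assume h: "?h2"
    have A04: "t 0 + t 4 = 0" using s(1) h by (simp only: simp_thms if_True if_False add_0 add_0_right)
    have A13: "t 1 + t 3 = 0" using s(2) h by (simp only: simp_thms if_True if_False add_0 add_0_right)
    have A25: "t 2 + t 5 = 0" using s(3) h by (simp only: simp_thms if_True if_False add_0 add_0_right)
    have B04: "(\<xi> - \<eta>) * (x ^ k * y ^ n) + \<eta> * y ^ n = 0" by (rule add_eq_0_cases(1)) (use A04 in \<open>simp only: t_eq\<close>)
    have B13: "(\<xi> - \<eta>) * (y ^ k * x ^ n) + \<xi> * x ^ k = 0" by (rule add_eq_0_cases(2)) (use A13 in \<open>simp only: t_eq\<close>)
    have B25: "\<xi> * x ^ n = \<eta> * y ^ k" by (rule add_eq_0_cases(3)) (use A25 in \<open>simp only: t_eq\<close>)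
    show False by (rule notE[OF MC(2)]) (intro conjI B04 B13 B25)
  next
    assume h: "?h3"
    have A05: "t 0 + t 5 = 0" using s(1) h by (simp only: simp_thms if_True if_False add_0 add_0_right)
    have A34: "t 3 + t 4 = 0" using s(4) h by (simp only: simp_thms if_True if_False add_0 add_0_right)
    have A12: "t 1 + t 2 = 0" using s(2) h by (simp only: simp_thms if_True if_False add_0 add_0_right)
    have B05: "(\<xi> - \<eta>) * (x ^ k * y ^ n) = \<eta> * y ^ k" by (rule add_eq_0_cases(3)) (use A05 in \<open>simp only: t_eq\<close>)
    have B34: "\<xi> * x ^ k = \<eta> * y ^ n" by (rule add_eq_0_cases(4)) (use A34 in \<open>simp only: t_eq\<close>)
    have B12: "(\<xi> - \<eta>) * (y ^ k * x ^ n) = \<xi> * x ^ n" by (rule add_eq_0_cases(4)) (use A12 in \<open>simp only: t_eq\<close>)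
    show False by (rule notE[OF MC(3)]) (intro conjI B05 B34 B12)
  next
    assume h: "?h4"
    have A02: "t 0 + t 2 = 0" using s(1) h by (simp only: simp_thms if_True if_False add_0 add_0_right)
    have A14: "t 1 + t 4 = 0" using s(2) h by (simp only: simp_thms if_True if_False add_0 add_0_right)
    have A35: "t 3 + t 5 = 0" using s(4) h by (simp only: simp_thms if_True if_False add_0 add_0_right)
    have B02: "(\<xi> - \<eta>) * (x ^ k * y ^ n) + \<xi> * x ^ n = 0" by (rule add_eq_0_cases(1)) (use A02 in \<open>simp only: t_eq\<close>)
    have B14: "(\<xi> - \<eta>) * (y ^ k * x ^ n) = \<eta> * y ^ n" by (rule add_eq_0_cases(4)) (use A14 in \<open>simp only: t_eq\<close>)
    have B35: "\<xi> * x ^ k + \<eta> * y ^ k = 0" by (rule add_eq_0_cases(2)) (use A35 in \<open>simp only: t_eq\<close>)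
    show False by (rule notE[OF MC(4)]) (intro conjI B02 B14 B35)
  qed
qed

end

section \<open>Branches of low degree lie on lines\<close>

context small_arc begin

text \<open>Logarithmic differentiation of Z^n' = W^k' gives n' dZ / Z = k' dW / W. The two sides
  carry the factors k n' and n k', which are equal and invertible in the field. After cancelling
  them and clearing denominators, the terms in x^(k+n) and y^(k+n) drop out and six monomials
  remain.\<close>

lemma log_deriv_relation:
  assumes kn: "k * n' = n * k'" "n' > 0" "k' > 0" "of_nat (k * n') \<noteq> (0::'a)"
    and F: "(x ^ k + y ^ k - 1) ^ n' = (x ^ n + y ^ n - 1) ^ k'" and Z: "x ^ k + y ^ k \<noteq> 1"
  shows "(\<xi> - \<eta>) * (x ^ k * y ^ n - x ^ n * y ^ k) + \<xi> * (x ^ n - x ^ k) + \<eta> * (y ^ n - y ^ k) = 0"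
proof -
  define Z where "Z = x ^ k + y ^ k - 1"
  define W where "W = x ^ n + y ^ n - 1"
  have Z_nz: "Z \<noteq> 0" using Z by (simp add: Z_def)
  have F: "Z ^ n' = W ^ k'" using F by (simp add: Z_def W_def)
  have W_nz: "W \<noteq> 0" using F Z_nz kn(3) by (metis power_eq_0_iff)
  have d1: "d 1 = 0" by (simp add: wderiv_def)
  have d_diff1: "d (f - 1) = d f" for f :: "'a fps" by (simp add: wderiv_def)
  have dsum: "d (x ^ j + y ^ j - 1) = of_nat j * (x ^ j * \<xi> + y ^ j * \<eta>)" for j
    unfolding d_diff1 wderiv_add d_pow[OF dx, symmetric] d_pow[OF dy, symmetric] by (simp add: algebra_simps)
  have dpow: "d (f ^ j) * f = of_nat j * (f ^ j * d f)" for f :: "'a fps" and j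
    by (induction j) (simp_all add: d1 wderiv_mult algebra_simps)
  have "of_nat n' * (Z ^ n' * d Z) * W = d (Z ^ n') * Z * W" by (simp only: dpow)
  also have "\<dots> = d (W ^ k') * W * Z" unfolding F by (simp only: mult_ac)
  also have "\<dots> = of_nat k' * (W ^ k' * d W) * Z" by (simp only: dpow)
  finally have "Z ^ n' * (of_nat n' * d Z * W) = Z ^ n' * (of_nat k' * d W * Z)" unfolding F by (simp only: mult_ac)
  then have "of_nat n' * d Z * W = of_nat k' * d W * Z" using Z_nz by (simp only: mult_cancel_left power_eq_0_iff) auto
  then have "of_nat (k * n') * ((x ^ k * \<xi> + y ^ k * \<eta>) * W) = of_nat (n * k') * ((x ^ n * \<xi> + y ^ n * \<eta>) * Z)"
    unfolding Z_def W_def dsum of_nat_mult by (simp only: mult_ac)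
  then have "of_nat (k * n') * ((x ^ k * \<xi> + y ^ k * \<eta>) * W) = of_nat (k * n') * ((x ^ n * \<xi> + y ^ n * \<eta>) * Z)"
    by (simp only: kn(1))
  moreover have "(of_nat (k * n') :: 'a fps) \<noteq> 0"
  proof
    assume "(of_nat (k * n') :: 'a fps) = 0"
    then have "(of_nat (k * n') :: 'a fps) $ 0 = 0" by (simp only: fps_zero_nth)
    moreover have "(of_nat (k * n') :: 'a fps) $ 0 = (of_nat (k * n') :: 'a)"
      unfolding fps_of_nat[symmetric] by (simp only: fps_nth_fps_const refl if_True)
    ultimately show False using kn(4) by (simp only:)
  qed
  ultimately have "(x ^ k * \<xi> + y ^ k * \<eta>) * W = (x ^ n * \<xi> + y ^ n * \<eta>) * Z"
    by (simp only: mult_cancel_left) auto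
  then show ?thesis unfolding Z_def W_def by (simp add: algebra_simps)
qed

end

context arc begin

lemma two_powers_independent:
  assumes "fps_const a * x ^ k + fps_const b * x ^ n = 0" "k < n"
  shows "a = 0" "b = 0"
proof -
  define c where "c = (\<lambda>l. if l = k then a else if l = n then b else 0)"
  have nc: "x \<noteq> fps_const (x $ 0)"
  proof
    assume "x = fps_const (x $ 0)"
    then have "fps_deriv x = 0" by (metis fps_deriv_const)
    with deriv_x show False by simp
  qed
  have "(\<Sum>l<Suc n. fps_const (c l) * x ^ l) = (\<Sum>l\<in>{k,n}. fps_const (c l) * x ^ l)"
    using assms(2) by (intro sum.mono_neutral_right) (auto simp: c_def)
  also have "\<dots> = 0" using assms by (simp add: c_def)
  finally have s: "(\<Sum>l<Suc n. fps_const (c l) * x ^ l) = 0" .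
  have "c k = 0" by (rule fps_powers_independent[OF nc s]) (use assms in simp)
  then show "a = 0" by (simp add: c_def)
  have "c n = 0" by (rule fps_powers_independent[OF nc s]) simp
  then show "b = 0" using assms(2) by (simp add: c_def)
qed

text \<open>For a relation of least degree the derivative with respect to y cannot vanish on the
  branch: it has smaller degree, and it is not the zero polynomial, because y must occur (x is
  transcendental) and its exponents stay below p.\<close>

lemma minimal_relation:
  assumes u: "u \<noteq> 0" "tdeg_le u m" "ev u = 0" and m: "m < p"
    and char: "\<And>j. 0 < j \<Longrightarrow> j < p \<Longrightarrow> of_nat j \<noteq> (0::'a)"
  obtains v l where "v \<noteq> 0" "tdeg_le v l" "ev v = 0" "0 < l" "l \<le> m" "ev (pderiv v) \<noteq> 0"
proof -
  define Q where "Q = (\<lambda>l. \<exists>v. v \<noteq> 0 \<and> tdeg_le v l \<and> ev v = 0)"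
  define l where "l = (LEAST l. Q l)"
  have "Q m" using u by (auto simp: Q_def)
  then have l: "Q l" "l \<le> m" unfolding l_def by (auto intro: LeastI Least_le)
  then obtain v where v: "v \<noteq> 0" "tdeg_le v l" "ev v = 0" by (auto simp: Q_def)
  have y_dep: "\<exists>j>0. coeff v j \<noteq> 0"
  proof (rule ccontr)
    assume n: "\<not> ?thesis"
    have "v = [:coeff v 0:]"
    proof (rule poly_eqI)
      fix j show "coeff v j = coeff [:coeff v 0:] j" using n by (cases j) auto
    qed
    then have "ev v = poly (map_poly fps_const (coeff v 0)) x" using ev_pCons[of "coeff v 0" 0] by simp
    then have "coeff v 0 = 0" using v(3) x_transcendental by simp
    with \<open>v = [:coeff v 0:]\<close> v(1) show False by simp
  qed
  then obtain j where j: "j > 0" "coeff v j \<noteq> 0" by blast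
  have jl: "j \<le> l"
  proof (rule ccontr)
    assume "\<not> j \<le> l"
    then have "coeff v j = 0" using v(2) by (intro poly_eqI) (simp add: tdeg_le_def)
    with j show False by simp
  qed
  have "pderiv v \<noteq> 0"
  proof
    assume "pderiv v = 0"
    then have "coeff (pderiv v) (j - 1) = 0" by simp
    then have z: "of_nat j * coeff v j = 0" using j(1) by (simp add: coeff_pderiv)
    have "of_nat j = [:of_nat j :: 'a:]" by (simp add: of_nat_poly)
    moreover have "(of_nat j :: 'a) \<noteq> 0" using char[of j] j jl l m by simp
    ultimately show False using z j(2) by simp
  qed
  moreover have "tdeg_le (pderiv v) (l - 1)" by (rule tdeg_le_pderiv[OF v(2)])
  moreover have "\<not> Q (l - 1)" unfolding l_def by (rule not_less_Least) (use jl j in \<open>simp add: l_def\<close>)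
  ultimately have "ev (pderiv v) \<noteq> 0" by (auto simp: Q_def)
  then show ?thesis using that[OF v, of] jl j l by simp
qed

text \<open>With g = v_y from a minimal relation v, the derivation x y g d/dx has the logarithmic
  derivatives y g and - x v_x, both of degree at most m. \<open>degree_lower_bound\<close> excludes
  every branch except those where y or y / x is constant. There the six-term relation reduces to two
  powers of x, and the vanishing of their coefficients gives the stated equations.\<close>

theorem low_degree_relation_trivial:
  assumes u: "u \<noteq> 0" "tdeg_le u m" "ev u = 0"
    and units: "x $ 0 \<noteq> 0" "y $ 0 \<noteq> 0"
    and char: "\<And>j. 0 < j \<Longrightarrow> j < p \<Longrightarrow> of_nat j \<noteq> (0::'a)"
    and kn: "0 < k" "k < n" "k * n' = n * k'" "n' > 0" "k' > 0" "of_nat (k * n') \<noteq> (0::'a)"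
    and F: "(x ^ k + y ^ k - 1) ^ n' = (x ^ n + y ^ n - 1) ^ k'" and Z: "x ^ k + y ^ k \<noteq> 1"
    and size: "4 * (m * (5103 ^ 36 * m)) < n" "m * (5103 ^ 37 * m + 2 * n) < p"
  shows "(y $ 0) ^ k = 1 \<and> (y $ 0) ^ n = 1 \<or> (\<exists>a. y $ 0 = a * x $ 0 \<and> a ^ k = - 1 \<and> a ^ n = - 1)"
proof -
  have "m * 1 \<le> m * (5103 ^ 37 * m + 2 * n)" using kn by (intro mult_le_mono2) simp
  from le_less_trans[OF this size(2)] have mp: "m < p" by simp
  obtain v l where v: "v \<noteq> 0" "tdeg_le v l" "ev v = 0" "0 < l" "l \<le> m" "ev (pderiv v) \<noteq> 0"
    by (rule minimal_relation[OF u mp char])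
  define g where "g = ev (pderiv v)"
  define \<xi> where "\<xi> = y * g"
  define \<eta> where "\<eta> = - (x * ev (map_poly pderiv v))"
  define hh where "hh = x * (y * g)"
  have nz: "x \<noteq> 0" "y \<noteq> 0" "g \<noteq> 0" using units v(6) by (auto simp: g_def)
  have g_y': "g * fps_deriv y = - ev (map_poly pderiv v)"
    using deriv_ev[of v] v(3) by (simp add: g_def eq_neg_iff_add_eq_0 add.commute)
  interpret small_arc x y v m p \<xi> \<eta> hh
  proof
    have "y * g \<in> S (1 + (l - 1))" "x * ev (map_poly pderiv v) \<in> S (1 + (l - 1))"
      unfolding g_def by (intro S_mult S_x S_y ev_in_S tdeg_le_pderiv v)+
    then show "\<xi> \<in> S m" "\<eta> \<in> S m"
      unfolding \<xi>_def \<eta>_def using v(4,5) by (auto intro!: S_uminus elim!: S_mono)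
    show "wderiv hh x = x * \<xi>" by (simp add: wderiv_def hh_def \<xi>_def deriv_x)
    have "wderiv hh y = x * y * (g * fps_deriv y)" by (simp add: wderiv_def hh_def mult_ac)
    then show "wderiv hh y = y * \<eta>" unfolding g_y' by (simp add: \<eta>_def)
    show "hh \<noteq> 0" using nz by (simp add: hh_def)
    show "tdeg_le v m" by (rule tdeg_le_mono[OF v(2,5)])
  qed (use v units char in auto)
  note star = log_deriv_relation[OF kn(3-6) F Z]
  have \<xi>_nz: "\<xi> \<noteq> 0" using nz by (simp add: \<xi>_def)
  show ?thesis
  proof (cases "\<exists>a. y = fps_const a")
    case True
    then obtain a where a: "y = fps_const a" by blast
    have "y * \<eta> = 0" unfolding dy[symmetric] by (simp add: wderiv_def a)
    then have "\<eta> = 0" using nz by simp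
    with star have "\<xi> * (x ^ k * y ^ n - x ^ n * y ^ k + x ^ n - x ^ k) = 0" by (simp add: algebra_simps)
    then have "x ^ k * y ^ n - x ^ n * y ^ k + x ^ n - x ^ k = 0" using \<xi>_nz by simp
    then have "fps_const (a ^ n - 1) * x ^ k + fps_const (1 - a ^ k) * x ^ n = 0"
      unfolding a fps_const_power by (simp add: algebra_simps flip: fps_const_sub)
    from two_powers_independent[OF this kn(2)] show ?thesis by (simp add: a)
  next
    case nc1: False
    show ?thesis
    proof (cases "\<exists>a. y = fps_const a * x")
      case True
      then obtain a where a: "y = fps_const a * x" by blast
      have "y * \<eta> = y * \<xi>" unfolding dy[symmetric] using dx by (simp add: wderiv_def a mult_ac)
      then have "\<eta> = \<xi>" using nz by simp
      with star have "\<xi> * (x ^ n - x ^ k + (y ^ n - y ^ k)) = 0" by (simp add: algebra_simps)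
      then have "x ^ n - x ^ k + (y ^ n - y ^ k) = 0" using \<xi>_nz by simp
      then have "fps_const (- (1 + a ^ k)) * x ^ k + fps_const (1 + a ^ n) * x ^ n = 0"
        unfolding a power_mult_distrib fps_const_power
        by (simp add: algebra_simps flip: fps_const_neg fps_const_add fps_const_sub)
      from two_powers_independent[OF this kn(2)] have "1 + a ^ k = 0" "1 + a ^ n = 0"
        by (simp_all only: neg_equal_0_iff_equal)
      then have "a ^ k = - 1" "a ^ n = - 1" by (simp_all only: eq_neg_iff_add_eq_0 add.commute)
      then show ?thesis by (auto simp: a)
    next
      case nc2: False
      have w1: "m * 1 < p" using mp by simp
      have "\<eta> \<noteq> 0"
      proof
        assume "\<eta> = 0"
        then have "hh * fps_deriv y = 0" using dy by (simp add: wderiv_def)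
        then have "fps_deriv y = 0" using hh by simp
        then have "y * fps_deriv 1 = 1 * fps_deriv y" by simp
        from wronskian_zero_imp_proportional[OF S_y S_one _ this w1] nc1 show False by auto
      qed
      moreover have "\<xi> \<noteq> \<eta>"
      proof
        assume "\<xi> = \<eta>"
        then have "y * wderiv hh x = x * wderiv hh y" unfolding dx dy by (simp add: mult_ac)
        then have "hh * (y * fps_deriv x) = hh * (x * fps_deriv y)" by (simp only: wderiv_def mult_ac)
        then have "y * fps_deriv x = x * fps_deriv y" using hh by (simp only: mult_cancel_left) auto
        from wronskian_zero_imp_proportional[OF S_y S_x nz(1) this w1] nc2 show False by auto
      qed
      moreover have "\<nexists>a. x = fps_const a * y"
      proof
        assume "\<exists>a. x = fps_const a * y"
        then obtain a where a: "x = fps_const a * y" by blast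
        then have "a \<noteq> 0" using nz by auto
        have "fps_const (inverse a) * x = fps_const (inverse a * a) * y"
          unfolding a by (simp add: mult.assoc flip: fps_const_mult)
        then have "y = fps_const (inverse a) * x" using \<open>a \<noteq> 0\<close> by simp
        with nc2 show False by blast
      qed
      moreover have "\<nexists>a. y = fps_const a * 1" using nc1 by simp
      ultimately have "n \<le> 4 * (m * (5103 ^ 36 * m))"
        using degree_lower_bound[OF kn(1,2) star \<xi>_nz _ _ Z _ _ size(2)] by blast
      with size(1) show ?thesis by linarith
    qed
  qed
qed

end

section \<open>Points on the curve\<close>

text \<open>Both powers equal \<open>z^(k n')\<close> on the curve \<open>x^k + y^k = 1 + z^k\<close>, \<open>x^n + y^n = 1 + z^n\<close>.\<close>

definition curve_poly :: "nat \<Rightarrow> nat \<Rightarrow> nat \<Rightarrow> nat \<Rightarrow> 'a::field poly poly" where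
  "curve_poly k n k' n' = ([:monom 1 k:] + monom 1 k - 1) ^ n' - ([:monom 1 n:] + monom 1 n - 1) ^ k'"

lemma tdeg_le_curve_poly:
  assumes "k * n' = n * k'" shows "tdeg_le (curve_poly k n k' n' :: 'a::field poly poly) (k * n')"
proof -
  have b: "tdeg_le ([:monom 1 k:] + monom 1 k - 1 :: 'a poly poly) k" for k
    by (auto simp: tdeg_le_def coeff_pCons coeff_monom coeff_1 split: nat.splits)
  have "tdeg_le (([:monom 1 k:] + monom 1 k - 1) ^ n' :: 'a poly poly) (n' * k)"
    "tdeg_le (([:monom 1 n:] + monom 1 n - 1) ^ k' :: 'a poly poly) (k' * n)"
    by (rule tdeg_le_power[OF b])+
  then show ?thesis unfolding curve_poly_def using assms by (intro tdeg_le_diff) (simp_all add: mult.commute)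
qed

context plane begin

lemma ev_monom_x: "ev [:monom 1 k:] = x ^ k"
  using ev_pCons[of "monom 1 k" 0] by (simp add: map_poly_monom poly_monom hom_one)

lemma ev_monom_y: "ev (monom 1 k) = y ^ k"
  by (simp add: ev_def map_poly_monom poly_monom hom_one)

lemma ev_curve_poly: "ev (curve_poly k n k' n') = (x ^ k + y ^ k - 1) ^ n' - (x ^ n + y ^ n - 1) ^ k'"
  by (simp add: curve_poly_def ev_diff ev_add ev_power ev_1 ev_monom_x ev_monom_y)

lemma ev_of_nat: "ev (of_nat j) = of_nat j"
  by (induction j) (auto simp: ev_add ev_1)

lemma ev_pderiv_curve_poly:
  "ev (pderiv (curve_poly k n k' n')) =
     of_nat n' * (x ^ k + y ^ k - 1) ^ (n' - 1) * (of_nat k * y ^ (k - 1))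
     - of_nat k' * (x ^ n + y ^ n - 1) ^ (k' - 1) * (of_nat n * y ^ (n - 1))"
proof -
  have b: "pderiv ([:monom 1 k:] + monom 1 k - 1 :: 'a poly poly) = of_nat k * monom 1 (k - 1)" for k
    by (simp add: pderiv_add pderiv_diff pderiv_pCons pderiv_monom pderiv_1 of_nat_poly smult_monom)
  have s: "smult (of_nat j) f = of_nat j * f" for j and f :: "'a poly poly"
    by (simp add: of_nat_poly)
  show ?thesis
    unfolding curve_poly_def pderiv_diff[of "_ ^ _" "_ ^ _"] pderiv_power b s
    by (simp only: ev_diff ev_mult ev_power ev_add ev_1 ev_monom_x ev_monom_y ev_of_nat mult.assoc)
qed

end

context plane begin

text \<open>The equation as a polynomial in y alone at a fixed x, the form in which roots are
  counted and Hensel lifting applies.\<close>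

definition fibre :: "'a poly poly \<Rightarrow> 'r poly" where
  "fibre f = map_poly (\<lambda>q. poly (map_poly \<kappa> q) x) f"

lemma ev_fibre: "ev f = poly (fibre f) y"
  by (simp add: ev_def fibre_def)

end

locale idom_plane = plane \<kappa> x y for \<kappa> :: "'a::field \<Rightarrow> 'r::idom" and x y
begin

lemma pderiv_fibre: "pderiv (fibre f) = fibre (pderiv f)"
proof (rule poly_eqI)
  fix j
  have H: "poly (map_poly \<kappa> (of_nat i * q)) x = of_nat i * poly (map_poly \<kappa> q) x" for i q
    by (induction i) (simp_all add: map_add distrib_right)
  show "coeff (pderiv (fibre f)) j = coeff (fibre (pderiv f)) j"
    by (simp only: fibre_def coeff_pderiv coeff_map_poly[where f = "\<lambda>q. poly (map_poly \<kappa> q) x"] H map_poly_0 poly_0)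
qed

end

sublocale arc \<subseteq> idom_plane fps_const x y ..

section \<open>Roots of unity in a field of prime order\<close>

lemma pow_gcd_eq_1:
  fixes z :: "'a::field"
  assumes "z ^ a = 1" "z ^ b = 1" "a > 0" shows "z ^ gcd a b = 1"
proof -
  obtain u v where uv: "a * u = b * v + gcd a b" using bezout_nat[of a b] assms(3) by auto
  have "1 = z ^ (a * u)" using assms(1) by (simp add: power_mult)
  also have "\<dots> = z ^ gcd a b" unfolding uv using assms(2) by (simp add: power_add power_mult)
  finally show ?thesis by simp
qed

lemma card_power_eq_1_le:
  assumes "d > 0" shows "card {z :: 'a::field. z ^ d = 1} \<le> d"
proof -
  let ?q = "monom 1 d - 1 :: 'a poly"
  have "coeff ?q d = 1" using assms by (simp add: coeff_1)
  then have nz: "?q \<noteq> 0" by (metis coeff_0 zero_neq_one)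
  have "degree ?q \<le> d" by (intro degree_diff_le) (auto simp: degree_monom_le)
  moreover have "{z :: 'a. z ^ d = 1} = {z. poly ?q z = 0}" by (auto simp: poly_monom)
  ultimately show ?thesis using card_poly_roots_bound[OF nz] by simp
qed

text \<open>The field of p elements as an abstract type with p a term; a concrete type is supplied
  only at the end.\<close>

locale prime_order_field =
  fixes p :: nat and F :: "'a::{field,finite} itself"
  assumes prime_p: "prime p" and card_F: "CARD('a) = p"
    and of_nat_eq_0: "\<And>j. of_nat j = (0::'a) \<longleftrightarrow> p dvd j" and frob: "\<And>a::'a. a ^ p = a"
begin

lemma fermat: "z ^ (p - 1) = 1" if "z \<noteq> 0" for z :: 'a
proof -
  have "z * z ^ (p - 1) = z * 1" using frob[of z] prime_gt_0_nat[OF prime_p] by (cases p) auto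
  then show ?thesis using that by simp
qed

text \<open>The source of s: combining both equations with the Fermat exponent p - 1 leaves z^s = 1.
  Every fibre of t -> (t^k, t^n) on nonzero t lies in a coset of this group.\<close>

lemma card_common_roots_of_unity:
  assumes "k > 0" shows "card {z::'a. z ^ k = 1 \<and> z ^ n = 1} \<le> gcd (gcd k n) (p - 1)"
proof -
  let ?s = "gcd (gcd k n) (p - 1)"
  have "?s > 0" using assms by simp
  have "{z::'a. z ^ k = 1 \<and> z ^ n = 1} \<subseteq> {z. z ^ ?s = 1}"
  proof clarify
    fix z :: 'a assume z: "z ^ k = 1" "z ^ n = 1"
    then have "z \<noteq> 0" using assms by (auto simp: power_0_left)
    have 1: "z ^ gcd k n = 1" by (rule pow_gcd_eq_1[OF z assms])
    have 2: "gcd k n > 0" using assms by simp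
    show "z ^ ?s = 1" by (rule pow_gcd_eq_1[OF 1 fermat[OF \<open>z \<noteq> 0\<close>] 2])
  qed
  then have "card {z::'a. z ^ k = 1 \<and> z ^ n = 1} \<le> card {z::'a. z ^ ?s = 1}" by (intro card_mono) auto
  also have "\<dots> \<le> ?s" by (rule card_power_eq_1_le) fact
  finally show ?thesis .
qed

end

locale binomial_curve = prime_order_field p F for p and F :: "'a::{field,finite} itself" +
  fixes k n :: nat
  assumes k_pos: "0 < k" and k_less: "k < n"
begin

definition "r = gcd k n"
definition "k' = k div r"
definition "n' = n div r"
definition "D = k * n'"

lemma r_pos: "r > 0" using k_pos by (simp add: r_def)

lemma k_eq: "k = r * k'" and n_eq: "n = r * n'" by (simp_all add: k'_def n'_def r_def)

lemma k'_pos: "k' > 0" and n'_pos: "n' > 0" using k_pos k_less k_eq n_eq by (auto intro: Nat.gr0I)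

lemma kn': "k * n' = n * k'"
  using k_eq n_eq by (metis mult.assoc mult.commute)

lemma D_eq: "D = n * k'" by (simp add: D_def kn')

lemma D_ge: "n \<le> D" using k'_pos by (simp add: D_eq)

definition on_curve :: "'a \<Rightarrow> 'a \<Rightarrow> 'a \<Rightarrow> bool" where
  "on_curve x y z \<longleftrightarrow> z \<noteq> 0 \<and> x ^ k + y ^ k = 1 + z ^ k \<and> x ^ n + y ^ n = 1 + z ^ n"

lemma on_curveD:
  assumes "on_curve x y z"
  shows "z \<noteq> 0" "x ^ k + y ^ k - 1 = z ^ k" "x ^ n + y ^ n - 1 = z ^ n"
proof -
  note a = assms[unfolded on_curve_def]
  note z = conjunct1[OF a] and e = conjunct1[OF conjunct2[OF a]] conjunct2[OF conjunct2[OF a]]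
  show "z \<noteq> 0" by (rule z)
  show "x ^ k + y ^ k - 1 = z ^ k" "x ^ n + y ^ n - 1 = z ^ n"
    unfolding e by (rule add_diff_cancel_left')+
qed

text \<open>The inequality ensures that the y-derivative of the curve equation is nonzero at the
  point when D < p. It excludes the lines x = c with c^k = c^n = 1, which lie on the curve but
  cannot be parametrised by x.\<close>

definition smooth_pts :: "('a \<times> 'a) set" where
  "smooth_pts = {(x,y). x \<noteq> 0 \<and> y \<noteq> 0 \<and> (\<exists>z. on_curve x y z \<and> y ^ (n - k) \<noteq> z ^ (n - k))}"

lemma smooth_ptsE:
  assumes "P \<in> smooth_pts"
  obtains z where "fst P \<noteq> 0" "snd P \<noteq> 0" "on_curve (fst P) (snd P) z" "snd P ^ (n - k) \<noteq> z ^ (n - k)"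
proof -
  have "fst P \<noteq> 0 \<and> snd P \<noteq> 0 \<and> (\<exists>z. on_curve (fst P) (snd P) z \<and> snd P ^ (n - k) \<noteq> z ^ (n - k))"
    using assms unfolding smooth_pts_def by (cases P) (simp only: mem_Collect_eq prod.case fst_conv snd_conv simp_thms)
  then show ?thesis using that by blast
qed

text \<open>The lines y = c and y = a x contained in the curve, which are the exceptional branches
  of \<open>low_degree_relation_trivial\<close>.\<close>

definition trivial_pts :: "('a \<times> 'a) set" where
  "trivial_pts = {(x,y). y ^ k = 1 \<and> y ^ n = 1 \<or> (\<exists>a. y = a * x \<and> a ^ k = - 1 \<and> a ^ n = - 1)}"

text \<open>Multiplied by y z^k z^n, the derivative becomes D z^D y^k z^k (z^(n-k) - y^(n-k)), and p
  does not divide D.\<close>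

lemma curve_derivative_nonzero:
  fixes x y z :: 'a
  assumes "D < p" "y \<noteq> 0" "on_curve x y z" "y ^ (n - k) \<noteq> z ^ (n - k)"
  shows "of_nat n' * (x ^ k + y ^ k - 1) ^ (n' - 1) * (of_nat k * y ^ (k - 1))
     - of_nat k' * (x ^ n + y ^ n - 1) ^ (k' - 1) * (of_nat n * y ^ (n - 1)) \<noteq> 0" (is "?v \<noteq> 0")
proof
  assume v: "?v = 0"
  have z: "z \<noteq> 0" "x ^ k + y ^ k - 1 = z ^ k" "x ^ n + y ^ n - 1 = z ^ n"
    by (rule on_curveD[OF assms(3)])+
  have zD: "(z ^ k) ^ n' = z ^ D" "(z ^ n) ^ k' = z ^ D"
    by (simp_all only: D_def kn' power_mult[symmetric])
  have e1: "z ^ k * (z ^ k) ^ (n' - 1) = z ^ D" "z ^ n * (z ^ n) ^ (k' - 1) = z ^ D"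
    using n'_pos k'_pos zD by (simp_all add: power_eq_if)
  have e2: "y * y ^ (k - 1) = y ^ k" "y * y ^ (n - 1) = y ^ n"
    using k_pos k_less by (simp_all add: power_eq_if)
  have e3: "of_nat n' * of_nat k = (of_nat D :: 'a)" "of_nat k' * of_nat n = (of_nat D :: 'a)"
  proof -
    have "n' * k = D" "k' * n = D" by (simp add: D_def mult.commute, simp add: D_eq mult.commute)
    then show "of_nat n' * of_nat k = (of_nat D :: 'a)" "of_nat k' * of_nat n = (of_nat D :: 'a)"
      by (metis of_nat_mult)+
  qed
  have "0 = y * z ^ k * z ^ n * ?v" by (simp only: v mult_zero_right)
  also have "\<dots> = (of_nat n' * of_nat k) * (z ^ k * (z ^ k) ^ (n' - 1)) * (y * y ^ (k - 1)) * z ^ n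
      - (of_nat k' * of_nat n) * (z ^ n * (z ^ n) ^ (k' - 1)) * (y * y ^ (n - 1)) * z ^ k"
    unfolding z by (simp add: algebra_simps)
  also have "\<dots> = of_nat D * z ^ D * (y ^ k * z ^ n - y ^ n * z ^ k)"
    unfolding e1 e2 e3 by (simp add: algebra_simps)
  also have "y ^ k * z ^ n - y ^ n * z ^ k = y ^ k * z ^ k * (z ^ (n - k) - y ^ (n - k))"
  proof -
    have "w ^ n = w ^ k * w ^ (n - k)" for w :: 'a using k_less by (simp flip: power_add)
    then show ?thesis by (simp add: algebra_simps)
  qed
  finally have "of_nat D = (0::'a)" using z(1) assms(2,4) by auto
  moreover have "\<not> p dvd D" using assms(1) D_ge k_less by (auto dest: dvd_imp_le)
  ultimately show False using of_nat_eq_0 by simp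
qed

text \<open>On a vertical line the points are roots of a polynomial in y of degree at most D, which
  is nonzero because its derivative is nonzero at such a root. This count serves when n is bounded
  by a constant.\<close>

lemma card_smooth_pts_trivial_bound:
  assumes "D < p" shows "card smooth_pts \<le> p * D"
proof -
  have fib: "card {y. (x,y) \<in> smooth_pts} \<le> D" for x
  proof (cases "\<exists>y. (x,y) \<in> smooth_pts")
    case False then show ?thesis by simp
  next
    case True
    interpret pl: idom_plane "\<lambda>a::'a. a" x y for y by unfold_locales auto
    let ?f = "curve_poly k n k' n' :: 'a poly poly"
    let ?g = "pl.fibre ?f"
    have root: "poly ?g y = 0" "poly (pderiv ?g) y \<noteq> 0" if "(x,y) \<in> smooth_pts" for y
    proof -
      have sp: "(x,y) \<in> smooth_pts" by fact
      obtain z where z': "fst (x,y) \<noteq> 0" "snd (x,y) \<noteq> 0" "on_curve (fst (x,y)) (snd (x,y)) z" "snd (x,y) ^ (n - k) \<noteq> z ^ (n - k)"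
        by (rule smooth_ptsE[OF sp])
      note z = z'(2-4)[unfolded fst_conv snd_conv]
      have zz: "x ^ k + y ^ k - 1 = z ^ k" "x ^ n + y ^ n - 1 = z ^ n" by (rule on_curveD[OF z(2)])+
      have "poly ?g y = (z ^ k) ^ n' - (z ^ n) ^ k'"
        unfolding pl.ev_fibre[symmetric] pl.ev_curve_poly zz ..
      then show "poly ?g y = 0" by (simp only: power_mult[symmetric] kn' diff_self)
      show "poly (pderiv ?g) y \<noteq> 0"
        unfolding pl.pderiv_fibre pl.ev_fibre[symmetric] pl.ev_pderiv_curve_poly
        by (rule curve_derivative_nonzero[OF assms z])
    qed
    have "?g \<noteq> 0"
    proof
      assume g0: "?g = 0"
      from True obtain y where "(x,y) \<in> smooth_pts" ..
      from root(2)[OF this] show False unfolding g0 pderiv_0 poly_0 by (rule notE) (rule refl)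
    qed
    have "degree ?g \<le> degree ?f" unfolding pl.fibre_def by (rule degree_map_poly_le)
    also have "\<dots> \<le> D"
    proof (rule degree_le, intro allI impI poly_eqI)
      fix j i assume "D < j"
      moreover have "tdeg_le ?f D" unfolding D_def by (rule tdeg_le_curve_poly[OF kn'])
      ultimately have "coeff (coeff ?f j) i = 0" unfolding tdeg_le_def by (meson trans_less_add2)
      then show "coeff (coeff ?f j) i = coeff 0 i" by (simp only: coeff_0)
    qed
    finally have "degree ?g \<le> D" .
    have "card {y. (x,y) \<in> smooth_pts} \<le> card {y. poly ?g y = 0}"
    proof (rule card_mono)
      show "{y. (x,y) \<in> smooth_pts} \<subseteq> {y. poly ?g y = 0}"
      proof (intro subsetI CollectI root(1))
        fix y assume "y \<in> {y. (x,y) \<in> smooth_pts}" then show "(x,y) \<in> smooth_pts" by (rule CollectD)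
      qed
    qed (rule finite)
    also have "\<dots> \<le> degree ?g" by (rule card_poly_roots_bound) fact
    finally show ?thesis using \<open>degree ?g \<le> D\<close> by simp
  qed
  have "smooth_pts = Sigma UNIV (\<lambda>x. {y. (x,y) \<in> smooth_pts})" by auto
  then have "card smooth_pts = (\<Sum>x\<in>UNIV. card {y. (x,y) \<in> smooth_pts})"
    by (metis card_SigmaI finite_code)
  also have "\<dots> \<le> (\<Sum>x\<in>(UNIV::'a set). D)" by (intro sum_mono fib)
  finally show ?thesis by (simp add: card_F)
qed

text \<open>Hensel lifts each point to a branch, and the y-derivative of the equation clears the
  denominator of y'. A branch with a relation of degree at most \<open>m\<close> would have its
  centre in \<open>trivial_pts\<close>; this provides the hypothesis \<open>indep\<close> of
  \<open>stohr_voloch\<close>.\<close>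

theorem card_nontrivial_smooth_pts:
  assumes D: "D < p" and m: "m > 0" "D * m < p"
    and size: "4 * (m * (5103 ^ 36 * m)) < n" "m * (5103 ^ 37 * m + 2 * n) < p"
  shows "real (card (smooth_pts - trivial_pts)) \<le> 2 * real D * real p / real m + 2 * (real D * real m)\<^sup>2"
proof (cases "smooth_pts - trivial_pts = {}")
  case True show ?thesis unfolding True by simp
next
  case False
  define I where "I = smooth_pts - trivial_pts"
  obtain P0 where P0: "P0 \<in> I" using False by (auto simp: I_def)
  let ?f = "curve_poly k n k' n' :: 'a poly poly"
  define X where "X = (\<lambda>P::'a\<times>'a. fps_const (fst P) + fps_X)"
  have arc_X: "arc (X P)" for P by unfold_locales (simp add: X_def)
  have nth0: "(plane.ev fps_const (X P) y ?f) $ 0 = (fst P ^ k + (y $ 0) ^ k - 1) ^ n' - (fst P ^ n + (y $ 0) ^ n - 1) ^ k'"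
    "(plane.ev fps_const (X P) y (pderiv ?f)) $ 0 =
     of_nat n' * (fst P ^ k + (y $ 0) ^ k - 1) ^ (n' - 1) * (of_nat k * (y $ 0) ^ (k - 1))
     - of_nat k' * (fst P ^ n + (y $ 0) ^ n - 1) ^ (k' - 1) * (of_nat n * (y $ 0) ^ (n - 1))" for P y
  proof -
    interpret arc "X P" y by (rule arc_X)
    have n0: "(of_nat j :: 'a fps) $ 0 = of_nat j" for j by (simp flip: fps_of_nat)
    show "ev ?f $ 0 = (fst P ^ k + (y $ 0) ^ k - 1) ^ n' - (fst P ^ n + (y $ 0) ^ n - 1) ^ k'"
      unfolding ev_curve_poly by (simp add: fps_power_zeroth X_def)
    show "ev (pderiv ?f) $ 0 =
     of_nat n' * (fst P ^ k + (y $ 0) ^ k - 1) ^ (n' - 1) * (of_nat k * (y $ 0) ^ (k - 1))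
     - of_nat k' * (fst P ^ n + (y $ 0) ^ n - 1) ^ (k' - 1) * (of_nat n * (y $ 0) ^ (n - 1))"
      unfolding ev_pderiv_curve_poly by (simp add: fps_power_zeroth X_def n0)
  qed
  have der: "(plane.ev fps_const (X P) y (pderiv ?f)) $ 0 \<noteq> 0" if "P \<in> I" "y $ 0 = snd P" for P y
  proof -
    have "P \<in> smooth_pts" using that by (simp add: I_def)
    then obtain z where z: "fst P \<noteq> 0" "snd P \<noteq> 0" "on_curve (fst P) (snd P) z" "snd P ^ (n - k) \<noteq> z ^ (n - k)"
      by (rule smooth_ptsE)
    show ?thesis unfolding nth0 that(2) by (rule curve_derivative_nonzero[OF D z(2-4)])
  qed
  have "\<exists>y. y $ 0 = snd P \<and> plane.ev fps_const (X P) y ?f = 0" if P: "P \<in> I" for P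
  proof -
    interpret pl: arc "X P" y for y by (rule arc_X)
    have "P \<in> smooth_pts" using P by (simp add: I_def)
    then obtain z where z: "fst P \<noteq> 0" "snd P \<noteq> 0" "on_curve (fst P) (snd P) z" "snd P ^ (n - k) \<noteq> z ^ (n - k)"
      by (rule smooth_ptsE)
    have zz: "fst P ^ k + snd P ^ k - 1 = z ^ k" "fst P ^ n + snd P ^ n - 1 = z ^ n"
      by (rule on_curveD[OF z(3)])+
    have "poly (pl.fibre ?f) (fps_const (snd P)) $ 0 = 0"
      unfolding pl.ev_fibre[symmetric] nth0
      by (simp only: fps_nth_fps_const refl if_True zz power_mult[symmetric] kn' diff_self)
    moreover have "poly (pderiv (pl.fibre ?f)) (fps_const (snd P)) $ 0 \<noteq> 0"
      unfolding pl.pderiv_fibre pl.ev_fibre[symmetric] by (rule der[OF P]) simp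
    ultimately show ?thesis unfolding pl.ev_fibre by (rule fps_hensel)
  qed
  then obtain Y where Y: "\<And>P. P \<in> I \<Longrightarrow> Y P $ 0 = snd P" "\<And>P. P \<in> I \<Longrightarrow> plane.ev fps_const (X P) (Y P) ?f = 0"
    by metis
  \<comment> \<open>Indices outside \<open>I\<close> repeat the branch at \<open>P0\<close>, so that the curve equation holds in the whole
    function ring.\<close>
  define \<pi> where "\<pi> = (\<lambda>P. if P \<in> I then P else P0)"
  have \<pi>: "\<pi> P \<in> I" for P using P0 by (simp add: \<pi>_def)
  define x where "x = (\<lambda>P. X (\<pi> P))"
  define y where "y = (\<lambda>P. Y (\<pi> P))"
  interpret mc: multi_curve x y I
  proof
    show "x P = fps_const (x P $ 0) + fps_X" for P by (simp add: x_def X_def)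
    show "inj_on (\<lambda>P. (x P $ 0, y P $ 0)) I"
      by (rule inj_onI) (auto simp: x_def y_def X_def \<pi>_def Y prod_eq_iff)
    show "finite I" by simp
  qed
  have y0: "y P $ 0 = snd (\<pi> P)" for P using Y(1)[OF \<pi>] by (simp add: y_def)
  have ev0: "mc.ev ?f = 0"
  proof
    fix P show "mc.ev ?f P = 0 P" unfolding mc.ev_apply using Y(2)[OF \<pi>, of P] by (simp add: x_def y_def)
  qed
  have tdeg: "tdeg_le ?f D" using tdeg_le_curve_poly[OF kn'] by (simp add: D_def)
  define h where "h = mc.ev (pderiv ?f)"
  have h_nz: "h P $ 0 \<noteq> 0" for P
    unfolding h_def mc.ev_apply using der[OF \<pi> y0] by (simp add: x_def)
  have f_nz: "?f \<noteq> 0"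
  proof
    assume "?f = 0"
    then have "h P0 = 0" by (simp add: h_def)
    with h_nz[of P0] show False by simp
  qed
  have "real (card I) \<le> 2 * real D * real p / real m + 2 * (real D * real m)\<^sup>2"
  proof (rule mc.stohr_voloch[OF ev0 f_nz tdeg])
    have up: "f \<in> mc.S (D - 1) \<Longrightarrow> f \<in> mc.S D" for f by (erule mc.S_mono) simp
    show "h \<in> mc.S D" unfolding h_def by (intro up mc.ev_in_S tdeg_le_pderiv tdeg)
    have "(\<lambda>P. h P * fps_deriv (y P)) = - mc.ev (map_poly pderiv ?f)"
    proof
      fix P
      interpret a: arc "x P" "y P" by (rule mc.arc_at)
      have "a.ev ?f = 0" using ev0 by (simp flip: mc.ev_apply)
      then show "h P * fps_deriv (y P) = (- mc.ev (map_poly pderiv ?f)) P"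
        using a.deriv_ev[of ?f] by (simp add: h_def mc.ev_apply eq_neg_iff_add_eq_0 add.commute)
    qed
    moreover have "mc.ev (map_poly pderiv ?f) \<in> mc.S D" by (intro up mc.ev_in_S tdeg_le_pderiv tdeg)
    ultimately show "(\<lambda>P. h P * fps_deriv (y P)) \<in> mc.S D" by (simp only: mc.S_uminus)
    show "h P $ 0 \<noteq> 0" for P by (rule h_nz)
    show "of_nat j \<noteq> (0::'a)" if "0 < j" "j < p" for j
      using of_nat_eq_0[of j] that by (auto dest: dvd_imp_le)
    show "of_nat p = (0::'a)" using of_nat_eq_0[of p] by simp
    show "a ^ p = a" for a :: 'a by (rule frob)
    show "m > 0" "D * m < p" by (fact m)+
    fix P and u :: "'a poly poly" assume P: "P \<in> I" and u: "u \<noteq> 0" "tdeg_le u m"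
    interpret a: arc "x P" "y P" by (rule mc.arc_at)
    have xP: "x P $ 0 = fst P" "y P $ 0 = snd P" using P Y(1) by (simp_all add: x_def y_def X_def \<pi>_def)
    have "P \<in> smooth_pts" using P by (simp add: I_def)
    then obtain z where z: "fst P \<noteq> 0" "snd P \<noteq> 0" "on_curve (fst P) (snd P) z" "snd P ^ (n - k) \<noteq> z ^ (n - k)"
      by (rule smooth_ptsE)
    have F0: "a.ev ?f = 0" using ev0 by (simp flip: mc.ev_apply)
    show "a.ev u \<noteq> 0"
    proof
      assume u0: "a.ev u = 0"
      have "(y P $ 0) ^ k = 1 \<and> (y P $ 0) ^ n = 1 \<or> (\<exists>b. y P $ 0 = b * x P $ 0 \<and> b ^ k = - 1 \<and> b ^ n = - 1)"
      proof (rule a.low_degree_relation_trivial[OF u u0 _ _ _ k_pos k_less kn' n'_pos k'_pos _ _ _ size])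
        show "of_nat j \<noteq> (0::'a)" if "0 < j" "j < p" for j
          using of_nat_eq_0[of j] that by (auto dest: dvd_imp_le)
        have "\<not> p dvd D" using D D_ge k_less by (auto dest: dvd_imp_le)
        then show "of_nat (k * n') \<noteq> (0::'a)" using of_nat_eq_0[of D] by (simp add: D_def)
        show "(x P ^ k + y P ^ k - 1) ^ n' = (x P ^ n + y P ^ n - 1) ^ k'"
          using F0 unfolding a.ev_curve_poly by simp
        have "(x P ^ k + y P ^ k - 1) $ 0 = z ^ k"
          using on_curveD(2)[OF z(3)] by (simp add: fps_power_zeroth xP)
        moreover have "z ^ k \<noteq> 0" using on_curveD(1)[OF z(3)] by simp
        ultimately show "x P ^ k + y P ^ k \<noteq> 1"
          by (metis diff_self fps_zero_nth)
      qed (use xP z in auto)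
      then have "P \<in> trivial_pts" by (auto simp: xP trivial_pts_def split_def)
      then show False using P by (simp add: I_def)
    qed
  qed
  then show ?thesis by (simp add: I_def)
qed

text \<open>At most s lines of each kind with p points each: the slopes a form a coset of the group
  of common roots of unity, or there are none.\<close>

lemma card_smooth_trivial_pts:
  "card (smooth_pts \<inter> trivial_pts) \<le> 2 * (p * gcd r (p - 1))"
proof -
  let ?\<mu> = "{z::'a. z ^ k = 1 \<and> z ^ n = 1}"
  let ?\<nu> = "{z::'a. z ^ k = - 1 \<and> z ^ n = - 1}"
  have \<mu>: "card ?\<mu> \<le> gcd r (p - 1)" using card_common_roots_of_unity[OF k_pos, of n] by (simp add: r_def)
  have \<nu>: "card ?\<nu> \<le> gcd r (p - 1)"
  proof (cases "?\<nu> = {}")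
    case True show ?thesis unfolding True by simp
  next
    case False
    then have "\<exists>b::'a. b ^ k = - 1 \<and> b ^ n = - 1" by simp
    then obtain b :: 'a where b: "b ^ k = - 1" "b ^ n = - 1" by blast
    then have "b \<noteq> 0" using k_pos by (auto simp: power_0_left)
    have "card ?\<nu> \<le> card ?\<mu>"
    proof (rule card_inj_on_le)
      show "inj_on (\<lambda>z. z / b) ?\<nu>" using \<open>b \<noteq> 0\<close> by (auto simp: inj_on_def)
      show "(\<lambda>z. z / b) ` ?\<nu> \<subseteq> ?\<mu>" by (auto simp: power_divide b)
    qed simp
    with \<mu> show ?thesis by simp
  qed
  have "smooth_pts \<inter> trivial_pts \<subseteq> (UNIV \<times> ?\<mu>) \<union> (\<lambda>(x,a). (x, a * x)) ` (UNIV \<times> ?\<nu>)"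
    by (auto simp: trivial_pts_def image_iff)
  then have "card (smooth_pts \<inter> trivial_pts) \<le> card ((UNIV \<times> ?\<mu>) \<union> (\<lambda>(x,a). (x, a * x)) ` (UNIV \<times> ?\<nu>))"
    by (intro card_mono) auto
  also have "\<dots> \<le> card ((UNIV :: 'a set) \<times> ?\<mu>) + card ((\<lambda>(x,a). (x, a * x)) ` ((UNIV :: 'a set) \<times> ?\<nu>))"
    by (rule card_Un_le)
  also have "card ((\<lambda>(x,a). (x, a * x)) ` ((UNIV :: 'a set) \<times> ?\<nu>)) \<le> card ((UNIV :: 'a set) \<times> ?\<nu>)"
    by (rule card_image_le) simp
  also have "card ((UNIV :: 'a set) \<times> ?\<mu>) + card ((UNIV :: 'a set) \<times> ?\<nu>) \<le> p * gcd r (p - 1) + p * gcd r (p - 1)"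
    unfolding card_cartesian_product card_F by (intro add_mono mult_le_mono2 \<mu> \<nu>)
  finally show ?thesis by simp
qed

definition curve_pts :: "('a \<times> 'a) set" where
  "curve_pts = {(x,y). x \<noteq> 0 \<and> y \<noteq> 0 \<and> (\<exists>z. on_curve x y z)}"

text \<open>Exchanging x and y preserves the curve, so a point is missed by the smooth points and
  their mirror images only if x^(n-k) = y^(n-k) = z^(n-k). Calling this value w, subtract w times
  the equation of degree k from the one of degree n: this leaves w = 1, which at most n^2 pairs
  satisfy.\<close>

lemma card_curve_pts_le:
  "card curve_pts \<le> n * n + 2 * card smooth_pts"
proof -
  let ?\<mu> = "{z::'a. z ^ (n - k) = 1}"
  have "curve_pts \<subseteq> (?\<mu> \<times> ?\<mu>) \<union> (smooth_pts \<union> prod.swap ` smooth_pts)"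
  proof
    fix P assume "P \<in> curve_pts"
    then obtain x y z where P: "P = (x,y)" "x \<noteq> 0" "y \<noteq> 0" "on_curve x y z" by (auto simp: curve_pts_def)
    have sym: "on_curve y x z" using P(4) by (simp add: on_curve_def add.commute)
    show "P \<in> (?\<mu> \<times> ?\<mu>) \<union> (smooth_pts \<union> prod.swap ` smooth_pts)"
    proof (cases "y ^ (n - k) = z ^ (n - k) \<and> x ^ (n - k) = z ^ (n - k)")
      case True
      define w where "w = z ^ (n - k)"
      have pw: "u ^ n = u ^ k * u ^ (n - k)" for u :: 'a using k_less by (simp flip: power_add)
      have "1 + z ^ n = x ^ n + y ^ n" using P(4) by (simp add: on_curve_def)
      also have "\<dots> = w * (x ^ k + y ^ k)" using True by (simp add: pw w_def algebra_simps)
      also have "\<dots> = w * (1 + z ^ k)" using P(4) by (simp add: on_curve_def)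
      also have "\<dots> = w + z ^ n" by (simp add: pw w_def algebra_simps)
      finally have "w = 1" by simp
      then show ?thesis using True P by (simp add: w_def)
    next
      case False
      then consider "y ^ (n - k) \<noteq> z ^ (n - k)" | "x ^ (n - k) \<noteq> z ^ (n - k)" by blast
      then show ?thesis
      proof cases
        case 1 then show ?thesis using P by (auto simp: smooth_pts_def)
      next
        case 2
        then have "(y,x) \<in> smooth_pts" using P sym by (auto simp: smooth_pts_def)
        then have "P \<in> prod.swap ` smooth_pts" using P(1) by (intro image_eqI[of _ _ "(y,x)"]) auto
        then show ?thesis by blast
      qed
    qed
  qed
  then have "card curve_pts \<le> card ((?\<mu> \<times> ?\<mu>) \<union> (smooth_pts \<union> prod.swap ` smooth_pts))"
    by (intro card_mono) auto
  also have "\<dots> \<le> card (?\<mu> \<times> ?\<mu>) + (card smooth_pts + card (prod.swap ` smooth_pts))"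
    by (intro order_trans[OF card_Un_le] add_left_mono card_Un_le)
  also have "card (prod.swap ` smooth_pts) \<le> card smooth_pts" by (rule card_image_le) simp
  also have "card (?\<mu> \<times> ?\<mu>) \<le> n * n"
  proof -
    have "card ?\<mu> \<le> n - k" using k_less by (intro card_power_eq_1_le) simp
    then have "card ?\<mu> \<le> n" by simp
    then show ?thesis unfolding card_cartesian_product by (intro mult_le_mono)
  qed
  finally show ?thesis by simp
qed

end

section \<open>Choice of the degree m and the point count\<close>

context binomial_curve begin

text \<open>The values of p D / m at m = sqrt n, where D = n k' is used, and at m = (p /
  D)^(1/3).\<close>

definition "main_size = real k' * sqrt (real n) * real p + real D powr (4/3) * real p powr (2/3)"

lemma nontrivial_smooth_bound:
  assumes "D < p"
  shows "real (card (smooth_pts - trivial_pts)) \<le> 8 * (2 * 5103 ^ 19) ^ 4 * main_size"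
proof -
  \<comment> \<open>Chosen with L^2 = 4 * 5103^38, so that m L <= sqrt n and m L <= (p / D)^(1/3)
    imply the size conditions of \<open>card_nontrivial_smooth_pts\<close>. The letters below make
    all exponents integral: D = u^3, p = q^3, n = w^2.\<close>
  define L :: real where "L = 2 * 5103 ^ 19"
  define u q w K where "u = real D powr (1/3)" and "q = real p powr (1/3)" and "w = sqrt (real n)" and "K = real k'"
  define N where "N = real (card (smooth_pts - trivial_pts))"
  have L: "L \<ge> 4" by (simp add: L_def)
  have D1: "real D \<ge> 1" using D_ge k_less by simp
  have uq_pos: "u > 0" "q > 0" using D1 assms by (auto simp: u_def q_def)
  have Du: "real D = u ^ 3" using D1 by (simp add: u_def powr_powr flip: powr_realpow)
  have pq: "real p = q ^ 3" using assms by (simp add: q_def powr_powr flip: powr_realpow)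
  have uq: "u \<le> q" unfolding u_def q_def using assms by (intro powr_mono2) auto
  have w1: "w \<ge> 1" using k_less by (simp add: w_def)
  have nw: "real n = w * w" by (simp add: w_def)
  have K1: "K \<ge> 1" using k'_pos by (simp add: K_def)
  have DK: "real D = K * (w * w)" by (simp add: D_eq K_def nw mult.commute flip: nw)
  have nD: "w * w \<le> u ^ 3" using D_ge unfolding nw[symmetric] Du[symmetric] by simp
  have T: "real D powr (4/3) * real p powr (2/3) = u ^ 4 * q ^ 2"
    using D1 assms by (simp add: u_def q_def powr_powr flip: powr_realpow)
  have main: "main_size = K * w * q ^ 3 + u ^ 4 * q ^ 2" by (simp add: main_size_def T K_def w_def flip: pq)
  define V T where "V = K * w * q ^ 3" and "T = u ^ 4 * q ^ 2"
  have VT: "V \<ge> 0" "T \<ge> 0" using K1 w1 uq_pos by (auto simp: V_def T_def)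
  have L4: "L \<le> L ^ 4" "1 \<le> L ^ 4" using L power_increasing[of 1 4 L] one_le_power[of L 4] by auto
  have N_smooth: "N \<le> real (card smooth_pts)" unfolding N_def by (intro of_nat_mono card_mono) auto
  have "N \<le> 8 * L ^ 4 * (V + T)"
  proof -
    \<comment> \<open>If sqrt n or (p / D)^(1/3) is below \<open>L\<close>, the floor defining
      \<open>m\<close> would be 0. In these cases the trivial counts p D and p^2 have the claimed
      size.\<close>
    consider "w < L" | "q < L * u" | "L \<le> w" "L * u \<le> q" by linarith
    then show ?thesis
    proof cases
      case 1
      have "N \<le> real (p * D)" by (rule order_trans[OF N_smooth of_nat_mono[OF card_smooth_pts_trivial_bound[OF assms]]])
      also have "\<dots> = w * V" by (simp add: DK pq V_def)
      also have "\<dots> \<le> L * V" using 1 VT by (intro mult_right_mono) auto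
      also have "\<dots> \<le> L ^ 4 * (V + T)" using L4 L VT by (intro mult_mono) auto
      also have "\<dots> \<le> 8 * L ^ 4 * (V + T)" using L4 VT by (intro mult_right_mono) auto
      finally show ?thesis .
    next
      case 2
      have "card smooth_pts \<le> card (UNIV :: ('a \<times> 'a) set)" by (intro card_mono) auto
      then have "card smooth_pts \<le> p * p" by (simp add: card_F card_prod)
      then have "N \<le> real (p * p)" by (rule order_trans[OF N_smooth of_nat_mono])
      also have "\<dots> = q ^ 4 * q ^ 2" by (simp add: pq flip: power_add)
      also have "\<dots> \<le> (L * u) ^ 4 * q ^ 2" using 2 uq_pos by (intro mult_right_mono power_mono) auto
      also have "\<dots> = L ^ 4 * T" by (simp add: T_def power_mult_distrib)
      also have "\<dots> \<le> L ^ 4 * (V + T)" using L4 VT by (intro mult_left_mono) auto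
      also have "\<dots> \<le> 8 * L ^ 4 * (V + T)" using L4 VT by (intro mult_right_mono) auto
      finally show ?thesis .
    next
      case 3
      define t where "t = min w (q / u)"
      have tL: "t \<ge> L" using 3 uq_pos by (auto simp: t_def pos_le_divide_eq)
      have t_pos: "t > 0" using tL L by simp
      define m where "m = nat \<lfloor>t / L\<rfloor>"
      have tL1: "t / L \<ge> 1" using tL L by (simp add: pos_le_divide_eq)
      have mr: "real m = of_int \<lfloor>t / L\<rfloor>" using tL1 by (simp add: m_def)
      have m_le: "real m \<le> t / L" unfolding mr by (rule of_int_floor_le)
      have m1: "real m \<ge> 1" unfolding mr using tL1 by simp
      have m_ge: "t / L \<le> 2 * real m"
        using floor_correct[of "t / L"] m1 unfolding mr by linarith
      have mL: "real m * L \<le> t" using m_le L by (simp add: pos_le_divide_eq)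
      have mw: "real m * L \<le> w" and mu: "real m * L * u \<le> q"
        using mL uq_pos by (auto simp: t_def pos_le_divide_eq)
      have L2: "L * L = 4 * 5103 ^ 38" by (simp add: L_def)
      have msq: "real m * real m * (4 * 5103 ^ 38) \<le> real n"
      proof -
        have "(real m * L) * (real m * L) \<le> w * w" using mw m1 L w1 by (intro mult_mono) auto
        then have "real m * real m * (L * L) \<le> w * w" by (simp only: mult_ac)
        then show ?thesis by (simp only: L2 nw)
      qed
      have n_pos: "real n > 0" using k_less by simp
      have s1: "4 * (m * (5103 ^ 36 * m)) < n"
      proof -
        have "real (4 * (m * (5103 ^ 36 * m))) * 5103 ^ 2 = real m * real m * (4 * 5103 ^ 38)" by simp
        then have "real (4 * (m * (5103 ^ 36 * m))) * 5103 ^ 2 \<le> real n" using msq by simp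
        then have "real (4 * (m * (5103 ^ 36 * m))) < real n" using n_pos by simp
        then show ?thesis by (simp only: of_nat_less_iff)
      qed
      have mn: "real m * real n * L \<le> real p"
      proof -
        have "real m * real n * L \<le> real m * u ^ 3 * L" unfolding nw using nD m1 L by (intro mult_right_mono mult_left_mono) auto
        also have "\<dots> = (real m * L * u) * u ^ 2" by (simp add: power2_eq_square power3_eq_cube)
        also have "\<dots> \<le> q * q ^ 2" using mu uq uq_pos by (intro mult_mono power_mono) auto
        finally show ?thesis by (simp add: pq power2_eq_square power3_eq_cube)
      qed
      have s2: "m * (5103 ^ 37 * m + 2 * n) < p"
      proof -
        have "real (m * (5103 ^ 37 * m)) * (4 * 5103) = real m * real m * (4 * 5103 ^ 38)" by simp
        then have a: "real (m * (5103 ^ 37 * m)) * (4 * 5103) \<le> real n" using msq by simp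
        have "n < p" using D_ge assms by simp
        then have "real n < real p" by simp
        with a have a': "real (m * (5103 ^ 37 * m)) * 4 < real p" by linarith
        have "real m * real n * 4 \<le> real m * real n * L" using L by (intro mult_left_mono) auto
        with mn have b: "real m * real n * 4 \<le> real p" by linarith
        have "real (m * (5103 ^ 37 * m + 2 * n)) = real (m * (5103 ^ 37 * m)) + 2 * (real m * real n)"
          by (simp add: algebra_simps)
        with a' b have "real (m * (5103 ^ 37 * m + 2 * n)) < real p" by linarith
        then show ?thesis by (simp only: of_nat_less_iff)
      qed
      have s3: "D * m < p"
      proof -
        have "real (D * m) * L = (real m * L * u) * u ^ 2" by (simp add: Du power2_eq_square power3_eq_cube)
        also have "\<dots> \<le> q * q ^ 2" using mu uq uq_pos by (intro mult_mono power_mono) auto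
        also have "\<dots> = real p" by (simp add: pq power2_eq_square power3_eq_cube)
        finally have a: "real (D * m) * L \<le> real p" .
        have "real (D * m) * 4 \<le> real (D * m) * L" using L by (intro mult_left_mono) auto
        moreover have "real (D * m) > 0" using D1 m1 by simp
        ultimately have "real (D * m) < real p" using a by linarith
        then show ?thesis by (simp only: of_nat_less_iff)
      qed
      have m0: "m > 0" using m1 by simp
      have "N \<le> 2 * real D * real p / real m + 2 * (real D * real m)\<^sup>2"
        unfolding N_def by (rule card_nontrivial_smooth_pts[OF assms m0 s3 s1 s2])
      also have "2 * real D * real p / real m \<le> 4 * L * (V + T)"
      proof -
        have V_eq: "real D * real p = w * V" by (simp add: DK pq V_def)
        have T_eq: "real D * real p = (q / u) * T"
          using uq_pos by (simp add: Du pq T_def power2_eq_square power3_eq_cube power4_eq_xxxx)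
        \<comment> \<open>\<open>V\<close> and \<open>T\<close> are p D divided by the two
          candidates for the minimum \<open>t\<close>.\<close>
        have "real D * real p \<le> t * (V + T)"
        proof (cases "w \<le> q / u")
          case True
          then have "real D * real p = t * V" by (simp add: V_eq t_def)
          also have "\<dots> \<le> t * (V + T)" using t_pos VT by (intro mult_left_mono) auto
          finally show ?thesis .
        next
          case False
          then have "real D * real p = t * T" by (simp add: T_eq t_def)
          also have "\<dots> \<le> t * (V + T)" using t_pos VT by (intro mult_left_mono) auto
          finally show ?thesis .
        qed
        also have "t * (V + T) \<le> (2 * real m * L) * (V + T)"
          using m_ge L VT by (intro mult_right_mono) (auto simp: pos_divide_le_eq)
        finally have "2 * real D * real p \<le> 4 * L * (V + T) * real m" by (simp add: algebra_simps)
        then show ?thesis using m1 by (simp add: pos_divide_le_eq)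
      qed
      also have "2 * (real D * real m)\<^sup>2 \<le> 2 * T"
      proof -
        have "real m * u \<le> q"
        proof -
          have "real m * 1 * u \<le> real m * L * u" using m1 L uq_pos by (intro mult_right_mono mult_left_mono) auto
          with mu show ?thesis by simp
        qed
        then have "(real m * u) ^ 2 \<le> q ^ 2" using m1 uq_pos by (intro power_mono) auto
        then have "u ^ 4 * (real m * u) ^ 2 \<le> u ^ 4 * q ^ 2" using uq_pos by (intro mult_left_mono) auto
        moreover have "(real D * real m)\<^sup>2 = u ^ 4 * (real m * u) ^ 2"
          by (simp add: Du power2_eq_square power3_eq_cube power4_eq_xxxx)
        ultimately show ?thesis by (simp add: T_def)
      qed
      also have "4 * L * (V + T) + 2 * T \<le> 8 * L ^ 4 * (V + T)"
      proof -
        obtain e where e: "e = L ^ 4 * (V + T)" by simp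
        have "L * (V + T) \<le> e" unfolding e using L4 VT by (intro mult_right_mono) auto
        moreover have "V + T \<le> e" using mult_right_mono[OF L4(2), of "V + T"] VT by (simp add: e)
        ultimately have "4 * (L * (V + T)) + 2 * T \<le> 8 * e" using VT by linarith
        then show ?thesis by (simp add: e)
      qed
      finally show ?thesis by simp
    qed
  qed
  then show ?thesis by (simp only: N_def L_def V_def T_def main)
qed

text \<open>For D >= p the trivial count p^2 is below the second term. For D < p the lines carry at
  most 2 p s points, and s <= r <= sqrt n puts this below a multiple of the first term, while n^2 <=
  D^2 is below the second. The constant 21 is 2 * 8 + 2 * 2 + 1, for the nontrivial points, the
  lines and the n^2 exceptional points.\<close>

theorem card_curve_pts_bound:
  assumes r: "real r \<le> sqrt (real n)"
  shows "real (card curve_pts) \<le> 21 * (2 * 5103 ^ 19) ^ 4 * main_size"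
proof -
  define C :: real where "C = (2 * 5103 ^ 19) ^ 4"
  have C: "C \<ge> 1" by (simp add: C_def)
  define V T where "V = real k' * sqrt (real n) * real p" and "T = real D powr (4/3) * real p powr (2/3)"
  have main: "main_size = V + T" by (simp add: main_size_def V_def T_def)
  have VT: "V \<ge> 0" "T \<ge> 0" by (auto simp: V_def T_def)
  have p1: "real p \<ge> 1" using prime_gt_0_nat[OF prime_p] by simp
  have pq: "real p powr 2 = real p * real p" using p1 by (simp add: powr_numeral power2_eq_square)
  have "real (card curve_pts) \<le> 21 * C * (V + T)"
  proof (cases "D < p")
    case False
    have "card curve_pts \<le> card (UNIV :: ('a \<times> 'a) set)" by (intro card_mono) auto
    then have "card curve_pts \<le> p * p" by (simp add: card_F card_prod)
    then have "real (card curve_pts) \<le> real (p * p)" by (rule of_nat_mono)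
    also have "\<dots> = real p powr (4/3) * real p powr (2/3)" using p1 pq by (simp flip: powr_add)
    also have "\<dots> \<le> T" unfolding T_def using False p1 by (intro mult_right_mono powr_mono2) auto
    also have "\<dots> \<le> 1 * (V + T)" using VT by simp
    also have "\<dots> \<le> 21 * C * (V + T)" using C VT by (intro mult_right_mono) auto
    finally show ?thesis .
  next
    case True
    have D1: "real D \<ge> 1" using D_ge k_less by simp
    have "card curve_pts \<le> n * n + 2 * card smooth_pts" by (rule card_curve_pts_le)
    also have "card smooth_pts = card (smooth_pts \<inter> trivial_pts) + card (smooth_pts - trivial_pts)"
      by (rule card_Int_Diff) simp
    finally have "real (card curve_pts) \<le> real (n * n + 2 * (card (smooth_pts \<inter> trivial_pts) + card (smooth_pts - trivial_pts)))"
      by (rule of_nat_mono)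
    then have main': "real (card curve_pts) \<le> real n * real n + 2 * real (card (smooth_pts \<inter> trivial_pts))
        + 2 * real (card (smooth_pts - trivial_pts))" by simp
    obtain e where e: "e = C * (V + T)" by simp
    have "real (card (smooth_pts - trivial_pts)) \<le> 8 * C * (V + T)"
      using nontrivial_smooth_bound[OF True] by (simp only: C_def main)
    then have "real (card (smooth_pts - trivial_pts)) \<le> 8 * e" by (simp add: e)
    moreover have "real (card (smooth_pts \<inter> trivial_pts)) \<le> 2 * V"
    proof -
      have "gcd r (p - 1) \<le> r" using r_pos by (intro gcd_le1_nat) simp
      then have "real (gcd r (p - 1)) \<le> 1 * sqrt (real n)" using r by simp
      also have "\<dots> \<le> real k' * sqrt (real n)" using k'_pos by (intro mult_right_mono) auto
      finally have "real p * real (gcd r (p - 1)) \<le> real p * (real k' * sqrt (real n))" by (intro mult_left_mono) auto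
      moreover have "real (card (smooth_pts \<inter> trivial_pts)) \<le> real (2 * (p * gcd r (p - 1)))"
        using card_smooth_trivial_pts by (rule of_nat_mono)
      ultimately show ?thesis by (simp add: V_def mult_ac)
    qed
    moreover have "real n * real n \<le> T"
    proof -
      have "real n * real n \<le> real D * real D" using D_ge by (intro mult_mono) auto
      also have "\<dots> = real D powr 2" using D1 by (simp add: powr_numeral power2_eq_square)
      also have "\<dots> = real D powr (4/3) * real D powr (2/3)" by (simp flip: powr_add)
      also have "\<dots> \<le> T" unfolding T_def using True by (intro mult_left_mono powr_mono2) auto
      finally show ?thesis .
    qed
    moreover have "V + T \<le> e"
      using mult_right_mono[OF C, of "V + T"] VT by (simp add: e)
    ultimately have "real (card curve_pts) \<le> 21 * e" using main' VT by linarith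
    then show ?thesis by (simp add: e)
  qed
  then show ?thesis by (simp only: C_def main)
qed

end

section \<open>Exponential sums\<close>

lemma e_mod_add: "e_mod p (x + y) = e_mod p x * e_mod p y"
  by (simp add: e_mod_def ring_distribs add_divide_distrib exp_add)

lemma e_mod_0: "e_mod p 0 = 1"
  by (simp add: e_mod_def)

lemma cnj_e_mod: "cnj (e_mod p x) = e_mod p (- x)"
  by (simp add: e_mod_def exp_cnj)

lemma e_mod_1_neq_1: assumes "p > 1" shows "e_mod p 1 \<noteq> 1"
proof
  assume "e_mod p 1 = 1"
  then obtain j :: int where "Im (2 * complex_of_real pi * \<i> * of_int 1 / of_nat p) = of_int (2 * j) * pi"
    unfolding e_mod_def exp_eq_1 by blast
  then have "2 * pi / real p = of_int (2 * j) * pi" by simp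
  then have "1 = of_int j * real p" using assms by (simp add: field_simps)
  then have "(1::int) = j * int p" by (metis of_int_1 of_int_eq_iff of_int_mult of_int_of_nat_eq)
  then have "int p dvd 1" by (metis dvd_triv_right)
  with assms show False by simp
qed

section \<open>The additive character on the abstract field\<close>

context prime_order_field begin

lemma of_int_eq_0: "of_int z = (0::'a) \<longleftrightarrow> int p dvd z"
proof (cases "z \<ge> 0")
  case True
  then obtain j where "z = int j" using nonneg_int_cases by blast
  then show ?thesis using of_nat_eq_0[of j] by simp
next
  case False
  then obtain j where "z = - int j" by (metis int_cases2 linear minus_le_iff neg_0_le_iff_le of_nat_0_le_iff)
  then show ?thesis using of_nat_eq_0[of j] by simp
qed

lemma of_int_surj: "\<exists>z. of_int z = (x::'a)" and of_nat_bij: "bij_betw (of_nat :: nat \<Rightarrow> 'a) {0..<p} UNIV"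
proof -
  have inj: "inj_on (of_nat :: nat \<Rightarrow> 'a) {0..<p}"
  proof (rule inj_onI)
    fix i j assume ij: "i \<in> {0..<p}" "j \<in> {0..<p}" "(of_nat i :: 'a) = of_nat j"
    then have "of_int (int i - int j) = (0::'a)" by simp
    then have "int p dvd int i - int j" by (simp only: of_int_eq_0)
    then have "int i mod int p = int j mod int p" by (simp only: mod_eq_dvd_iff)
    with ij show "i = j" by simp
  qed
  have "of_nat ` {0..<p} = (UNIV :: 'a set)"
    by (rule card_subset_eq) (auto simp: card_image[OF inj] card_F)
  with inj show b: "bij_betw (of_nat :: nat \<Rightarrow> 'a) {0..<p} UNIV" by (simp add: bij_betw_def)
  then obtain i where "x = of_nat i" unfolding bij_betw_def by blast
  then show "\<exists>z. of_int z = x" by (intro exI[of _ "int i"]) simp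
qed

text \<open>The character of the integers modulo p carried over to the abstract field. Periodicity
  makes the choice of representative irrelevant, see \<open>\<psi>_of_int\<close>.\<close>

definition \<psi> :: "'a \<Rightarrow> complex" where
  "\<psi> x = e_mod p (SOME z. of_int z = x)"

lemma \<psi>_of_int: "\<psi> (of_int z) = e_mod p z"
proof -
  define z' where "z' = (SOME z'. of_int z' = (of_int z :: 'a))"
  have "of_int z' = (of_int z :: 'a)" unfolding z'_def by (rule someI[of _ z]) simp
  then have "of_int (z' - z) = (0::'a)" by simp
  then have "int p dvd z' - z" by (simp only: of_int_eq_0)
  then have "z' mod int p = z mod int p" by (simp only: mod_eq_dvd_iff)
  then have "e_mod p z' = e_mod p z" using prime_gt_0_nat[OF prime_p] by (intro e_mod_cong)
  then show ?thesis by (simp only: \<psi>_def z'_def)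
qed

lemma \<psi>_add: "\<psi> (x + y) = \<psi> x * \<psi> y"
proof -
  obtain a b where "x = of_int a" "y = of_int b" using of_int_surj by metis
  then show ?thesis by (simp only: \<psi>_of_int e_mod_add flip: of_int_add)
qed

lemma \<psi>_0: "\<psi> 0 = 1"
  using \<psi>_of_int[of 0] by (simp add: e_mod_0)

lemma cnj_\<psi>: "cnj (\<psi> x) = \<psi> (- x)"
proof -
  obtain a where "x = of_int a" using of_int_surj by metis
  then show ?thesis by (simp only: \<psi>_of_int cnj_e_mod flip: of_int_minus)
qed

lemma \<psi>_orthogonal: "(\<Sum>x\<in>UNIV. \<psi> (x * a)) = (if a = 0 then of_nat p else 0)"
proof (cases "a = 0")
  case True then show ?thesis by (simp add: \<psi>_0 card_F)
next
  case False
  have one: "\<psi> 1 \<noteq> 1" using \<psi>_of_int[of 1] e_mod_1_neq_1 prime_gt_1_nat[OF prime_p] by simp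
  have "(\<Sum>x\<in>UNIV. \<psi> (x * a)) = (\<Sum>x\<in>UNIV. \<psi> ((x + inverse a) * a))"
    by (rule sum.reindex_bij_witness[of _ "\<lambda>x. x + inverse a" "\<lambda>x. x - inverse a"]) auto
  also have "\<dots> = (\<Sum>x\<in>UNIV. \<psi> (x * a) * \<psi> 1)"
    using False by (intro sum.cong refl) (simp add: distrib_right \<psi>_add)
  also have "\<dots> = (\<Sum>x\<in>UNIV. \<psi> (x * a)) * \<psi> 1" by (simp only: sum_distrib_right)
  finally have "(\<Sum>x\<in>UNIV. \<psi> (x * a)) * (\<psi> 1 - 1) = 0" by (simp add: right_diff_distrib)
  then show ?thesis using one False by simp
qed

lemma binomial_exp_sum_eq:
  "binomial_exp_sum p k n a b = (\<Sum>x\<in>UNIV. \<psi> (of_int a * x ^ k + of_int b * x ^ n))"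
proof -
  have "binomial_exp_sum p k n a b = (\<Sum>x = 0..<p. \<psi> (of_int a * of_nat x ^ k + of_int b * of_nat x ^ n))"
    unfolding binomial_exp_sum_def by (intro sum.cong refl) (simp flip: \<psi>_of_int)
  also have "\<dots> = (\<Sum>x\<in>UNIV. \<psi> (of_int a * x ^ k + of_int b * x ^ n))"
    by (rule sum.reindex_bij_betw[OF of_nat_bij])
  finally show ?thesis .
qed

end

section \<open>The fourth moment and its reduction to the curve\<close>

context binomial_curve begin

abbreviation "X \<equiv> UNIV - {0::'a}"

text \<open>The term x = 0 is left out so that solutions can be divided by a coordinate;
  \<open>binomial_exp_sum_bound\<close> adds it back.\<close>

definition "T \<alpha> \<beta> = (\<Sum>x\<in>X. \<psi> (\<alpha> * x ^ k + \<beta> * x ^ n))"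

definition "quads = {((a,b),(c,d)). a \<in> X \<and> b \<in> X \<and> c \<in> X \<and> d \<in> X \<and>
   a ^ k + b ^ k = c ^ k + d ^ k \<and> a ^ n + b ^ n = c ^ n + d ^ n}"

lemma card_X: "card X = p - 1"
  by (simp add: card_Diff_singleton card_F)

lemma fourth_moment: "(\<Sum>\<alpha>\<in>UNIV. \<Sum>\<beta>\<in>UNIV. cmod (T \<alpha> \<beta>) ^ 4) = real p * real p * real (card quads)"
proof -
  define u where "u = (\<lambda>j ((a,b),(c,d)). (a ^ j + b ^ j) - (c ^ j + d ^ j :: 'a))"
  let ?Q = "(X \<times> X) \<times> (X \<times> X)"
  have norm4: "complex_of_real (cmod z ^ 4) = (z * z) * cnj (z * z)" for z
  proof -
    have "complex_of_real (cmod z ^ 4) = (complex_of_real ((cmod z)\<^sup>2))\<^sup>2" by (simp flip: power_mult)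
    also have "\<dots> = (z * cnj z)\<^sup>2" by (simp only: complex_norm_square)
    finally show ?thesis by (simp add: power2_eq_square mult_ac)
  qed
  have expand: "complex_of_real (cmod (T \<alpha> \<beta>) ^ 4) = (\<Sum>t\<in>?Q. \<psi> (\<alpha> * u k t) * \<psi> (\<beta> * u n t))" for \<alpha> \<beta>
  proof -
    define f where "f = (\<lambda>(a,b). \<alpha> * (a ^ k + b ^ k) + \<beta> * (a ^ n + b ^ n))"
    have sq: "T \<alpha> \<beta> * T \<alpha> \<beta> = (\<Sum>ab\<in>X \<times> X. \<psi> (f ab))"
      unfolding T_def sum_product sum.cartesian_product
      by (intro sum.cong refl) (auto simp: f_def algebra_simps simp flip: \<psi>_add)
    have "T \<alpha> \<beta> * T \<alpha> \<beta> * cnj (T \<alpha> \<beta> * T \<alpha> \<beta>) = (\<Sum>ab\<in>X \<times> X. \<psi> (f ab)) * (\<Sum>cd\<in>X \<times> X. \<psi> (- f cd))"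
      unfolding sq by (simp add: cnj_\<psi>)
    also have "\<dots> = (\<Sum>(ab,cd)\<in>?Q. \<psi> (f ab) * \<psi> (- f cd))"
      unfolding sum_product sum.cartesian_product ..
    also have "\<dots> = (\<Sum>t\<in>?Q. \<psi> (\<alpha> * u k t) * \<psi> (\<beta> * u n t))"
      by (intro sum.cong refl) (auto simp: f_def u_def algebra_simps simp flip: \<psi>_add)
    finally show ?thesis by (simp only: norm4)
  qed
  have "complex_of_real (\<Sum>\<alpha>\<in>UNIV. \<Sum>\<beta>\<in>UNIV. cmod (T \<alpha> \<beta>) ^ 4)
      = (\<Sum>\<alpha>\<in>UNIV. \<Sum>\<beta>\<in>UNIV. \<Sum>t\<in>?Q. \<psi> (\<alpha> * u k t) * \<psi> (\<beta> * u n t))"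
    by (simp only: of_real_sum expand)
  also have "\<dots> = (\<Sum>t\<in>?Q. \<Sum>\<alpha>\<in>UNIV. \<Sum>\<beta>\<in>UNIV. \<psi> (\<alpha> * u k t) * \<psi> (\<beta> * u n t))"
    by (subst sum.swap[of _ UNIV ?Q]) (subst sum.swap[of _ ?Q UNIV], rule refl)+
  also have "\<dots> = (\<Sum>t\<in>?Q. (\<Sum>\<alpha>\<in>UNIV. \<psi> (\<alpha> * u k t)) * (\<Sum>\<beta>\<in>UNIV. \<psi> (\<beta> * u n t)))"
    by (simp only: sum_product)
  also have "\<dots> = (\<Sum>t\<in>?Q. if u k t = 0 \<and> u n t = 0 then of_nat p * of_nat p else 0)"
    unfolding \<psi>_orthogonal by (intro sum.cong refl) auto
  also have "\<dots> = (\<Sum>t\<in>{t\<in>?Q. u k t = 0 \<and> u n t = 0}. of_nat p * of_nat p)"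
    by (rule sum.inter_filter[symmetric]) simp
  also have "{t\<in>?Q. u k t = 0 \<and> u n t = 0} = quads"
    unfolding quads_def u_def by auto
  finally have "complex_of_real (\<Sum>\<alpha>\<in>UNIV. \<Sum>\<beta>\<in>UNIV. cmod (T \<alpha> \<beta>) ^ 4)
      = complex_of_real (real p * real p * real (card quads))" by simp
  then show ?thesis by (simp only: of_real_eq_iff)
qed

text \<open>Dividing by \<open>d\<close> turns a solution into a curve point together with a z. For
  given x and y the values z^k and z^n are fixed, so at most s values of z occur.\<close>

lemma card_quads: "card quads \<le> (p - 1) * (gcd r (p - 1) * card curve_pts)"
proof -
  let ?C = "Sigma curve_pts (\<lambda>(x,y). {z. on_curve x y z})"
  have "card quads \<le> card (X \<times> ?C)"
  proof (rule card_inj_on_le)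
    show "inj_on (\<lambda>((a,b),(c,d)). (d, ((a / d, b / d), c / d))) quads"
      by (auto simp: inj_on_def quads_def)
    show "(\<lambda>((a,b),(c,d)). (d, ((a / d, b / d), c / d))) ` quads \<subseteq> X \<times> ?C"
    proof (intro subsetI, elim imageE)
      fix w t assume w: "w = (\<lambda>((a,b),(c,d)). (d, ((a / d, b / d), c / d))) t" and t: "t \<in> quads"
      obtain a b c d where abcd: "t = ((a,b),(c,d))" by (metis surj_pair)
      have nz: "a \<noteq> 0" "b \<noteq> 0" "c \<noteq> 0" "d \<noteq> 0" and e: "a ^ k + b ^ k = c ^ k + d ^ k" "a ^ n + b ^ n = c ^ n + d ^ n"
        using t by (auto simp: quads_def abcd)
      have "(a / d) ^ j + (b / d) ^ j = 1 + (c / d) ^ j" if "a ^ j + b ^ j = c ^ j + d ^ j" for j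
      proof -
        have "(a / d) ^ j + (b / d) ^ j = (c ^ j + d ^ j) / d ^ j"
          unfolding that[symmetric] by (simp add: power_divide add_divide_distrib)
        then show ?thesis using nz by (simp add: power_divide add_divide_distrib)
      qed
      from this[OF e(1)] this[OF e(2)] have "on_curve (a / d) (b / d) (c / d)"
        using nz unfolding on_curve_def by simp
      then show "w \<in> X \<times> ?C" using nz unfolding w abcd curve_pts_def by auto
    qed
  qed simp
  also have "\<dots> = (p - 1) * (\<Sum>P\<in>curve_pts. card (case P of (x,y) \<Rightarrow> {z. on_curve x y z}))"
    by (simp only: card_cartesian_product card_X card_SigmaI[OF finite, OF ballI[OF finite]])
  also have "(\<Sum>P\<in>curve_pts. card (case P of (x,y) \<Rightarrow> {z. on_curve x y z})) \<le> (\<Sum>P\<in>curve_pts. gcd r (p - 1))"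
  proof (rule sum_mono)
    fix P assume "P \<in> curve_pts"
    obtain x y where P: "P = (x,y)" by (cases P)
    have "card {z. on_curve x y z} \<le> gcd r (p - 1)"
    proof (cases "\<exists>z. on_curve x y z")
      case False then show ?thesis by simp
    next
      case True
      then obtain z0 where z0: "on_curve x y z0" ..
      note z0 = on_curveD[OF z0]
      have "card {z. on_curve x y z} \<le> card {z::'a. z ^ k = 1 \<and> z ^ n = 1}"
      proof (rule card_inj_on_le)
        show "inj_on (\<lambda>z. z / z0) {z. on_curve x y z}" using z0(1) by (intro inj_onI) simp
        show "(\<lambda>z. z / z0) ` {z. on_curve x y z} \<subseteq> {z. z ^ k = 1 \<and> z ^ n = 1}"
        proof (intro subsetI, elim imageE)
          fix w z assume w: "w = z / z0" and "z \<in> {z. on_curve x y z}"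
          then have "on_curve x y z" by simp
          note z = on_curveD[OF this]
          have "z ^ k = z0 ^ k" "z ^ n = z0 ^ n" unfolding z(2,3)[symmetric] z0(2,3)[symmetric] by (rule refl)+
          then show "w \<in> {z. z ^ k = 1 \<and> z ^ n = 1}" using z0(1) by (simp add: w power_divide)
        qed
      qed (rule finite)
      also have "\<dots> \<le> gcd r (p - 1)" using card_common_roots_of_unity[OF k_pos, of n] by (simp only: r_def)
      finally show ?thesis .
    qed
    then show "card (case P of (x,y) \<Rightarrow> {z. on_curve x y z}) \<le> gcd r (p - 1)" by (simp only: P prod.case)
  qed
  finally show ?thesis by (simp add: mult.commute)
qed

text \<open>The sum is unchanged when the coefficients move to (\<alpha> t^k, \<beta> t^n), and each
  pair is reached by at most s values of t; so (p - 1) times the fourth power is at most s times the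
  full moment. The factor p - 1 cancels against the one in \<open>card_quads\<close>, which also
  contributes the second s.\<close>

lemma T_fourth_power:
  assumes "\<alpha> \<noteq> 0" "\<beta> \<noteq> 0"
  shows "cmod (T \<alpha> \<beta>) ^ 4 \<le> (real (gcd r (p - 1)))\<^sup>2 * (real p)\<^sup>2 * real (card curve_pts)"
proof -
  let ?s = "gcd r (p - 1)"
  define g where "g = (\<lambda>t. (\<alpha> * t ^ k, \<beta> * t ^ n))"
  have inv: "T (\<alpha> * t ^ k) (\<beta> * t ^ n) = T \<alpha> \<beta>" if "t \<noteq> 0" for t
    unfolding T_def
    by (rule sum.reindex_bij_witness[of _ "\<lambda>x. x / t" "\<lambda>x. x * t"]) (use that in \<open>auto simp: power_mult_distrib mult_ac\<close>)
  have fib: "card {t\<in>X. g t = w} \<le> ?s" for w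
  proof (cases "\<exists>t\<in>X. g t = w")
    case False
    then have "{t\<in>X. g t = w} = {}" by auto
    then show ?thesis by (simp only: card.empty zero_le)
  next
    case True
    then obtain t0 where t0: "t0 \<noteq> 0" "g t0 = w" by auto
    have "card {t\<in>X. g t = w} \<le> card {z::'a. z ^ k = 1 \<and> z ^ n = 1}"
    proof (rule card_inj_on_le)
      show "inj_on (\<lambda>z. z / t0) {t\<in>X. g t = w}" using t0(1) by (intro inj_onI) simp
      show "(\<lambda>z. z / t0) ` {t\<in>X. g t = w} \<subseteq> {z. z ^ k = 1 \<and> z ^ n = 1}"
      proof (intro subsetI, elim imageE)
        fix v t assume v: "v = t / t0" and "t \<in> {t\<in>X. g t = w}"
        then have "g t = g t0" using t0 by simp
        then have "t ^ k = t0 ^ k" "t ^ n = t0 ^ n" using assms by (simp_all add: g_def)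
        then show "v \<in> {z. z ^ k = 1 \<and> z ^ n = 1}" using t0(1) by (simp add: v power_divide)
      qed
    qed (rule finite)
    also have "\<dots> \<le> ?s" using card_common_roots_of_unity[OF k_pos, of n] by (simp only: r_def)
    finally show ?thesis .
  qed
  define h where "h = (\<lambda>(\<alpha>,\<beta>). cmod (T \<alpha> \<beta>) ^ 4)"
  have "real (p - 1) * cmod (T \<alpha> \<beta>) ^ 4 = (\<Sum>t\<in>X. h (g t))"
    by (simp add: h_def g_def inv card_X)
  also have "\<dots> = (\<Sum>w\<in>UNIV. \<Sum>t\<in>{t\<in>X. g t = w}. h (g t))"
    by (rule sum.group[symmetric]) auto
  also have "\<dots> = (\<Sum>w\<in>UNIV. real (card {t\<in>X. g t = w}) * h w)"
    by (intro sum.cong refl) simp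
  also have "\<dots> \<le> (\<Sum>w\<in>UNIV. real ?s * h w)"
    by (intro sum_mono mult_right_mono of_nat_mono fib) (auto simp: h_def split_def)
  also have "\<dots> = real ?s * (\<Sum>w\<in>UNIV \<times> UNIV. h w)" by (simp add: sum_distrib_left)
  also have "(\<Sum>w\<in>UNIV \<times> UNIV. h w) = real p * real p * real (card quads)"
    unfolding fourth_moment[symmetric] h_def by (simp add: sum.cartesian_product)
  also have "real ?s * (real p * real p * real (card quads))
      \<le> real ?s * (real p * real p * real ((p - 1) * (?s * card curve_pts)))"
    by (intro mult_left_mono of_nat_mono card_quads) auto
  also have "\<dots> = real (p - 1) * ((real ?s)\<^sup>2 * (real p)\<^sup>2 * real (card curve_pts))"
    by (simp add: power2_eq_square mult_ac)
  finally show ?thesis using prime_gt_1_nat[OF prime_p] by simp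
qed

end

section \<open>The bound for a single sum and for the maximum\<close>

definition sum_bound :: "nat \<Rightarrow> nat \<Rightarrow> nat \<Rightarrow> real" where
  "sum_bound p k n =
     real k powr (1/4) * real n powr (1/8) * real (gcd (gcd k n) (p - 1)) powr (1/2) * real p powr (3/4)
       / real (gcd k n) powr (1/4)
     + (real k * real n / real (gcd k n)) powr (1/3) * real (gcd (gcd k n) (p - 1)) powr (1/2) * real p powr (2/3)"

context binomial_curve begin

text \<open>The terms A and B of the bound satisfy that A^4 and B^4 are s^2 p^2 times the two terms
  of \<open>main_size\<close>, so the fourth root of the moment bound is at most a constant times A
  + B.\<close>

theorem binomial_exp_sum_bound:
  assumes r: "real r \<le> sqrt (real n)" and ab: "\<not> int p dvd a" "\<not> int p dvd b"
  shows "cmod (binomial_exp_sum p k n a b) \<le> 10 * 5103 ^ 19 * sum_bound p k n"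
proof -
  define L :: real where "L = 2 * 5103 ^ 19"
  define s where "s = real (gcd r (p - 1))"
  define A where "A = real k powr (1/4) * real n powr (1/8) * s powr (1/2) * real p powr (3/4) / real r powr (1/4)"
  define B where "B = (real k * real n / real r) powr (1/3) * s powr (1/2) * real p powr (2/3)"
  have AB: "sum_bound p k n = A + B" by (simp add: sum_bound_def A_def B_def s_def r_def)
  have AB0: "A \<ge> 0" "B \<ge> 0" by (auto simp: A_def B_def)
  have L1: "L \<ge> 1" by (simp add: L_def)
  have p1: "real p \<ge> 1" using prime_gt_0_nat[OF prime_p] by simp
  have "gcd r (p - 1) > 0" using r_pos by simp
  then have "real 1 \<le> real (gcd r (p - 1))" by (intro of_nat_mono) linarith
  then have s1: "s \<ge> 1" by (simp only: s_def of_nat_1)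
  have pos: "real k > 0" "real n > 0" "real r > 0" "real p > 0" "s > 0"
    using k_pos k_less r_pos p1 s1 by auto
  have kr: "real k' = real k / real r"
    using arg_cong[OF k_eq, of real] pos by (simp add: field_simps)
  have Dr: "real D = real k * real n / real r"
    by (simp add: D_eq kr mult.commute)
  have pw: "(x powr e) ^ 4 = x powr (4 * e)" if "x > 0" for x e :: real
    using that by (simp add: powr_powr mult.commute flip: powr_realpow)
  have s2: "s powr 2 = s\<^sup>2" using pos by (simp add: powr_numeral)
  have A4: "A ^ 4 = s\<^sup>2 * (real p)\<^sup>2 * (real k' * sqrt (real n) * real p)"
  proof -
    have "real p powr 3 = (real p)\<^sup>2 * real p" using pos by (simp add: powr_numeral power2_eq_square power3_eq_cube)
    moreover have "(s powr (1/2)) ^ 4 = s\<^sup>2" using pw[OF pos(5), of "1/2"] s2 by simp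
    ultimately show ?thesis unfolding A_def power_mult_distrib power_divide
      using pos by (simp add: pw kr powr_half_sqrt)
  qed
  have B4: "B ^ 4 = s\<^sup>2 * (real p)\<^sup>2 * (real D powr (4/3) * real p powr (2/3))"
  proof -
    have "real p powr (8/3) = real p powr (2 + 2/3)" by simp
    also have "\<dots> = real p powr 2 * real p powr (2/3)" by (rule powr_add)
    also have "real p powr 2 = (real p)\<^sup>2" using pos by (simp add: powr_numeral)
    finally have p83: "real p powr (8/3) = (real p)\<^sup>2 * real p powr (2/3)" .
    have "(s powr (1/2)) ^ 4 = s\<^sup>2" using pw[OF pos(5), of "1/2"] s2 by simp
    moreover have "real D > 0" using D_ge k_less by simp
    ultimately show ?thesis unfolding B_def power_mult_distrib Dr[symmetric]
      using pos by (simp add: pw p83)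
  qed
  define Y where "Y = s\<^sup>2 * (real p)\<^sup>2 * main_size"
  have Y: "Y = A ^ 4 + B ^ 4" unfolding A4 B4 Y_def main_size_def by (simp add: algebra_simps)
  have Y1: "Y \<ge> 1"
  proof -
    have "real k' * sqrt (real n) * real p \<ge> 1 * 1 * 1"
      using k'_pos k_less p1 by (intro mult_mono) auto
    then have "main_size \<ge> 1" unfolding main_size_def by (simp add: add_increasing2)
    then have "1 * 1 * 1 \<le> s\<^sup>2 * (real p)\<^sup>2 * main_size"
      using s1 p1 by (intro mult_mono one_le_power) auto
    then show ?thesis by (simp add: Y_def)
  qed
  define \<alpha> \<beta> :: 'a where "\<alpha> = of_int a" and "\<beta> = of_int b"
  have nz: "\<alpha> \<noteq> 0" "\<beta> \<noteq> 0" using ab by (simp_all add: \<alpha>_def \<beta>_def of_int_eq_0)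
  define \<tau> where "\<tau> = cmod (T \<alpha> \<beta>)"
  have "binomial_exp_sum p k n a b = (\<Sum>x\<in>UNIV. \<psi> (\<alpha> * x ^ k + \<beta> * x ^ n))"
    by (simp add: binomial_exp_sum_eq \<alpha>_def \<beta>_def)
  also have "\<dots> = \<psi> (\<alpha> * 0 ^ k + \<beta> * 0 ^ n) + T \<alpha> \<beta>"
    unfolding T_def by (rule sum.remove) auto
  also have "\<psi> (\<alpha> * 0 ^ k + \<beta> * 0 ^ n) = 1" using k_pos k_less by (simp add: \<psi>_0 power_0_left)
  finally have "cmod (binomial_exp_sum p k n a b) \<le> 1 + \<tau>"
    unfolding \<tau>_def using norm_triangle_ineq[of 1 "T \<alpha> \<beta>"] by simp
  moreover have "(1 + \<tau>) ^ 4 \<le> (5 * L * (A + B)) ^ 4"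
  proof -
    have \<tau>0: "\<tau> \<ge> 0" by (simp add: \<tau>_def)
    have "\<tau> ^ 4 \<le> s\<^sup>2 * (real p)\<^sup>2 * real (card curve_pts)"
      unfolding \<tau>_def s_def by (rule T_fourth_power[OF nz])
    also have "\<dots> \<le> s\<^sup>2 * (real p)\<^sup>2 * (21 * L ^ 4 * main_size)"
      unfolding L_def by (intro mult_left_mono card_curve_pts_bound[OF r]) auto
    also have "\<dots> = 21 * L ^ 4 * Y" by (simp add: Y_def)
    finally have \<tau>4: "\<tau> ^ 4 \<le> 21 * L ^ 4 * Y" .
    have one: "1 \<le> 21 * L ^ 4 * Y"
    proof -
      have "1 * 1 * 1 \<le> 21 * L ^ 4 * Y" using Y1 L1 by (intro mult_mono one_le_power) auto
      then show ?thesis by simp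
    qed
    \<comment> \<open>The term x = 0 contributes 1, absorbed through 1 + \<tau> <= 2 max 1 \<tau>;
      the constants fit because 16 * 21 <= 5^4.\<close>
    have "(1 + \<tau>) ^ 4 \<le> (2 * max 1 \<tau>) ^ 4" using \<tau>0 by (intro power_mono) auto
    also have "\<dots> = 16 * max 1 \<tau> ^ 4" by (simp add: power_mult_distrib)
    also have "max 1 \<tau> ^ 4 \<le> 21 * L ^ 4 * Y" using \<tau>4 one by (simp add: max_def)
    also have "16 * (21 * L ^ 4 * Y) \<le> 625 * (L ^ 4 * Y)" using L1 Y1 by simp
    also have "\<dots> = (5 * L) ^ 4 * (A ^ 4 + B ^ 4)" by (simp add: power_mult_distrib Y)
    also have "A ^ 4 + B ^ 4 \<le> (A + B) ^ 4"
    proof -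
      have "(A + B) ^ 4 = A ^ 4 + B ^ 4 + (4 * A ^ 3 * B + 6 * A ^ 2 * B ^ 2 + 4 * A * B ^ 3)"
        by (simp add: power4_eq_xxxx power3_eq_cube power2_eq_square algebra_simps)
      moreover have "4 * A ^ 3 * B + 6 * A ^ 2 * B ^ 2 + 4 * A * B ^ 3 \<ge> 0" using AB0 by simp
      ultimately show ?thesis by linarith
    qed
    finally show ?thesis using L1 by (simp add: power_mult_distrib)
  qed
  then have "1 + \<tau> \<le> 5 * L * (A + B)"
    by (rule power_le_imp_le_base[where n = 3, unfolded numeral_eq_Suc, simplified, unfolded numeral_eq_Suc, simplified]) (use L1 AB0 in auto)
  ultimately have "cmod (binomial_exp_sum p k n a b) \<le> 5 * L * (A + B)" by linarith
  then show ?thesis by (simp add: AB L_def)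
qed

end

definition bound_at :: "nat \<Rightarrow> bool" where
  "bound_at p \<longleftrightarrow> (\<forall>k n a b. 0 < k \<and> k < n \<and> real (gcd k n) \<le> sqrt (real n) \<and> \<not> int p dvd a \<and> \<not> int p dvd b
     \<longrightarrow> cmod (binomial_exp_sum p k n a b) \<le> 10 * 5103 ^ 19 * sum_bound p k n)"

text \<open>The bound is proved over a field type with \<open>p\<close> elements, and a type cannot depend on a bound
  variable \<open>p\<close>. Hence it is proved for one fixed prime only, chosen to be a counterexample if there
  is any.\<close>

definition test_prime :: nat where
  "test_prime = (if \<exists>p. prime p \<and> \<not> bound_at p then SOME p. prime p \<and> \<not> bound_at p else 2)"

lemma test_prime: "prime test_prime"
proof (cases "\<exists>p. prime p \<and> \<not> bound_at p")
  case True
  then show ?thesis unfolding test_prime_def if_P[OF True] using someI_ex[OF True] by blast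
next
  case False
  show ?thesis unfolding test_prime_def if_not_P[OF False] by (rule two_is_prime_nat)
qed

typedef index = "{0..<test_prime}"
  using prime_gt_0_nat[OF test_prime] by (intro exI[of _ 0]) simp

lemma card_index: "CARD(index) = test_prime"
  using type_definition.card[OF type_definition_index] by simp

instance index :: finite
  by standard (metis card_index test_prime card.infinite not_prime_0)

instance index :: prime_card
  by standard (simp add: card_index test_prime)

lemma prime_order_field_mod_ring:
  "prime_order_field TYPE('a::prime_card mod_ring) CARD('a)"
proof
  show "prime CARD('a)" by (rule prime_card)
  show "CARD('a mod_ring) = CARD('a)" by simp
  show "of_nat j = (0::'a mod_ring) \<longleftrightarrow> CARD('a) dvd j" for j
    by (simp add: of_nat_eq_0_iff_char_dvd)
  show "a ^ CARD('a) = a" for a :: "'a mod_ring"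
    using finite_field_power_card_eq_same[of a] by simp
qed

lemma bound_at_prime: assumes "prime p" shows "bound_at p"
proof (rule ccontr)
  assume "\<not> bound_at p"
  then have ex: "\<exists>p. prime p \<and> \<not> bound_at p" using assms by blast
  have "\<not> bound_at test_prime"
    unfolding test_prime_def if_P[OF ex] using someI_ex[OF ex] by blast
  moreover have "bound_at test_prime"
    unfolding bound_at_def
  proof (intro allI impI, elim conjE)
    fix k n a b
    assume kn: "0 < k" "k < n" and r: "real (gcd k n) \<le> sqrt (real n)" and ab: "\<not> int test_prime dvd a" "\<not> int test_prime dvd b"
    interpret prime_order_field test_prime "TYPE(index mod_ring)"
      using prime_order_field_mod_ring[where 'a = index] by (simp only: card_index)
    interpret binomial_curve test_prime "TYPE(index mod_ring)" k n
      by unfold_locales (fact kn)+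
    show "cmod (binomial_exp_sum test_prime k n a b) \<le> 10 * 5103 ^ 19 * sum_bound test_prime k n"
      by (rule binomial_exp_sum_bound[OF r[folded r_def] ab])
  qed
  ultimately show False by blast
qed

text \<open>The bound is not symmetric, but everything above assumes k < n. Exchanging the two moves
  the exponent 1/4 from the larger to the smaller number, so the result for the exchanged pair is at
  least as strong.\<close>

lemma sum_bound_swap_le:
  assumes "n \<le> k" shows "sum_bound p n k \<le> sum_bound p k n"
proof -
  have e: "z powr (1/4) = z powr (1/8) * z powr (1/8)" for z :: real by (simp flip: powr_add)
  have "real n powr (1/8) \<le> real k powr (1/8)" using assms by (intro powr_mono2) auto
  then have "real n powr (1/8) * (real n powr (1/8) * real k powr (1/8)) \<le> real k powr (1/8) * (real n powr (1/8) * real k powr (1/8))"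
    by (intro mult_right_mono) auto
  then have "real n powr (1/4) * real k powr (1/8) \<le> real k powr (1/4) * real n powr (1/8)"
    by (simp add: e mult_ac)
  then have "real n powr (1/4) * real k powr (1/8) * (real (gcd (gcd k n) (p - 1)) powr (1/2) * real p powr (3/4)
       / real (gcd k n) powr (1/4)) \<le> real k powr (1/4) * real n powr (1/8) * (real (gcd (gcd k n) (p - 1)) powr (1/2) * real p powr (3/4)
       / real (gcd k n) powr (1/4))" by (intro mult_right_mono) auto
  then show ?thesis by (simp add: sum_bound_def gcd.commute[of n k] mult.commute[of "real n" "real k"])
qed

lemma binomial_exp_sum_swap: "binomial_exp_sum p k n a b = binomial_exp_sum p n k b a"
  by (simp add: binomial_exp_sum_def add.commute)

theorem theorem3p4:
  "\<exists>c::real. c > 0 \<and>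
    (\<forall>p k n r s :: nat.
       prime p \<and> 1 \<le> k \<and> k < p \<and> 1 \<le> n \<and> n < p \<and> k \<noteq> n \<and>
       r = gcd k n \<and> s = gcd r (p - 1) \<and> real r \<le> 0.5 * sqrt (real n) \<longrightarrow>
       \<bar>max_exp_sum p k n\<bar> \<le>
         c * (real k powr (1/4) * real n powr (1/8) * real s powr (1/2) * real p powr (3/4)
                / real r powr (1/4)
              + (real k * real n / real r) powr (1/3) * real s powr (1/2) * real p powr (2/3)))"
proof (intro exI[of _ "10 * 5103 ^ 19"] conjI allI impI)
  show "(0::real) < 10 * 5103 ^ 19" by simp
next
  fix p k n r s :: nat
  assume "prime p \<and> 1 \<le> k \<and> k < p \<and> 1 \<le> n \<and> n < p \<and> k \<noteq> n \<and>
       r = gcd k n \<and> s = gcd r (p - 1) \<and> real r \<le> 0.5 * sqrt (real n)"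
  then have p: "prime p" and kn: "0 < k" "0 < n" "k \<noteq> n"
    and rs: "r = gcd k n" "s = gcd (gcd k n) (p - 1)" and r: "real (gcd k n) \<le> 0.5 * sqrt (real n)" by auto
  have "0 \<le> sqrt (real n)" by simp
  with r have r': "real (gcd k n) \<le> sqrt (real n)" by linarith
  note bound = bound_at_prime[OF p, unfolded bound_at_def, rule_format]
  have each: "cmod (binomial_exp_sum p k n a b) \<le> 10 * 5103 ^ 19 * sum_bound p k n"
    if g: "gcd (a * b) (int p) = 1" for a b
  proof -
    have nd: "\<not> int p dvd a" "\<not> int p dvd b"
    proof -
      have "\<not> int p dvd a * b"
      proof
        assume "int p dvd a * b"
        then have "int p dvd gcd (a * b) (int p)" by simp
        then have "int p dvd 1" by (simp only: g)
        then show False using prime_gt_1_nat[OF p] by simp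
      qed
      then show "\<not> int p dvd a" "\<not> int p dvd b" by auto
    qed
    show ?thesis
    proof (cases "k < n")
      case True
      with bound[of k n a b] kn r' nd show ?thesis by blast
    next
      case False
      then have nk: "n < k" using kn by simp
      \<comment> \<open>With exchanged roles r must be compared with sqrt k, which is the larger
        root here.\<close>
      have "sqrt (real n) \<le> sqrt (real k)" using nk by simp
      with r' have "real (gcd k n) \<le> sqrt (real k)" by linarith
      then have "real (gcd n k) \<le> sqrt (real k)" by (simp only: gcd.commute)
      with bound[of n k b a] kn nk nd have "cmod (binomial_exp_sum p n k b a) \<le> 10 * 5103 ^ 19 * sum_bound p n k" by blast
      also have "\<dots> \<le> 10 * 5103 ^ 19 * sum_bound p k n"
        using sum_bound_swap_le[of n k p] nk by (intro mult_left_mono) auto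
      finally show ?thesis by (simp only: binomial_exp_sum_swap[of p k n])
    qed
  qed
  let ?M = "{cmod (binomial_exp_sum p k n a b) | a b :: int. gcd (a * b) (int p) = 1}"
  have "cmod (binomial_exp_sum p k n 1 1) \<in> ?M" by (intro CollectI exI[of _ 1] conjI) simp_all
  then have "?M \<noteq> {}" by (metis empty_iff)
  with finite_exp_sum_norms[of p k n] prime_gt_0_nat[OF p] have "max_exp_sum p k n \<in> ?M"
    unfolding max_exp_sum_def by (intro Max_in)
  then have "\<exists>a b. max_exp_sum p k n = cmod (binomial_exp_sum p k n a b) \<and> gcd (a * b) (int p) = 1"
    by (rule CollectD)
  then obtain a b where "max_exp_sum p k n = cmod (binomial_exp_sum p k n a b)" "gcd (a * b) (int p) = 1"
    by (elim exE conjE)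
  with each[of a b] have "\<bar>max_exp_sum p k n\<bar> \<le> 10 * 5103 ^ 19 * sum_bound p k n" by simp
  then show "\<bar>max_exp_sum p k n\<bar> \<le> 10 * 5103 ^ 19 * (real k powr (1/4) * real n powr (1/8) * real s powr (1/2) * real p powr (3/4)
                / real r powr (1/4)
              + (real k * real n / real r) powr (1/3) * real s powr (1/2) * real p powr (2/3))"
    by (simp only: sum_bound_def rs)
qed

end
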